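(* A group $H$ is isomorphic to a solvable subgroup of $PL_o(I)$ if and only if $H$ is isomorphic to a group in the class $\mathscr{R}$.
   Context: $PL_o(I)$ denotes the group of orientation-preserving piecewise-linear homeomorphisms of the unit interval $I=[0,1]$ having finitely many breaks in slope, under composition. For a group $A$, $A\wr\mathbf{Z}$ denotes the restricted wreath product $(\bigoplus_{i\in\mathbf{Z}}A)\rtimes\mathbf{Z}$, where the generator of $\mathbf{Z}$ acts by shifting the index. A bounded direct sum is a countable direct sum of groups for which there is a uniform upper bound on the lengths of their derived series. $\mathscr{R}$ is the smallest non-empty class of groups closed under the three operations: (1) $A\mapsto A\wr\mathbf{Z}$; (2) bounded direct sums of groups in the class; (3) taking subgroups. *)

theory Defs
  imports Complex_Main "HOL-Algebra.Solvable_Groups"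
begin

definition piecewise_linear_I :: "(real \<Rightarrow> real) \<Rightarrow> bool" where
  "piecewise_linear_I f \<longleftrightarrow>
     (\<exists>xs. length xs \<ge> 2 \<and> sorted_wrt (<) xs \<and> hd xs = 0 \<and> last xs = 1 \<and>
        (\<forall>i. Suc i < length xs \<longrightarrow>
           (\<exists>a b. \<forall>x \<in> {xs ! i .. xs ! Suc i}. f x = a * x + b)))"

text \<open>Orientation-preserving PL homeomorphisms of I=[0,1]. To make composition a group
  operation with equality of HOL functions, maps are normalised to be the identity
  outside [0,1].\<close>
definition PLo_set :: "(real \<Rightarrow> real) set" where
  "PLo_set = {f. continuous_on {0..1} f \<and> bij_betw f {0..1} {0..1}
                 \<and> strict_mono_on {0..1} f \<and> piecewise_linear_I f
                 \<and> (\<forall>x. x \<notin> {0..1} \<longrightarrow> f x = x)}"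

definition PLo_I :: "(real \<Rightarrow> real) monoid" where
  "PLo_I = \<lparr> carrier = PLo_set, mult = (\<circ>), one = id \<rparr>"

definition wreath_Z :: "('a, 'b) monoid_scheme \<Rightarrow> ((int \<Rightarrow> 'a) \<times> int) monoid" where
  "wreath_Z A = \<lparr> carrier = {(f, k). (\<forall>i. f i \<in> carrier A) \<and> finite {i. f i \<noteq> \<one>\<^bsub>A\<^esub>}},
      mult = (\<lambda>(f, m) (g, n). (\<lambda>i. f i \<otimes>\<^bsub>A\<^esub> g (i - m), m + n)),
      one = (\<lambda>i. \<one>\<^bsub>A\<^esub>, 0) \<rparr>"

definition dsum :: "(nat \<Rightarrow> ('a, 'b) monoid_scheme) \<Rightarrow> (nat \<Rightarrow> 'a) monoid" where
  "dsum A = \<lparr> carrier = {f. (\<forall>i. f i \<in> carrier (A i)) \<and> finite {i. f i \<noteq> \<one>\<^bsub>A i\<^esub>}},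
      mult = (\<lambda>f g i. f i \<otimes>\<^bsub>A i\<^esub> g i),
      one = (\<lambda>i. \<one>\<^bsub>A i\<^esub>) \<rparr>"

definition derived_length_le :: "('a, 'b) monoid_scheme \<Rightarrow> nat \<Rightarrow> bool" where
  "derived_length_le G n \<longleftrightarrow> (derived G ^^ n) (carrier G) = {\<one>\<^bsub>G\<^esub>}"

text \<open>All groups in R are countable, so R is represented (up to isomorphism) by groups
  whose carrier is a subset of nat. A class C of such groups is closed if it is closed
  (up to isomorphism) under the three operations.\<close>
definition R_closed :: "nat monoid set \<Rightarrow> bool" where
  "R_closed C \<longleftrightarrow>
     (\<forall>G \<in> C. group G) \<and>
     (\<forall>A \<in> C. \<forall>G :: nat monoid. group G \<and> G \<cong> wreath_Z A \<longrightarrow> G \<in> C) \<and>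
     (\<forall>A :: nat \<Rightarrow> nat monoid. (\<forall>i. A i \<in> C) \<and> (\<exists>n. \<forall>i. derived_length_le (A i) n) \<longrightarrow>
        (\<forall>G :: nat monoid. group G \<and> G \<cong> dsum A \<longrightarrow> G \<in> C)) \<and>
     (\<forall>A \<in> C. \<forall>K. subgroup K A \<longrightarrow> A\<lparr>carrier := K\<rparr> \<in> C)"

definition R_class :: "nat monoid set" where
  "R_class = \<Inter> {C. C \<noteq> {} \<and> R_closed C}"

end

theory Submission
  imports "HOL-Library.Countable_Set" Defs
begin

text \<open>
  Realising the operations of the class R: finitely many nontrivial elements supported in disjoint
  intervals can be glued, which gives direct sums. Placing a copy of A in a fundamental domain of a
  one-bump map g gives the wreath product of A with the integers.

  Conversely, induct on the derived length of a subgroup H. An element of H is nontrivial on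
  finitely many orbitals of H (components of the complement of the global fixed point set), because
  a nontrivial affine piece is not fixed at both ends; so H embeds in the direct sum of its
  restrictions to the orbitals. If H has a single orbital (a, b), let K be the normal subgroup of
  elements with trivial germs at a and b. Its elements have compact support in (a, b), and if K had
  no fixed point in (a, b), it could move supports off one another, so that every commutator would
  be a commutator of commutators; solvability forbids this. Hence the set F of fixed points of K is
  nonempty and H acts on it through the abelian group H/K. It follows that elements outside K have
  no fixed points in (a, b), and that the slopes at a form a discrete group, since affine maps do
  not intertwine multiplicative scalings at a and at b. So H is generated by K and one element g,
  and for p in F the group H embeds in the wreath product of the restriction of K to (p, g p) with
  the integers. Each k in K agrees on (p, g p) with a commutator of k and a power of g, so this
  restriction has smaller derived length.
\<close>

subsection \<open>Piecewise linear homeomorphisms of the line\<close>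

text \<open>Splitting into orbitals does not lower the derived length. It keeps one bound for all
  factors, because restriction is a homomorphism, and this uniform bound is what a bounded direct
  sum asks for when there are infinitely many orbitals. The length drops only in the one-orbital
  step. There K contains the derived subgroup of H, which by itself bounds nothing; only after
  restriction to (p, g p) does K coincide with that derived subgroup. The base point p has to lie in
  F: then K fixes every point g^i p, hence preserves the intervals between them, and these intervals
  become the coordinates of the wreath product. The slope at a alone decides membership in K, so H/K
  is a subgroup of the positive reals, and a gap above 1 makes it infinite cyclic. That gap is where
  the two ends of the orbital are compared.\<close>

abbreviation finv :: "(real \<Rightarrow> real) \<Rightarrow> real \<Rightarrow> real" where
  "finv f \<equiv> inv_into UNIV f"

text \<open>The set S only has to contain the breaks. Such supersets can be united and moved by maps
  without any ordering; the sorted lists of \<open>piecewise_linear_I\<close> enter only through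
  \<open>PLo_set_iff\<close>.\<close>

definition aff_off :: "real set \<Rightarrow> (real \<Rightarrow> real) \<Rightarrow> bool" where
  "aff_off S f \<longleftrightarrow>
     (\<forall>u v. u < v \<and> {u<..<v} \<inter> S = {} \<longrightarrow> (\<exists>a b. \<forall>x\<in>{u<..<v}. f x = a * x + b))"

lemma aff_offE:
  assumes "aff_off S f" "u < v" "{u<..<v} \<inter> S = {}"
  obtains a b where "\<And>x. x \<in> {u<..<v} \<Longrightarrow> f x = a * x + b"
  using assms unfolding aff_off_def by blast

definition pl_homeo :: "(real \<Rightarrow> real) \<Rightarrow> bool" where
  "pl_homeo f \<longleftrightarrow> strict_mono f \<and> surj f \<and> (\<exists>S. finite S \<and> aff_off S f)"

lemma pl_homeoD:
  assumes "pl_homeo f"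
  shows "strict_mono f" "surj f" "inj f"
  using assms by (auto simp: pl_homeo_def strict_mono_imp_inj_on)

lemma pl_homeo_less_iff: "pl_homeo f \<Longrightarrow> f x < f y \<longleftrightarrow> x < y"
  by (simp add: pl_homeoD strict_mono_less)

lemma pl_homeo_le_iff: "pl_homeo f \<Longrightarrow> f x \<le> f y \<longleftrightarrow> x \<le> y"
  by (simp add: pl_homeoD strict_mono_less_eq)

lemma pl_homeo_eq_iff: "pl_homeo f \<Longrightarrow> f x = f y \<longleftrightarrow> x = y"
  by (simp add: pl_homeoD strict_mono_eq)

lemma pl_homeo_continuous: "pl_homeo f \<Longrightarrow> continuous_on UNIV f"
  by (rule continuous_onI_mono) (auto simp: pl_homeoD(2) pl_homeo_le_iff)

lemma pl_homeo_inv_apply [simp]: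
  assumes "pl_homeo f"
  shows "f (finv f x) = x" "finv f (f x) = x"
  using pl_homeoD[OF assms] by (auto simp: surj_f_inv_f)

lemma finv_less_iff:
  assumes "pl_homeo f"
  shows "finv f x < y \<longleftrightarrow> x < f y" "y < finv f x \<longleftrightarrow> f y < x"
  using pl_homeo_less_iff[OF assms, of "finv f x" y] pl_homeo_less_iff[OF assms, of y "finv f x"]
    assms by auto

lemma affine_pl_homeo:
  assumes "c > 0"
  shows "pl_homeo (\<lambda>x. c * x + d)"
proof -
  have "surj (\<lambda>x. c * x + d)"
    by (rule surjI[where f="\<lambda>y. (y - d) / c"]) (use assms in auto)
  moreover have "strict_mono (\<lambda>x. c * x + d)"
    using assms by (auto simp: strict_mono_def)
  moreover have "aff_off {} (\<lambda>x. c * x + d)"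
    by (auto simp: aff_off_def)
  ultimately show ?thesis unfolding pl_homeo_def by blast
qed

lemma id_pl_homeo: "pl_homeo id"
  using affine_pl_homeo[of 1 0] by (simp add: id_def)

lemma pl_homeo_comp:
  assumes f: "pl_homeo f" and g: "pl_homeo g"
  shows "pl_homeo (f \<circ> g)"
proof -
  obtain S T where S: "finite S" "aff_off S f" and T: "finite T" "aff_off T g"
    using f g unfolding pl_homeo_def by blast
  have fin: "finite (T \<union> finv g ` S)"
    using S T by simp
  have "aff_off (T \<union> finv g ` S) (f \<circ> g)"
    unfolding aff_off_def
  proof (intro allI impI, elim conjE)
    fix u v :: real assume uv: "u < v" and dis: "{u<..<v} \<inter> (T \<union> finv g ` S) = {}"
    obtain a b where ab: "\<And>x. x \<in> {u<..<v} \<Longrightarrow> g x = a * x + b"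
      using aff_offE[OF T(2) uv] dis by (metis Int_Un_distrib sup_eq_bot_iff)
    have "{g u<..<g v} \<inter> S = {}"
    proof (rule ccontr)
      assume "{g u<..<g v} \<inter> S \<noteq> {}"
      then obtain s where s: "s \<in> S" "g u < s" "s < g v" by auto
      then have "u < finv g s" "finv g s < v"
        using g by (auto simp: finv_less_iff)
      then show False using dis s by auto
    qed
    then obtain c d where cd: "\<And>x. x \<in> {g u<..<g v} \<Longrightarrow> f x = c * x + d"
      using S uv g unfolding aff_off_def by (metis pl_homeo_less_iff)
    have "(f \<circ> g) x = (c * a) * x + (c * b + d)" if "x \<in> {u<..<v}" for x
    proof -
      have "g x \<in> {g u<..<g v}" using that g by (simp add: pl_homeo_less_iff)
      from cd[OF this] show ?thesis using ab[OF that] by (simp add: algebra_simps)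
    qed
    then show "\<exists>a b. \<forall>x\<in>{u<..<v}. (f \<circ> g) x = a * x + b" by blast
  qed
  moreover have "strict_mono (f \<circ> g)"
    using f g by (simp add: strict_mono_def pl_homeo_less_iff)
  moreover have "surj (f \<circ> g)"
    using pl_homeoD(2)[OF f] pl_homeoD(2)[OF g] by (rule comp_surj[rotated])
  ultimately show ?thesis unfolding pl_homeo_def using fin by blast
qed

lemma pl_homeo_inv:
  assumes f: "pl_homeo f"
  shows "pl_homeo (finv f)"
proof -
  obtain S where S: "finite S" "aff_off S f"
    using f unfolding pl_homeo_def by blast
  have "aff_off (f ` S) (finv f)"
    unfolding aff_off_def
  proof (intro allI impI, elim conjE)
    fix u v :: real assume uv: "u < v" and dis: "{u<..<v} \<inter> f ` S = {}"
    have mono: "finv f x < finv f y \<longleftrightarrow> x < y" for x y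
      using f by (simp add: finv_less_iff)
    have "{finv f u<..<finv f v} \<inter> S = {}"
    proof (rule ccontr)
      assume "{finv f u<..<finv f v} \<inter> S \<noteq> {}"
      then obtain s where s: "s \<in> S" "finv f u < s" "s < finv f v" by auto
      then have "u < f s" "f s < v"
        using f by (auto simp: finv_less_iff)
      then show False using dis s by auto
    qed
    then obtain c d where cd: "\<And>x. x \<in> {finv f u<..<finv f v} \<Longrightarrow> f x = c * x + d"
      using S uv mono unfolding aff_off_def by metis
    have fi: "x = c * finv f x + d" if "x \<in> {u<..<v}" for x
      using cd[of "finv f x"] that f mono by simp
    have "c \<noteq> 0"
    proof
      assume "c = 0"
      obtain x where "u < x" "x < v" using uv dense by blast
      moreover obtain y where "x < y" "y < v" using \<open>x < v\<close> dense by blast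
      ultimately show False using fi[of x] fi[of y] \<open>c = 0\<close> by auto
    qed
    then have "finv f x = (1 / c) * x + (- d / c)" if "x \<in> {u<..<v}" for x
      using fi[OF that] by (simp add: field_simps)
    then show "\<exists>a b. \<forall>x\<in>{u<..<v}. finv f x = a * x + b" by blast
  qed
  moreover have "strict_mono (finv f)"
    using f by (simp add: finv_less_iff strict_mono_def)
  moreover have "surj (finv f)"
    using pl_homeoD(3)[OF f] by (simp add: inj_imp_surj_inv)
  ultimately show ?thesis unfolding pl_homeo_def using S by blast
qed

definition restr :: "real \<Rightarrow> real \<Rightarrow> (real \<Rightarrow> real) \<Rightarrow> real \<Rightarrow> real" where
  "restr a b f x = (if a < x \<and> x < b then f x else x)"

lemma pl_homeo_restr:
  assumes f: "pl_homeo f" and ab: "f a = a" "f b = b"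
  shows "pl_homeo (restr a b f)"
proof -
  have in_iff: "a < f x \<longleftrightarrow> a < x" "f x < b \<longleftrightarrow> x < b" for x
    using pl_homeo_less_iff[OF f, of a x] pl_homeo_less_iff[OF f, of x b] ab by auto
  obtain S where S: "finite S" "aff_off S f"
    using f unfolding pl_homeo_def by blast
  have "aff_off (S \<union> {a, b}) (restr a b f)"
    unfolding aff_off_def
  proof (intro allI impI, elim conjE)
    fix u v :: real assume uv: "u < v" and dis: "{u<..<v} \<inter> (S \<union> {a, b}) = {}"
    obtain c d where cd: "\<And>x. x \<in> {u<..<v} \<Longrightarrow> f x = c * x + d"
      using aff_offE[OF S(2) uv] dis by (metis Int_Un_distrib sup_eq_bot_iff)
    have "a \<le> u \<or> v \<le> a" "b \<le> u \<or> v \<le> b"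
      using dis by auto
    then consider "\<forall>x\<in>{u<..<v}. a < x \<and> x < b" | "\<forall>x\<in>{u<..<v}. \<not> (a < x \<and> x < b)"
      by fastforce
    then show "\<exists>a' b'. \<forall>x\<in>{u<..<v}. restr a b f x = a' * x + b'"
    proof cases
      case 1
      then show ?thesis using cd unfolding restr_def by metis
    next
      case 2
      then have "\<forall>x\<in>{u<..<v}. restr a b f x = 1 * x + 0" by (auto simp: restr_def)
      then show ?thesis by blast
    qed
  qed
  moreover have "strict_mono (restr a b f)"
  proof (rule strict_monoI)
    fix x y :: real assume "x < y"
    then show "restr a b f x < restr a b f y"
      using f in_iff[of x] in_iff[of y] unfolding restr_def
      by (auto simp: pl_homeo_less_iff)
  qed
  moreover have "surj (restr a b f)"
  proof (rule surjI[where f="restr a b (finv f)"])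
    fix y show "restr a b f (restr a b (finv f) y) = y"
      using f in_iff[of "finv f y"] unfolding restr_def by auto
  qed
  ultimately show ?thesis unfolding pl_homeo_def using S by (meson finite.emptyI finite.insertI finite_UnI)
qed

text \<open>Both ends are reached as one-sided limits of the affine expression. This leads from the
  open pieces of \<open>aff_off\<close> to the closed pieces of \<open>piecewise_linear_I\<close>
  and to germs at a break.\<close>

lemma affine_extend:
  assumes f: "continuous_on UNIV f" and uv: "(u::real) < v"
    and ab: "\<And>x. x \<in> {u<..<v} \<Longrightarrow> f x = a * x + (b::real)" and x: "x \<in> {u..v}"
  shows "f x = a * x + b"
proof -
  have ic: "isCont f x" for x
    using f by (simp add: continuous_on_eq_continuous_at)
  have "f u = a * u + b"
  proof (rule tendsto_unique)
    show "(f \<longlongrightarrow> f u) (at_right u)"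
      using ic[of u] by (simp add: continuous_at filterlim_at_split)
    have "((\<lambda>x. a * x + b) \<longlongrightarrow> a * u + b) (at_right u)" by (intro tendsto_intros)
    moreover have "\<forall>\<^sub>F x in at_right u. a * x + b = f x"
      using eventually_at_right_real[OF uv] by eventually_elim (simp add: ab)
    ultimately show "(f \<longlongrightarrow> a * u + b) (at_right u)" by (rule Lim_transform_eventually)
  qed simp
  moreover have "f v = a * v + b"
  proof (rule tendsto_unique)
    show "(f \<longlongrightarrow> f v) (at_left v)"
      using ic[of v] by (simp add: continuous_at filterlim_at_split)
    have "((\<lambda>x. a * x + b) \<longlongrightarrow> a * v + b) (at_left v)" by (intro tendsto_intros)
    moreover have "\<forall>\<^sub>F x in at_left v. a * x + b = f x"
      using eventually_at_left_real[OF uv] by eventually_elim (simp add: ab)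
    ultimately show "(f \<longlongrightarrow> a * v + b) (at_left v)" by (rule Lim_transform_eventually)
  qed simp
  ultimately show ?thesis using ab[of x] x by fastforce
qed

text \<open>The index is the largest one whose entry is at most u: the next entry exceeds u and, not
  lying in the gap, is at least v.\<close>

lemma sorted_list_gap:
  fixes xs :: "real list"
  assumes xs: "sorted_wrt (<) xs" "xs \<noteq> []" and uv: "hd xs \<le> u" "u < v" "v \<le> last xs"
    and dis: "{u<..<v} \<inter> set xs = {}"
  shows "\<exists>i. Suc i < length xs \<and> xs ! i \<le> u \<and> v \<le> xs ! Suc i"
proof -
  define I where "I = {i. i < length xs \<and> xs ! i \<le> u}"
  have fin: "finite I" by (simp add: I_def)
  moreover have "0 \<in> I" using xs uv by (auto simp: I_def hd_conv_nth)
  ultimately have "Max I \<in> I" using Max_in by blast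
  then have i: "Max I < length xs" "xs ! Max I \<le> u" by (auto simp: I_def)
  have "Max I \<noteq> length xs - 1"
    using i uv xs by (auto simp: last_conv_nth)
  then have s: "Suc (Max I) < length xs" using i by linarith
  have "Suc (Max I) \<notin> I" using Max_ge[OF fin] by (meson not_less_eq_eq order_refl)
  then have "xs ! Suc (Max I) > u" using s by (auto simp: I_def)
  moreover have "xs ! Suc (Max I) \<notin> {u<..<v}" using dis s nth_mem by blast
  ultimately show ?thesis using i s by (intro exI[of _ "Max I"]) auto
qed

text \<open>Extension by the identity makes the group act on the whole line, where composition,
  inverses and order need no side conditions about a domain.\<close>

lemma PLo_set_iff:
  "f \<in> PLo_set \<longleftrightarrow> pl_homeo f \<and> (\<forall>x. x \<notin> {0<..<1} \<longrightarrow> f x = x)"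
proof
  assume "f \<in> PLo_set"
  then have bij: "bij_betw f {0..1} {0..1}" and mono: "strict_mono_on {0..1} f"
    and pl: "piecewise_linear_I f" and out: "\<And>x. x \<notin> {0..1} \<Longrightarrow> f x = x"
    unfolding PLo_set_def by auto
  have img: "f x \<in> {0..1}" if "x \<in> {0..1}" for x
    using bij that bij_betwE by blast
  have f0: "f 0 = 0" "f 1 = 1"
  proof -
    obtain x where x: "x \<in> {0..1}" "f x = 0"
      using bij by (metis atLeastAtMost_iff bij_betw_iff_bijections le_numeral_extra(3) zero_le_one)
    then show "f 0 = 0" using mono img[of 0] unfolding strict_mono_on_def
      by (metis atLeastAtMost_iff less_eq_real_def not_less zero_le_one)
    obtain y where y: "y \<in> {0..1}" "f y = 1"
      using bij by (metis atLeastAtMost_iff bij_betw_iff_bijections order_refl zero_le_one)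
    then show "f 1 = 1" using mono img[of 1] unfolding strict_mono_on_def
      by (metis atLeastAtMost_iff less_eq_real_def not_less zero_le_one)
  qed
  have "strict_mono f"
  proof (rule strict_monoI)
    fix x y :: real assume "x < y"
    then show "f x < f y"
      using out[of x] out[of y] img[of x] img[of y] mono
      unfolding strict_mono_on_def by (cases "x \<in> {0..1}"; cases "y \<in> {0..1}") auto
  qed
  moreover have "surj f"
    unfolding surj_def
  proof
    fix y show "\<exists>x. y = f x"
      using bij out[of y] unfolding bij_betw_def by (cases "y \<in> {0..1}") (blast, metis)
  qed
  moreover have "\<exists>S. finite S \<and> aff_off S f"
  proof -
    obtain xs where xs: "length xs \<ge> 2" "sorted_wrt (<) xs" "hd xs = 0" "last xs = 1"
      and aff: "\<And>i. Suc i < length xs \<Longrightarrow> \<exists>a b. \<forall>x\<in>{xs ! i..xs ! Suc i}. f x = a * x + b"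
      using pl unfolding piecewise_linear_I_def by blast
    have ne: "xs \<noteq> []" using xs(1) by auto
    have mem: "0 \<in> set xs" "1 \<in> set xs"
      using ne xs(3,4) hd_in_set last_in_set by metis+
    have "aff_off (set xs) f"
      unfolding aff_off_def
    proof (intro allI impI, elim conjE)
      fix u v :: real assume uv: "u < v" and dis: "{u<..<v} \<inter> set xs = {}"
      then have "0 \<le> u \<or> v \<le> 0" "1 \<le> u \<or> v \<le> 1"
        using mem by (meson disjoint_iff greaterThanLessThan_iff linorder_not_le)+
      then consider "0 \<le> u" "v \<le> 1" | "v \<le> 0 \<or> 1 \<le> u" using uv by linarith
      then show "\<exists>a b. \<forall>x\<in>{u<..<v}. f x = a * x + b"
      proof cases
        case 1
        then obtain i where i: "Suc i < length xs" "xs ! i \<le> u" "v \<le> xs ! Suc i"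
          using sorted_list_gap[OF xs(2) ne, of u v] uv dis xs(3,4) by auto
        obtain a b where "\<forall>x\<in>{xs ! i..xs ! Suc i}. f x = a * x + b"
          using aff[OF i(1)] by blast
        then have "\<forall>x\<in>{u<..<v}. f x = a * x + b" using i by auto
        then show ?thesis by blast
      next
        case 2
        then have "\<forall>x\<in>{u<..<v}. f x = 1 * x + 0" using out by auto
        then show ?thesis by blast
      qed
    qed
    then show ?thesis by blast
  qed
  moreover have "f x = x" if "x \<notin> {0<..<1}" for x
    using that out[of x] f0 by fastforce
  ultimately show "pl_homeo f \<and> (\<forall>x. x \<notin> {0<..<1} \<longrightarrow> f x = x)"
    unfolding pl_homeo_def by blast
next
  assume "pl_homeo f \<and> (\<forall>x. x \<notin> {0<..<1} \<longrightarrow> f x = x)"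
  then have f: "pl_homeo f" and out: "\<And>x. x \<notin> {0<..<1} \<Longrightarrow> f x = x" by auto
  have f0: "f 0 = 0" "f 1 = 1" using out by auto
  have cont: "continuous_on UNIV f" using f by (rule pl_homeo_continuous)
  have "bij_betw f {0..1} {0..1}"
    unfolding bij_betw_def
  proof
    show "inj_on f {0..1}" using pl_homeoD(3)[OF f] inj_on_subset by blast
    show "f ` {0..1} = {0..1}"
    proof
      show "f ` {0..1} \<subseteq> {0..1}"
        using f f0 by (metis atLeastAtMost_iff image_subsetI pl_homeo_le_iff)
      show "{0..1} \<subseteq> f ` {0..1}"
      proof
        fix y :: real assume "y \<in> {0..1}"
        then have "finv f y \<in> {0..1}"
          using f f0 by (metis atLeastAtMost_iff pl_homeo_inv_apply(1) pl_homeo_le_iff)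
        then show "y \<in> f ` {0..1}" using f by (metis image_eqI pl_homeo_inv_apply(1))
      qed
    qed
  qed
  moreover have "piecewise_linear_I f"
  proof -
    obtain S where S: "finite S" "aff_off S f" using f unfolding pl_homeo_def by blast
    \<comment> \<open>The list has to begin at 0 and end at 1, so both are inserted; breaks outside
      the unit interval are dropped.\<close>
    define T where "T = insert 0 (insert 1 (S \<inter> {0..1}))"
    define xs where "xs = sorted_list_of_set T"
    have T: "finite T" "0 \<in> T" "1 \<in> T" "T \<subseteq> {0..1}" using S by (auto simp: T_def)
    have set: "set xs = T" using T by (simp add: xs_def)
    have sorted: "sorted_wrt (<) xs" by (simp add: xs_def)
    have ne: "xs \<noteq> []" using set T by auto
    have hd: "hd xs = 0"
    proof -
      obtain i where i: "i < length xs" "xs ! i = 0" using set T by (metis in_set_conv_nth)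
      have "xs ! 0 \<in> T" using set ne nth_mem by blast
      moreover have "i = 0 \<or> xs ! 0 < xs ! i"
        using sorted_wrt_nth_less[OF sorted, of 0 i] i by auto
      ultimately have "xs ! 0 = 0" using i T by auto
      then show ?thesis using ne by (simp add: hd_conv_nth)
    qed
    have last: "last xs = 1"
    proof -
      obtain i where i: "i < length xs" "xs ! i = 1" using set T by (metis in_set_conv_nth)
      have "xs ! (length xs - 1) \<in> T" using set ne nth_mem by (metis diff_less length_greater_0_conv zero_less_one)
      moreover have "i = length xs - 1 \<or> xs ! i < xs ! (length xs - 1)"
        using sorted_wrt_nth_less[OF sorted, of i "length xs - 1"] i by fastforce
      ultimately have "xs ! (length xs - 1) = 1" using i T by auto
      then show ?thesis using ne by (simp add: last_conv_nth)
    qed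
    have "\<exists>a b. \<forall>x\<in>{xs ! i..xs ! Suc i}. f x = a * x + b" if i: "Suc i < length xs" for i
    proof -
      have less: "xs ! i < xs ! Suc i" using sorted_wrt_nth_less[OF sorted, of i "Suc i"] i by simp
      have in01: "xs ! i \<in> {0..1}" "xs ! Suc i \<in> {0..1}"
        using set T i nth_mem Suc_lessD by (metis subsetD)+
      have "{xs ! i<..<xs ! Suc i} \<inter> T = {}"
      proof (rule ccontr)
        assume "\<not> ?thesis"
        then obtain j where j: "j < length xs" "xs ! i < xs ! j" "xs ! j < xs ! Suc i"
          using set by (auto simp: in_set_conv_nth)
        have "i < j" using j i sorted_wrt_nth_less[OF sorted, of j i]
          by (metis Suc_lessD linorder_neqE_nat order_less_asym order_less_irrefl)
        moreover have "j < Suc i" using j i sorted_wrt_nth_less[OF sorted, of "Suc i" j]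
          by (metis linorder_neqE_nat order_less_asym order_less_irrefl)
        ultimately show False by simp
      qed
      then have "{xs ! i<..<xs ! Suc i} \<inter> S = {}"
        using in01 by (auto simp: T_def)
      then obtain a b where "\<And>x. x \<in> {xs ! i<..<xs ! Suc i} \<Longrightarrow> f x = a * x + b"
        using aff_offE[OF S(2) less] by metis
      then have "\<forall>x\<in>{xs ! i..xs ! Suc i}. f x = a * x + b"
        using affine_extend[OF cont less] by blast
      then show ?thesis by blast
    qed
    moreover have "length xs \<ge> 2"
    proof -
      have "card T \<ge> card {0, 1::real}" using T by (intro card_mono) auto
      then show ?thesis using T by (simp add: xs_def)
    qed
    ultimately show ?thesis
      unfolding piecewise_linear_I_def using sorted hd last by blast
  qed
  ultimately show "f \<in> PLo_set"
    unfolding PLo_set_def using f out cont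
    by (auto simp: pl_homeo_less_iff strict_mono_on_def intro: continuous_on_subset)
qed

lemma PLo_I_simps [simp]:
  "carrier PLo_I = PLo_set" "mult PLo_I = (\<circ>)" "one PLo_I = id"
  by (simp_all add: PLo_I_def)

lemma PLo_setD:
  assumes "f \<in> PLo_set"
  shows "pl_homeo f" "x \<notin> {0<..<1} \<Longrightarrow> f x = x"
  using assms by (auto simp: PLo_set_iff)

lemma id_PLo: "id \<in> PLo_set"
  by (simp add: PLo_set_iff id_pl_homeo)

lemma comp_PLo: "f \<in> PLo_set \<Longrightarrow> g \<in> PLo_set \<Longrightarrow> f \<circ> g \<in> PLo_set"
  by (simp add: PLo_set_iff pl_homeo_comp)

lemma inv_PLo: "f \<in> PLo_set \<Longrightarrow> finv f \<in> PLo_set"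
  by (metis PLo_set_iff pl_homeo_inv pl_homeo_inv_apply(2))

lemma inv_comp_PLo: "f \<in> PLo_set \<Longrightarrow> finv f \<circ> f = id"
  by (simp add: PLo_setD fun_eq_iff)

lemma PLo_group: "group PLo_I"
  by (rule groupI) (auto simp: comp_PLo id_PLo comp_assoc intro: inv_PLo inv_comp_PLo)

lemma PLo_inv: "f \<in> PLo_set \<Longrightarrow> inv\<^bsub>PLo_I\<^esub> f = finv f"
  by (rule group.inv_equality[OF PLo_group]) (auto simp: inv_comp_PLo inv_PLo)

lemma restr_PLo:
  assumes "f \<in> PLo_set" "f a = a" "f b = b"
  shows "restr a b f \<in> PLo_set"
  using assms pl_homeo_restr[of f a b] by (auto simp: PLo_set_iff restr_def)

subsection \<open>Derived length and the class R\<close>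

text \<open>Derived series of subgroups can thus be computed with the ambient operator
  \<open>derived PLo_I\<close>, without changing the group structure.\<close>

lemma derived_exp_consistent:
  assumes "group G" "subgroup H G" "K \<subseteq> H"
  shows "(derived (G\<lparr>carrier := H\<rparr>) ^^ n) K = (derived G ^^ n) K \<and> (derived G ^^ n) K \<subseteq> H"
proof (induction n)
  case 0
  then show ?case using assms by simp
next
  case (Suc n)
  then show ?case
    using group.derived_consistent[OF assms(1) _ assms(2)] group.derived_incl[OF assms(1) _ assms(2)]
    by simp
qed

lemma derived_length_le_subgroup:
  assumes "group G" "subgroup H G"
  shows "derived_length_le (G\<lparr>carrier := H\<rparr>) n \<longleftrightarrow> (derived G ^^ n) H = {\<one>\<^bsub>G\<^esub>}"
  using derived_exp_consistent[OF assms order_refl] by (simp add: derived_length_le_def)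

lemma solvable_iff_derived_length_le:
  "group G \<Longrightarrow> solvable G \<longleftrightarrow> (\<exists>n. derived_length_le G n)"
  by (simp add: group.solvable_iff_trivial_derived_seq derived_length_le_def)

text \<open>Each \<open>\<Phi> i\<close> carries the n-th derived subgroup into the trivial one of
  its target, and the family separates elements from the identity. The principle serves embeddings
  (a one-element family), direct sums and the base of a wreath product (coordinates).\<close>

lemma derived_length_le_family:
  assumes G: "group G" and A: "\<And>i. group (A i)" "\<And>i. derived_length_le (A i) n"
    and hom: "\<And>i. \<Phi> i \<in> hom G (A i)"
    and sep: "\<And>x. x \<in> carrier G \<Longrightarrow> (\<And>i. \<Phi> i x = \<one>\<^bsub>A i\<^esub>) \<Longrightarrow> x = \<one>\<^bsub>G\<^esub>"
  shows "derived_length_le G n"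
proof -
  have sub: "subgroup ((derived G ^^ n) (carrier G)) G"
    using G by (simp add: group.exp_of_derived_is_subgroup group.subgroup_self)
  have "x = \<one>\<^bsub>G\<^esub>" if x: "x \<in> (derived G ^^ n) (carrier G)" for x
  proof (rule sep)
    show "x \<in> carrier G" using x sub subgroup.subset by blast
    fix i
    have gh: "group_hom G (A i) (\<Phi> i)"
      using G A hom by (simp add: group_hom_def group_hom_axioms_def)
    have "\<Phi> i ` (derived G ^^ n) (carrier G) = (derived (A i) ^^ n) (\<Phi> i ` carrier G)"
      using group_hom.exp_of_derived_img[OF gh order_refl] by simp
    also have "\<dots> \<subseteq> (derived (A i) ^^ n) (carrier (A i))"
      by (rule group.mono_exp_of_derived[OF A(1)]) (use hom in \<open>auto simp: hom_def\<close>)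
    also have "\<dots> = {\<one>\<^bsub>A i\<^esub>}" using A(2) by (simp add: derived_length_le_def)
    finally show "\<Phi> i x = \<one>\<^bsub>A i\<^esub>" using x by blast
  qed
  then show ?thesis
    using subgroup.one_closed[OF sub] unfolding derived_length_le_def by blast
qed

lemma derived_length_le_embed:
  assumes "group G" "group A" "\<Phi> \<in> hom G A" "inj_on \<Phi> (carrier G)" "derived_length_le A n"
  shows "derived_length_le G n"
proof (rule derived_length_le_family[where A="\<lambda>_::unit. A" and \<Phi>="\<lambda>_. \<Phi>"])
  fix x assume "x \<in> carrier G" "\<And>i. \<Phi> x = \<one>\<^bsub>A\<^esub>"
  moreover have "\<Phi> \<one>\<^bsub>G\<^esub> = \<one>\<^bsub>A\<^esub>" using assms hom_one by blast
  ultimately show "x = \<one>\<^bsub>G\<^esub>"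
    using assms(1,4) by (metis group.is_monoid inj_onD monoid.one_closed)
qed (use assms in auto)

section \<open>Direct sums and wreath products\<close>

lemma dsum_simps:
  "carrier (dsum A) = {f. (\<forall>i. f i \<in> carrier (A i)) \<and> finite {i. f i \<noteq> \<one>\<^bsub>A i\<^esub>}}"
  "f \<otimes>\<^bsub>dsum A\<^esub> g = (\<lambda>i. f i \<otimes>\<^bsub>A i\<^esub> g i)"
  "\<one>\<^bsub>dsum A\<^esub> = (\<lambda>i. \<one>\<^bsub>A i\<^esub>)"
  by (simp_all add: dsum_def)

lemma dsum_group:
  assumes A: "\<And>i. group (A i)"
  shows "group (dsum A)"
proof -
  interpret A: group "A i" for i by (rule A)
  show ?thesis
  proof (rule groupI)
    fix x y assume xy: "x \<in> carrier (dsum A)" "y \<in> carrier (dsum A)"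
    have "{i. x i \<otimes>\<^bsub>A i\<^esub> y i \<noteq> \<one>\<^bsub>A i\<^esub>} \<subseteq> {i. x i \<noteq> \<one>\<^bsub>A i\<^esub>} \<union> {i. y i \<noteq> \<one>\<^bsub>A i\<^esub>}"
      by auto
    then show "x \<otimes>\<^bsub>dsum A\<^esub> y \<in> carrier (dsum A)"
      using xy by (auto simp: dsum_simps intro: finite_subset)
  next
    fix x assume x: "x \<in> carrier (dsum A)"
    then have "{i. inv\<^bsub>A i\<^esub> x i \<noteq> \<one>\<^bsub>A i\<^esub>} = {i. x i \<noteq> \<one>\<^bsub>A i\<^esub>}"
      by (auto simp: dsum_simps A.inv_eq_1_iff)
    then show "\<exists>y\<in>carrier (dsum A). y \<otimes>\<^bsub>dsum A\<^esub> x = \<one>\<^bsub>dsum A\<^esub>"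
      using x by (intro bexI[of _ "\<lambda>i. inv\<^bsub>A i\<^esub> x i"]) (auto simp: dsum_simps)
  qed (auto simp: dsum_simps A.m_assoc)
qed

lemma derived_length_le_dsum:
  assumes A: "\<And>i. group (A i)" "\<And>i. derived_length_le (A i) n"
  shows "derived_length_le (dsum A) n"
  by (rule derived_length_le_family[where \<Phi>="\<lambda>i f. f i", OF dsum_group A])
     (use A in \<open>auto simp: dsum_simps hom_def\<close>)

lemma wreath_simps:
  "carrier (wreath_Z A) =
     {(f, k). (\<forall>i. f i \<in> carrier A) \<and> finite {i. f i \<noteq> \<one>\<^bsub>A\<^esub>}}"
  "(f, m) \<otimes>\<^bsub>wreath_Z A\<^esub> (g, n) = (\<lambda>i. f i \<otimes>\<^bsub>A\<^esub> g (i - m), m + n)"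
  "\<one>\<^bsub>wreath_Z A\<^esub> = (\<lambda>i. \<one>\<^bsub>A\<^esub>, 0)"
  by (simp_all add: wreath_Z_def)

lemma finite_shift:
  fixes m :: int
  assumes "finite {i. P i}"
  shows "finite {i. P (i + m)}" "finite {i. P (i - m)}"
proof -
  have "{i. P (i + m)} = (\<lambda>i. i - m) ` {i. P i}" "{i. P (i - m)} = (\<lambda>i. i + m) ` {i. P i}"
    by (force simp: image_iff)+
  then show "finite {i. P (i + m)}" "finite {i. P (i - m)}" using assms by auto
qed

lemma
  assumes A: "group A"
  shows wreath_group: "group (wreath_Z A)"
    and wreath_inv: "(f, m) \<in> carrier (wreath_Z A) \<Longrightarrow>
           inv\<^bsub>wreath_Z A\<^esub> (f, m) = (\<lambda>i. inv\<^bsub>A\<^esub> f (i + m), - m)"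
proof -
  interpret A: group A by (rule A)
  have inv: "(\<lambda>i. inv\<^bsub>A\<^esub> f (i + m), - m) \<in> carrier (wreath_Z A)"
    "(\<lambda>i. inv\<^bsub>A\<^esub> f (i + m), - m) \<otimes>\<^bsub>wreath_Z A\<^esub> (f, m) = \<one>\<^bsub>wreath_Z A\<^esub>"
    if "(f, m) \<in> carrier (wreath_Z A)" for f m
    using that finite_shift(1)[of "\<lambda>i. f i \<noteq> \<one>\<^bsub>A\<^esub>" m]
    by (auto simp: wreath_simps A.inv_eq_1_iff)
  show gr: "group (wreath_Z A)"
  proof (rule groupI)
    fix x y assume xy: "x \<in> carrier (wreath_Z A)" "y \<in> carrier (wreath_Z A)"
    obtain f m where x: "x = (f, m)" by fastforce
    obtain g n where y: "y = (g, n)" by fastforce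
    have "{i. f i \<otimes>\<^bsub>A\<^esub> g (i - m) \<noteq> \<one>\<^bsub>A\<^esub>} \<subseteq> {i. f i \<noteq> \<one>\<^bsub>A\<^esub>} \<union> {i. g (i - m) \<noteq> \<one>\<^bsub>A\<^esub>}"
      by auto
    moreover have "finite \<dots>"
      using xy x y finite_shift(2)[of "\<lambda>i. g i \<noteq> \<one>\<^bsub>A\<^esub>" m] by (auto simp: wreath_simps)
    ultimately show "x \<otimes>\<^bsub>wreath_Z A\<^esub> y \<in> carrier (wreath_Z A)"
      using xy x y by (auto simp: wreath_simps intro: finite_subset)
  next
    fix x assume x: "x \<in> carrier (wreath_Z A)"
    then show "\<exists>y\<in>carrier (wreath_Z A). y \<otimes>\<^bsub>wreath_Z A\<^esub> x = \<one>\<^bsub>wreath_Z A\<^esub>"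
      by (cases x) (use inv in blast)
  next
    fix x y z assume "x \<in> carrier (wreath_Z A)" "y \<in> carrier (wreath_Z A)" "z \<in> carrier (wreath_Z A)"
    then show "x \<otimes>\<^bsub>wreath_Z A\<^esub> y \<otimes>\<^bsub>wreath_Z A\<^esub> z = x \<otimes>\<^bsub>wreath_Z A\<^esub> (y \<otimes>\<^bsub>wreath_Z A\<^esub> z)"
      by (cases x; cases y; cases z) (auto simp: wreath_simps A.m_assoc algebra_simps)
  qed (auto simp: wreath_simps)
  show "inv\<^bsub>wreath_Z A\<^esub> (f, m) = (\<lambda>i. inv\<^bsub>A\<^esub> f (i + m), - m)"
    if "(f, m) \<in> carrier (wreath_Z A)"
    using group.inv_equality[OF gr] inv that by blast
qed

text \<open>The base group B is the kernel of the projection to the integers, so it contains all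
  commutators; its coordinates are homomorphisms into A that separate points.\<close>

lemma derived_length_le_wreath:
  assumes A: "group A" "derived_length_le A n"
  shows "derived_length_le (wreath_Z A) (Suc n)"
proof -
  interpret A: group A by (rule A)
  interpret W: group "wreath_Z A" by (rule wreath_group[OF A(1)])
  let ?W = "wreath_Z A"
  define B where "B = {x \<in> carrier ?W. snd x = 0}"
  have snd_mult: "snd (x \<otimes>\<^bsub>?W\<^esub> y) = snd x + snd y" for x y
    by (cases x; cases y) (simp add: wreath_simps)
  have snd_inv: "snd (inv\<^bsub>?W\<^esub> x) = - snd x" if "x \<in> carrier ?W" for x
    using that wreath_inv[OF A(1)] by (cases x) auto
  have B: "subgroup B ?W"
  proof (rule W.subgroupI)
    have "\<one>\<^bsub>?W\<^esub> \<in> B" using W.one_closed by (simp add: B_def wreath_simps(3))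
    then show "B \<noteq> {}" by blast
  qed (auto simp: B_def snd_mult snd_inv)
  have "derived ?W (carrier ?W) \<subseteq> B"
    unfolding derived_def
    by (rule W.generate_subgroup_incl[OF _ B]) (auto simp: B_def snd_mult snd_inv)
  \<comment> \<open>The first derived step is spent on entering B; the other n act inside B.\<close>
  then have "(derived ?W ^^ Suc n) (carrier ?W) \<subseteq> (derived ?W ^^ n) B"
    by (simp add: funpow_Suc_right W.mono_exp_of_derived del: funpow.simps)
  moreover have "derived_length_le (?W\<lparr>carrier := B\<rparr>) n"
  proof (rule derived_length_le_family[where \<Phi>="\<lambda>i x. fst x i" and A="\<lambda>_. A"])
    show "group (?W\<lparr>carrier := B\<rparr>)" using B W.subgroup_imp_group by blast
    show "(\<lambda>x. fst x i) \<in> hom (?W\<lparr>carrier := B\<rparr>) A" for i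
      by (auto simp: hom_def B_def wreath_simps)
    fix x assume "x \<in> carrier (?W\<lparr>carrier := B\<rparr>)" "\<And>i. fst x i = \<one>\<^bsub>A\<^esub>"
    then show "x = \<one>\<^bsub>?W\<lparr>carrier := B\<rparr>\<^esub>"
      by (cases x) (auto simp: B_def wreath_simps fun_eq_iff)
  qed (use A in auto)
  ultimately have "(derived ?W ^^ Suc n) (carrier ?W) \<subseteq> {\<one>\<^bsub>?W\<^esub>}"
    using derived_length_le_subgroup[OF W.is_group B] by simp
  moreover have "\<one>\<^bsub>?W\<^esub> \<in> (derived ?W ^^ Suc n) (carrier ?W)"
    using W.exp_of_derived_is_subgroup[OF W.subgroup_self] subgroup.one_closed by blast
  ultimately show ?thesis unfolding derived_length_le_def by blast
qed

section \<open>The class R up to isomorphism\<close>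

definition in_R :: "('a, 'b) monoid_scheme \<Rightarrow> bool" where
  "in_R H \<longleftrightarrow> (\<exists>G\<in>R_class. H \<cong> G)"

lemma
  assumes "R_closed C"
  shows R_closed_group: "G \<in> C \<Longrightarrow> group G"
    and R_closed_wreath: "A \<in> C \<Longrightarrow> group G \<Longrightarrow> G \<cong> wreath_Z A \<Longrightarrow> G \<in> C"
    and R_closed_dsum: "(\<And>i. A' i \<in> C) \<Longrightarrow> (\<And>i. derived_length_le (A' i) n) \<Longrightarrow>
      group G \<Longrightarrow> G \<cong> dsum A' \<Longrightarrow> G \<in> C"
    and R_closed_subgroup: "A \<in> C \<Longrightarrow> subgroup K A \<Longrightarrow> A\<lparr>carrier := K\<rparr> \<in> C"
proof -
  note c = assms[unfolded R_closed_def]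
  note c1 = c[THEN conjunct1] and c2 = c[THEN conjunct2, THEN conjunct1]
    and c3 = c[THEN conjunct2, THEN conjunct2, THEN conjunct1]
    and c4 = c[THEN conjunct2, THEN conjunct2, THEN conjunct2]
  show "G \<in> C \<Longrightarrow> group G" by (rule bspec[OF c1])
  show "A \<in> C \<Longrightarrow> group G \<Longrightarrow> G \<cong> wreath_Z A \<Longrightarrow> G \<in> C"
    using bspec[OF c2, THEN spec] by iprover
  show "A \<in> C \<Longrightarrow> subgroup K A \<Longrightarrow> A\<lparr>carrier := K\<rparr> \<in> C"
    using bspec[OF c4, THEN spec] by iprover
  show "(\<And>i. A' i \<in> C) \<Longrightarrow> (\<And>i. derived_length_le (A' i) n) \<Longrightarrow>
      group G \<Longrightarrow> G \<cong> dsum A' \<Longrightarrow> G \<in> C"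
    using spec[OF c3, of A'] by iprover
qed

lemma trivial_group: "group \<lparr>carrier = {0::nat}, mult = (\<lambda>_ _. 0), one = 0\<rparr>"
  by (rule groupI) auto

text \<open>The subgroup clause yields only the trivial subgroup of some given A, whose operations
  depend on A. The sum clause admits every isomorphic copy on \<open>nat\<close>, so a direct sum of
  such trivial groups leads to this fixed one.\<close>

lemma trivial_in_R_closed:
  assumes "C \<noteq> {}" "R_closed C"
  shows "\<lparr>carrier = {0}, mult = (\<lambda>_ _. 0), one = 0\<rparr> \<in> C"
proof -
  obtain A where A: "A \<in> C" using assms(1) by auto
  then interpret A: group A using R_closed_group[OF assms(2)] by simp
  define T where "T = A\<lparr>carrier := {\<one>\<^bsub>A\<^esub>}\<rparr>"
  have "T \<in> C" unfolding T_def by (rule R_closed_subgroup[OF assms(2) A A.triv_subgroup])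
  moreover have "derived_length_le T 0" by (simp add: derived_length_le_def T_def)
  moreover have "group \<lparr>carrier = {0::nat}, mult = (\<lambda>_ _. 0), one = 0\<rparr>"
    by (rule trivial_group)
  moreover have "\<lparr>carrier = {0::nat}, mult = (\<lambda>_ _. 0), one = 0\<rparr> \<cong> dsum (\<lambda>_::nat. T)"
  proof (rule is_isoI, rule isoI)
    show "(\<lambda>_. \<lambda>_. \<one>\<^bsub>A\<^esub>) \<in> hom \<lparr>carrier = {0::nat}, mult = (\<lambda>_ _. 0), one = 0\<rparr> (dsum (\<lambda>_::nat. T))"
      by (auto simp: hom_def dsum_simps T_def)
    show "bij_betw (\<lambda>_. \<lambda>_. \<one>\<^bsub>A\<^esub>) (carrier \<lparr>carrier = {0::nat}, mult = (\<lambda>_ _. 0), one = 0\<rparr>)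
        (carrier (dsum (\<lambda>_::nat. T)))"
      by (auto simp: bij_betw_def dsum_simps T_def)
  qed
  ultimately show ?thesis using R_closed_dsum[OF assms(2), of "\<lambda>_. T" 0] by simp
qed

lemma trivial_R_class: "\<lparr>carrier = {0}, mult = (\<lambda>_ _. 0), one = 0\<rparr> \<in> R_class"
  unfolding R_class_def using trivial_in_R_closed by auto

lemma R_class_subset: "C \<noteq> {} \<Longrightarrow> R_closed C \<Longrightarrow> R_class \<subseteq> C"
  unfolding R_class_def by blast

text \<open>Closed classes are stable under intersection. The class of all groups on
  \<open>nat\<close> is closed and non-empty, so the intersection ranges over a non-empty family and
  has only groups as members.\<close>

lemma R_closed_R_class: "R_closed R_class"
proof -
  have gr: "R_closed {G. group G}"
    unfolding R_closed_def using group.subgroup_imp_group by auto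
  moreover have "{G::nat monoid. group G} \<noteq> {}"
    using trivial_group by auto
  ultimately have 1: "group G" if "G \<in> R_class" for G
    using subsetD[OF R_class_subset that, of "{G. group G}"] by blast
  have mem: "G \<in> C" if "G \<in> R_class" "C \<noteq> {}" "R_closed C" for G C
    using that R_class_subset by (meson subsetD)
  have R_I: "G \<in> R_class" if "\<And>C. C \<noteq> {} \<Longrightarrow> R_closed C \<Longrightarrow> G \<in> C" for G
    using that by (simp add: R_class_def)
  show ?thesis
    unfolding R_closed_def
  proof (intro conjI ballI allI impI)
    fix A G assume A: "A \<in> R_class" and G: "group (G::nat monoid) \<and> G \<cong> wreath_Z A"
    show "G \<in> R_class"
    proof (rule R_I)
      fix C assume "C \<noteq> {}" "R_closed C"
      then show "G \<in> C" using R_closed_wreath[of C A G] mem[OF A] G by simp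
    qed
  next
    fix A :: "nat \<Rightarrow> nat monoid" and G
    assume "(\<forall>i. A i \<in> R_class) \<and> (\<exists>n. \<forall>i. derived_length_le (A i) n)"
    then obtain n where A: "\<And>i. A i \<in> R_class" "\<And>i. derived_length_le (A i) n" by auto
    assume G: "group (G::nat monoid) \<and> G \<cong> dsum A"
    show "G \<in> R_class"
    proof (rule R_I)
      fix C assume "C \<noteq> {}" "R_closed C"
      then show "G \<in> C" using R_closed_dsum[of C A n G] mem[OF A(1)] A(2) G by simp
    qed
  next
    fix A K assume A: "A \<in> R_class" and K: "subgroup K A"
    show "A\<lparr>carrier := K\<rparr> \<in> R_class"
    proof (rule R_I)
      fix C assume "C \<noteq> {}" "R_closed C"
      then show "A\<lparr>carrier := K\<rparr> \<in> C" using R_closed_subgroup[of C A K] mem[OF A] K by simp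
    qed
  qed (rule 1)
qed

lemmas R_class_group = R_closed_group[OF R_closed_R_class]

text \<open>Wreath products and sums of groups on \<open>nat\<close> live on function types; an
  enumeration of the carrier brings them back to \<open>nat\<close>, where \<open>R_class\<close> is
  defined.\<close>

lemma nat_copy:
  assumes G: "group G" and c: "countable (carrier G)"
  shows "\<exists>N :: nat monoid. group N \<and> N \<cong> G"
proof -
  interpret G: group G by (rule G)
  let ?e = "to_nat_on (carrier G)" and ?d = "from_nat_into (carrier G)"
  define N :: "nat monoid" where
    "N = \<lparr>carrier = ?e ` carrier G, mult = (\<lambda>x y. ?e (?d x \<otimes>\<^bsub>G\<^esub> ?d y)), one = ?e \<one>\<^bsub>G\<^esub>\<rparr>"
  have hom: "?e \<in> hom G N" using c by (auto simp: hom_def N_def)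
  then have "group (N\<lparr>carrier := ?e ` carrier G, one := ?e \<one>\<^bsub>G\<^esub>\<rparr>)"
    by (rule G.hom_imp_img_group)
  then have "group N" by (simp add: N_def)
  moreover have "?e \<in> iso G N"
    using hom c by (auto simp: iso_def bij_betw_def N_def)
  ultimately show ?thesis using G.iso_sym is_isoI by blast
qed

text \<open>The image in a representative on \<open>nat\<close> is a subgroup there. With this
  lemma, membership in R is shown by injective homomorphisms alone.\<close>

lemma in_R_embed:
  assumes H: "group H" and hom: "\<Phi> \<in> hom H A" "inj_on \<Phi> (carrier H)" and A: "in_R A"
  shows "in_R H"
proof -
  obtain G \<psi> where G: "G \<in> R_class" and \<psi>: "\<psi> \<in> iso A G"
    using A unfolding in_R_def is_iso_def by blast
  interpret G: group G using G by (rule R_class_group)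
  define \<theta> where "\<theta> = \<psi> \<circ> \<Phi>"
  have \<theta>: "\<theta> \<in> hom H G" unfolding \<theta>_def
    using hom \<psi> by (auto simp: iso_def intro: hom_compose)
  have im: "\<Phi> ` carrier H \<subseteq> carrier A" using hom by (simp add: hom_carrier)
  have inj: "inj_on \<theta> (carrier H)"
    unfolding \<theta>_def using hom(2) \<psi> im
    by (auto simp: iso_def bij_betw_def intro!: comp_inj_on intro: inj_on_subset)
  have gh: "group_hom H G \<theta>"
    using H \<theta> by (simp add: group_hom_def group_hom_axioms_def)
  have "subgroup (\<theta> ` carrier H) G" by (rule group_hom.img_is_subgroup[OF gh])
  then have "G\<lparr>carrier := \<theta> ` carrier H\<rparr> \<in> R_class"
    by (rule R_closed_subgroup[OF R_closed_R_class G])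
  moreover have "\<theta> \<in> iso H (G\<lparr>carrier := \<theta> ` carrier H\<rparr>)"
    using \<theta> inj by (auto simp: iso_def hom_def bij_betw_def)
  ultimately show ?thesis unfolding in_R_def using is_isoI by blast
qed

lemma in_R_trivial:
  assumes "group H" "carrier H = {\<one>\<^bsub>H\<^esub>}"
  shows "in_R H"
proof (rule in_R_embed[OF assms(1), where \<Phi>="\<lambda>_. 0"])
  let ?T = "\<lparr>carrier = {0}, mult = (\<lambda>_ _. 0), one = 0\<rparr> :: nat monoid"
  show "(\<lambda>_. 0) \<in> hom H ?T" by (simp add: hom_def)
  show "in_R ?T" using trivial_R_class iso_refl unfolding in_R_def by blast
qed (simp add: assms(2))

text \<open>Such a function is recovered from the finite set of pairs at which it differs from c,
  and a countable set has only countably many finite subsets.\<close>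

lemma countable_finite_support:
  assumes "countable I" "\<And>i. countable (S i)"
  shows "countable {f. (\<forall>i\<in>I. f i \<in> S i) \<and> (\<forall>i. i \<notin> I \<longrightarrow> f i = c i) \<and> finite {i. f i \<noteq> c i}}"
    (is "countable ?F")
proof -
  let ?g = "\<lambda>f. {(i, f i) | i. f i \<noteq> c i}"
  have "countable {X. finite X \<and> X \<subseteq> (SIGMA i:I. S i)}"
    by (rule countable_Collect_finite_subset) (use assms in auto)
  moreover have "?g ` ?F \<subseteq> {X. finite X \<and> X \<subseteq> (SIGMA i:I. S i)}"
    by (auto simp: setcompr_eq_image)
  ultimately have "countable (?g ` ?F)" using countable_subset by blast
  moreover have "inj_on ?g ?F"
  proof (rule inj_onI)
    fix f g assume eq: "?g f = ?g g"
    show "f = g"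
    proof
      fix i
      have "(i, y) \<in> ?g f \<longleftrightarrow> (i, y) \<in> ?g g" for y using eq by simp
      from this[of "f i"] this[of "g i"] show "f i = g i" by (cases "f i = c i") auto
    qed
  qed
  ultimately show ?thesis using countable_image_inj_on by blast
qed

text \<open>A may live on any type, so it is replaced by an isomorphic G on \<open>nat\<close>. The
  wreath product of G is countable and has a copy in R, and the isomorphism applied in every
  coordinate embeds the wreath product of A.\<close>

lemma in_R_wreath:
  assumes A: "group A" "in_R A"
  shows "in_R (wreath_Z A)"
proof -
  obtain G \<psi> where G: "G \<in> R_class" and \<psi>: "\<psi> \<in> iso A G"
    using A unfolding in_R_def is_iso_def by blast
  have gG: "group G" using G by (rule R_class_group)
  have cnt: "countable (carrier (wreath_Z G))"
  proof -
    have "carrier (wreath_Z G) = {f. (\<forall>i\<in>UNIV. f i \<in> carrier G) \<and> (\<forall>i. i \<notin> UNIV \<longrightarrow> f i = \<one>\<^bsub>G\<^esub>)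
        \<and> finite {i. f i \<noteq> \<one>\<^bsub>G\<^esub>}} \<times> UNIV"
      by (auto simp: wreath_simps)
    then show ?thesis
      using countable_finite_support[of "UNIV :: int set" "\<lambda>_. carrier G" "\<lambda>_. \<one>\<^bsub>G\<^esub>"]
      by (auto intro!: countable_SIGMA)
  qed
  then obtain N :: "nat monoid" where N: "group N" "N \<cong> wreath_Z G"
    using nat_copy[OF wreath_group[OF gG] cnt] by auto
  then have "N \<in> R_class" using R_closed_wreath[OF R_closed_R_class G] by simp
  moreover have "wreath_Z G \<cong> N" using N group.iso_sym by blast
  ultimately have "in_R (wreath_Z G)" unfolding in_R_def by blast
  moreover have \<psi>h: "\<psi> \<in> hom A G" "inj_on \<psi> (carrier A)" using \<psi> by (auto simp: iso_def bij_betw_def)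
  have one: "\<psi> \<one>\<^bsub>A\<^esub> = \<one>\<^bsub>G\<^esub>" using hom_one[OF \<psi>h(1) A(1) gG] .
  have "(\<lambda>(f, m). (\<psi> \<circ> f, m)) \<in> hom (wreath_Z A) (wreath_Z G)"
  proof (rule homI)
    fix x assume x: "x \<in> carrier (wreath_Z A)"
    obtain f m where fm: "x = (f, m)" by fastforce
    have "{i. \<psi> (f i) \<noteq> \<one>\<^bsub>G\<^esub>} \<subseteq> {i. f i \<noteq> \<one>\<^bsub>A\<^esub>}" using one by auto
    then show "(\<lambda>(f, m). (\<psi> \<circ> f, m)) x \<in> carrier (wreath_Z G)"
      using x fm \<psi>h by (auto simp: wreath_simps hom_def intro: finite_subset)
  next
    fix x y assume "x \<in> carrier (wreath_Z A)" "y \<in> carrier (wreath_Z A)"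
    then show "(\<lambda>(f, m). (\<psi> \<circ> f, m)) (x \<otimes>\<^bsub>wreath_Z A\<^esub> y) =
      (\<lambda>(f, m). (\<psi> \<circ> f, m)) x \<otimes>\<^bsub>wreath_Z G\<^esub> (\<lambda>(f, m). (\<psi> \<circ> f, m)) y"
      using \<psi>h by (cases x; cases y) (auto simp: wreath_simps hom_def fun_eq_iff)
  qed
  moreover have "inj_on (\<lambda>(f, m::int). (\<psi> \<circ> f, m)) (carrier (wreath_Z A))"
    using \<psi>h(2) by (auto simp: inj_on_def wreath_simps fun_eq_iff)
  ultimately show ?thesis using in_R_embed[OF wreath_group[OF A(1)]] by blast
qed

lemma in_R_dsum:
  assumes A: "\<And>i. group (A i)" "\<And>i. in_R (A i)" "\<And>i. derived_length_le (A i) n"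
  shows "in_R (dsum A)"
proof -
  have "\<forall>i. \<exists>G \<psi>. G \<in> R_class \<and> \<psi> \<in> iso (A i) G"
    using A(2) unfolding in_R_def is_iso_def by blast
  then obtain G \<psi> where G: "\<And>i. G i \<in> R_class" and \<psi>: "\<And>i. \<psi> i \<in> iso (A i) (G i)"
    by metis
  have gG: "group (G i)" for i using G by (rule R_class_group)
  \<comment> \<open>The sum clause asks for the bound on the representatives \<open>G i\<close>, not
    on the \<open>A i\<close>.\<close>
  have dl: "derived_length_le (G i) n" for i
  proof -
    obtain \<theta> where "\<theta> \<in> iso (G i) (A i)"
      using \<psi> A(1) group.iso_set_sym by blast
    then show ?thesis
      by (intro derived_length_le_embed[OF gG A(1) _ _ A(3)]) (auto simp: iso_def bij_betw_def)
  qed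
  have cnt: "countable (carrier (dsum G))"
  proof -
    have "carrier (dsum G) = {f. (\<forall>i\<in>UNIV. f i \<in> carrier (G i)) \<and> (\<forall>i. i \<notin> UNIV \<longrightarrow> f i = \<one>\<^bsub>G i\<^esub>)
        \<and> finite {i. f i \<noteq> \<one>\<^bsub>G i\<^esub>}}"
      by (auto simp: dsum_simps)
    then show ?thesis
      using countable_finite_support[of "UNIV :: nat set" "\<lambda>i. carrier (G i)" "\<lambda>i. \<one>\<^bsub>G i\<^esub>"] by auto
  qed
  then obtain N :: "nat monoid" where N: "group N" "N \<cong> dsum G"
    using nat_copy[OF dsum_group[OF gG] cnt] by auto
  then have "N \<in> R_class" using R_closed_dsum[OF R_closed_R_class G dl] by simp
  moreover have "dsum G \<cong> N" using N group.iso_sym by blast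
  ultimately have "in_R (dsum G)" unfolding in_R_def by blast
  moreover have \<psi>h: "\<psi> i \<in> hom (A i) (G i)" "inj_on (\<psi> i) (carrier (A i))" for i
    using \<psi> by (auto simp: iso_def bij_betw_def)
  have one: "\<psi> i \<one>\<^bsub>A i\<^esub> = \<one>\<^bsub>G i\<^esub>" for i using hom_one[OF \<psi>h(1) A(1) gG] .
  have "(\<lambda>f i. \<psi> i (f i)) \<in> hom (dsum A) (dsum G)"
  proof (rule homI)
    fix f assume f: "f \<in> carrier (dsum A)"
    have "{i. \<psi> i (f i) \<noteq> \<one>\<^bsub>G i\<^esub>} \<subseteq> {i. f i \<noteq> \<one>\<^bsub>A i\<^esub>}" using one by auto
    then show "(\<lambda>i. \<psi> i (f i)) \<in> carrier (dsum G)"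
      using f \<psi>h(1) by (auto simp: dsum_simps hom_def Pi_iff intro: finite_subset)
  qed (use \<psi>h(1) in \<open>auto simp: dsum_simps hom_def fun_eq_iff\<close>)
  moreover have "inj_on (\<lambda>f i. \<psi> i (f i)) (carrier (dsum A))"
  proof (rule inj_onI, rule ext)
    fix f g i assume "f \<in> carrier (dsum A)" "g \<in> carrier (dsum A)" "(\<lambda>i. \<psi> i (f i)) = (\<lambda>i. \<psi> i (g i))"
    then show "f i = g i"
      using \<psi>h(2)[of i] by (auto simp: dsum_simps inj_on_def fun_eq_iff)
  qed
  ultimately show ?thesis using in_R_embed[OF dsum_group[of A, OF A(1)]] by blast
qed

subsection \<open>Embedding groups of the class R\<close>

definition PL_embeddable :: "('a, 'b) monoid_scheme \<Rightarrow> bool" where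
  "PL_embeddable G \<longleftrightarrow> (\<exists>\<Phi>\<in>hom G PLo_I. inj_on \<Phi> (carrier G))"

section \<open>Gluing and rescaling of maps\<close>

definition glue :: "('i \<Rightarrow> real set) \<Rightarrow> ('i \<Rightarrow> real \<Rightarrow> real) \<Rightarrow> real \<Rightarrow> real" where
  "glue J u x = (if \<exists>i. x \<in> J i then u (THE i. x \<in> J i) x else x)"

definition supported :: "('i \<Rightarrow> real set) \<Rightarrow> ('i \<Rightarrow> real \<Rightarrow> real) \<Rightarrow> bool" where
  "supported J u \<longleftrightarrow> (\<forall>i. u i \<in> PLo_set \<and> (\<forall>x. x \<notin> J i \<longrightarrow> u i x = x))"

text \<open>A point of \<open>J i\<close> sent outside would there be fixed by \<open>u i\<close>,
  against injectivity.\<close>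

lemma supported_mem_iff:
  assumes "supported J u"
  shows "u i x \<in> J i \<longleftrightarrow> x \<in> J i"
  using assms pl_homeo_eq_iff[of "u i"] PLo_setD(1)[of "u i"] unfolding supported_def by metis

context
  fixes J :: "'i \<Rightarrow> real set"
  assumes disj: "\<And>i j x. x \<in> J i \<Longrightarrow> x \<in> J j \<Longrightarrow> i = j"
begin

lemma glue_in: "x \<in> J i \<Longrightarrow> glue J u x = u i x"
proof -
  assume x: "x \<in> J i"
  then have "(THE i. x \<in> J i) = i" using disj by blast
  then show ?thesis using x by (auto simp: glue_def)
qed

lemma glue_out: "(\<And>i. x \<notin> J i) \<Longrightarrow> glue J u x = x"
  by (simp add: glue_def)

lemma glue_comp:
  assumes v: "supported J v"
  shows "glue J (\<lambda>i. u i \<circ> v i) = glue J u \<circ> glue J v"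
proof
  fix x
  show "glue J (\<lambda>i. u i \<circ> v i) x = (glue J u \<circ> glue J v) x"
  proof (cases "\<exists>i. x \<in> J i")
    case True
    then obtain i where i: "x \<in> J i" by blast
    then show ?thesis using supported_mem_iff[OF v, of i x] by (simp add: glue_in)
  qed (simp add: glue_def)
qed

text \<open>Induction on the set of nontrivial indices peels off one \<open>u i\<close> as a factor,
  which writes the glued map as a finite composition. Finiteness keeps the set of breaks
  finite.\<close>

lemma glue_PLo:
  assumes "supported J u" "finite {i. u i \<noteq> id}"
  shows "glue J u \<in> PLo_set"
proof -
  have "glue J u \<in> PLo_set" if "finite T" "supported J u" "{i. u i \<noteq> id} \<subseteq> T" for T u
    using that
  proof (induction T arbitrary: u rule: finite_induct)
    case empty
    then have "u i = id" for i by auto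
    then have "glue J u = id" by (auto simp: glue_def fun_eq_iff)
    then show ?case by (simp only: id_PLo)
  next
    case (insert i T)
    have sup: "supported J (u(i := id))"
      using insert.prems(1) by (auto simp: supported_def id_PLo)
    have u: "u i \<in> PLo_set" using insert.prems(1) by (simp add: supported_def)
    have "glue J u = glue J (u(i := id)) \<circ> u i"
    proof
      fix x
      show "glue J u x = (glue J (u(i := id)) \<circ> u i) x"
      proof (cases "x \<in> J i")
        case True
        then show ?thesis using supported_mem_iff[OF insert.prems(1), of i x] by (simp add: glue_in)
      next
        case False
        then have "u i x = x" using insert.prems(1) by (simp add: supported_def)
        show ?thesis
        proof (cases "\<exists>j. x \<in> J j")
          case True
          then obtain j where j: "x \<in> J j" by blast
          then have "j \<noteq> i" using False by blast
          then show ?thesis using \<open>u i x = x\<close> j by (simp add: glue_in)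
        qed (use \<open>u i x = x\<close> in \<open>simp add: glue_def\<close>)
      qed
    qed
    moreover have "glue J (u(i := id)) \<in> PLo_set"
      by (rule insert.IH[OF sup]) (use insert.prems(2) in auto)
    ultimately show ?case using comp_PLo[OF _ u] by metis
  qed
  then show ?thesis using assms by blast
qed

lemma glue_inject:
  assumes "supported J u" "supported J v" "glue J u = glue J v"
  shows "u = v"
proof (rule ext, rule ext)
  fix i x
  show "u i x = v i x"
  proof (cases "x \<in> J i")
    case True
    then show ?thesis using assms(3) by (metis glue_in)
  qed (use assms(1,2) in \<open>simp add: supported_def\<close>)
qed

end

text \<open>The conjugate of f by the affine map that carries [0, 1] onto [c, d].\<close>

definition squeeze :: "real \<Rightarrow> real \<Rightarrow> (real \<Rightarrow> real) \<Rightarrow> real \<Rightarrow> real" where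
  "squeeze c d f x = (d - c) * f ((x - c) / (d - c)) + c"

lemma squeeze_comp: "c < d \<Longrightarrow> squeeze c d (f \<circ> g) = squeeze c d f \<circ> squeeze c d g"
  by (simp add: squeeze_def fun_eq_iff)

lemma squeeze_id: "c < d \<Longrightarrow> squeeze c d id = id"
  by (simp add: squeeze_def fun_eq_iff)

lemma squeeze_inject:
  assumes "c < d" "squeeze c d f = squeeze c d g"
  shows "f = g"
proof
  fix x
  have "squeeze c d f ((d - c) * x + c) = squeeze c d g ((d - c) * x + c)" using assms by simp
  then show "f x = g x" using assms(1) by (simp add: squeeze_def)
qed

lemma squeeze_out:
  assumes "c < d" "f \<in> PLo_set" "x \<notin> {c<..<d}"
  shows "squeeze c d f x = x"
proof -
  have "(x - c) / (d - c) \<notin> {0<..<1}" using assms by (auto simp: field_simps)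
  then show ?thesis using PLo_setD(2)[OF assms(2)] assms(1) by (simp add: squeeze_def)
qed

lemma squeeze_PLo:
  assumes cd: "c < d" "0 \<le> c" "d \<le> 1" and f: "f \<in> PLo_set"
  shows "squeeze c d f \<in> PLo_set"
proof -
  have "squeeze c d f = (\<lambda>x. (d - c) * x + c) \<circ> f \<circ> (\<lambda>x. (1 / (d - c)) * x + (- c / (d - c)))"
    using cd by (simp add: squeeze_def fun_eq_iff diff_divide_distrib)
  moreover have "pl_homeo \<dots>"
    using cd f by (intro pl_homeo_comp affine_pl_homeo PLo_setD) auto
  ultimately show ?thesis
    using squeeze_out[OF cd(1) f] cd by (auto simp: PLo_set_iff)
qed

section \<open>Realising direct sums and wreath products\<close>

lemma intervals_disjoint:
  fixes c d :: "'i::linorder \<Rightarrow> real"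
  assumes "\<And>i j. i < j \<Longrightarrow> d i \<le> c j" "x \<in> {c i<..<d i}" "x \<in> {c j<..<d j}"
  shows "i = j"
  using assms(1)[of i j] assms(1)[of j i] assms(2,3) by (cases i j rule: linorder_cases) auto

lemma PL_embeddable_dsum:
  assumes A: "\<And>i. group (A i)" "\<And>i. PL_embeddable (A i)"
  shows "PL_embeddable (dsum A)"
proof -
  have "\<forall>i. \<exists>\<Phi>. \<Phi> \<in> hom (A i) PLo_I \<and> inj_on \<Phi> (carrier (A i))"
    using A(2) unfolding PL_embeddable_def by blast
  then obtain \<Phi> where hom: "\<And>i. \<Phi> i \<in> hom (A i) PLo_I" and inj: "\<And>i. inj_on (\<Phi> i) (carrier (A i))"
    by metis
  have one: "\<Phi> i \<one>\<^bsub>A i\<^esub> = id" for i using hom_one[OF hom A(1) PLo_group] by simp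
  \<comment> \<open>These points increase towards 1, so infinitely many disjoint intervals fit into
    [0, 1], one for each summand.\<close>
  define c :: "nat \<Rightarrow> real" where "c i = 1 - (1/2) ^ i" for i
  have c: "c i < c (Suc i)" "0 \<le> c i" "c i \<le> 1" for i by (auto simp: c_def power_le_one)
  have "mono c" using c(1) by (simp add: incseq_SucI less_imp_le)
  then have cc: "i < j \<Longrightarrow> c (Suc i) \<le> c j" for i j by (simp add: Suc_leI monoD)
  define J where "J i = {c i<..<c (Suc i)}" for i
  have disj: "i = j" if "x \<in> J i" "x \<in> J j" for i j x
    using intervals_disjoint[of "\<lambda>i. c (Suc i)" c x i j] cc that unfolding J_def by blast
  define u where "u f i = squeeze (c i) (c (Suc i)) (\<Phi> i (f i))" for f i
  have sup: "supported J (u f)" if "f \<in> carrier (dsum A)" for f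
    unfolding supported_def J_def u_def
    using that hom c by (auto simp: dsum_simps hom_def Pi_iff intro!: squeeze_PLo squeeze_out)
  have "(\<lambda>f. glue J (u f)) \<in> hom (dsum A) PLo_I"
  proof (rule homI)
    fix f assume f: "f \<in> carrier (dsum A)"
    have "{i. u f i \<noteq> id} \<subseteq> {i. f i \<noteq> \<one>\<^bsub>A i\<^esub>}" using one c by (auto simp: u_def squeeze_id)
    then have "finite {i. u f i \<noteq> id}" using f by (auto simp: dsum_simps intro: finite_subset)
    then show "glue J (u f) \<in> carrier PLo_I" using glue_PLo[of J "u f", OF disj sup[OF f]] by simp
  next
    fix f g assume fg: "f \<in> carrier (dsum A)" "g \<in> carrier (dsum A)"
    have "u (f \<otimes>\<^bsub>dsum A\<^esub> g) = (\<lambda>i. u f i \<circ> u g i)"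
    proof
      fix i
      have "\<Phi> i (f i \<otimes>\<^bsub>A i\<^esub> g i) = \<Phi> i (f i) \<circ> \<Phi> i (g i)"
        using hom_mult[OF hom[of i], of "f i" "g i"] fg by (auto simp: dsum_simps)
      then show "u (f \<otimes>\<^bsub>dsum A\<^esub> g) i = u f i \<circ> u g i"
        using squeeze_comp[OF c(1)] by (simp add: u_def dsum_simps)
    qed
    then show "glue J (u (f \<otimes>\<^bsub>dsum A\<^esub> g)) = glue J (u f) \<otimes>\<^bsub>PLo_I\<^esub> glue J (u g)"
      using glue_comp[of J "u g" "u f", OF disj sup[OF fg(2)]] by simp
  qed
  moreover have "inj_on (\<lambda>f. glue J (u f)) (carrier (dsum A))"
  proof (rule inj_onI, rule ext)
    fix f g i assume fg: "f \<in> carrier (dsum A)" "g \<in> carrier (dsum A)" and "glue J (u f) = glue J (u g)"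
    then have "u f i = u g i"
      using glue_inject[of J "u f" "u g", OF disj sup[OF fg(1)] sup[OF fg(2)]] by simp
    then have "\<Phi> i (f i) = \<Phi> i (g i)" using squeeze_inject[OF c(1)] unfolding u_def by blast
    then show "f i = g i" using inj[of i] fg by (auto simp: inj_on_def dsum_simps)
  qed
  ultimately show ?thesis unfolding PL_embeddable_def by blast
qed

text \<open>A one-bump map: every point of (0, 1) moves up. The constants make 1/4 go to 1/2, so
  that (1/4, 1/2) is, up to its ends, a fundamental domain for the powers.\<close>

definition bump :: "real \<Rightarrow> real" where
  "bump x = (if x \<le> 0 then x else if x \<le> 1/4 then 2 * x else if x \<le> 1 then (2 * x + 1) / 3 else x)"

lemma bump_PLo: "bump \<in> PLo_set"
proof -
  have "strict_mono bump"
    by (auto simp: strict_mono_def bump_def)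
  moreover have "surj bump"
    by (rule surjI[where f="\<lambda>y. if y \<le> 0 then y else if y \<le> 1/2 then y / 2 else if y \<le> 1
          then (3 * y - 1) / 2 else y"]) (auto simp: bump_def field_simps)
  moreover have "aff_off {0, 1/4, 1} bump"
    unfolding aff_off_def
  proof (intro allI impI, elim conjE)
    fix u v :: real assume uv: "u < v" and dis: "{u<..<v} \<inter> {0, 1/4, 1} = {}"
    have "0 \<notin> {u<..<v}" "1/4 \<notin> {u<..<v}" "1 \<notin> {u<..<v}" using dis by blast+
    then have "0 \<le> u \<or> v \<le> 0" "1/4 \<le> u \<or> v \<le> 1/4" "1 \<le> u \<or> v \<le> 1"
      unfolding greaterThanLessThan_iff by linarith+
    then consider "v \<le> 0 \<or> 1 \<le> u" | "0 \<le> u" "v \<le> 1/4" | "1/4 \<le> u" "v \<le> 1"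
      using uv by linarith
    then show "\<exists>a b. \<forall>x\<in>{u<..<v}. bump x = a * x + b"
    proof cases
      case 1
      then have "\<forall>x\<in>{u<..<v}. bump x = 1 * x + 0" by (auto simp: bump_def)
      then show ?thesis by blast
    next
      case 2
      then have "\<forall>x\<in>{u<..<v}. bump x = 2 * x + 0" by (auto simp: bump_def)
      then show ?thesis by blast
    next
      case 3
      then have "\<forall>x\<in>{u<..<v}. bump x = 2 / 3 * x + 1 / 3"
        by (auto simp: bump_def add_divide_distrib)
      then show ?thesis by blast
    qed
  qed
  ultimately have "pl_homeo bump"
    unfolding pl_homeo_def by (intro conjI exI[of _ "{0, 1/4, 1}"]) simp_all
  then show ?thesis by (auto simp: PLo_set_iff bump_def)
qed

abbreviation ipow :: "(real \<Rightarrow> real) \<Rightarrow> int \<Rightarrow> real \<Rightarrow> real" where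
  "ipow g m \<equiv> g [^]\<^bsub>PLo_I\<^esub> m"

lemma ipow_PLo: "g \<in> PLo_set \<Longrightarrow> ipow g m \<in> PLo_set"
  using group.int_pow_closed[OF PLo_group, of g m] by simp

lemma ipow_add: "g \<in> PLo_set \<Longrightarrow> ipow g (m + n) = ipow g m \<circ> ipow g n"
  using group.int_pow_mult[OF PLo_group, of g m n] by simp

lemma ipow_0: "ipow g 0 = id"
  by simp

lemma ipow_1: "g \<in> PLo_set \<Longrightarrow> ipow g 1 = g"
  using group.int_pow_1[OF PLo_group, of g] by simp

lemma ipow_add_apply: "g \<in> PLo_set \<Longrightarrow> ipow g m (ipow g n x) = ipow g (m + n) x"
  by (simp add: ipow_add)

lemma ipow_neg: "g \<in> PLo_set \<Longrightarrow> ipow g (- m) = finv (ipow g m)"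
  using group.int_pow_neg[OF PLo_group, of g m] by (simp add: PLo_inv ipow_PLo)

lemma ipow_less:
  assumes g: "g \<in> PLo_set" and p: "p < g p"
  shows "ipow g i p < ipow g (i + 1) p"
  using pl_homeo_less_iff[OF PLo_setD(1)[OF ipow_PLo[OF g, of i]], of p "g p"] p
  by (simp add: ipow_add[OF g] ipow_1[OF g])

text \<open>The translates of the fundamental domain (p, g p) are ordered by their index; this is
  the form that \<open>intervals_disjoint\<close> needs.\<close>

lemma ipow_chain:
  assumes g: "g \<in> PLo_set" and p: "p < g p" and ij: "i < j"
  shows "ipow g (i + 1) p \<le> ipow g j p"
proof -
  have "ipow g (i + 1) p \<le> ipow g (i + 1 + int n) p" for n
  proof (induction n)
    case (Suc n)
    then show ?case using ipow_less[OF g p, of "i + 1 + int n"] by (simp add: algebra_simps)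
  qed simp
  from this[of "nat (j - i - 1)"] show ?thesis using ij by simp
qed

text \<open>Powers of g permute the translates by a shift of the index, just as the integers act in
  \<open>wreath_Z\<close>.\<close>

lemma ipow_mem_iff:
  assumes g: "g \<in> PLo_set"
  shows "ipow g m x \<in> {ipow g i p<..<ipow g (i + 1) p} \<longleftrightarrow>
    x \<in> {ipow g (i - m) p<..<ipow g (i - m + 1) p}"
proof -
  have "ipow g i p = ipow g m (ipow g (i - m) p)" "ipow g (i + 1) p = ipow g m (ipow g (i - m + 1) p)"
    using g by (simp_all add: ipow_add_apply)
  then show ?thesis using pl_homeo_less_iff[OF PLo_setD(1)[OF ipow_PLo[OF g, of m]]] by auto
qed

lemma PL_embeddable_wreath:
  assumes A: "group A" "PL_embeddable A"
  shows "PL_embeddable (wreath_Z A)"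
proof -
  obtain \<Phi> where hom: "\<Phi> \<in> hom A PLo_I" and inj: "inj_on \<Phi> (carrier A)"
    using A(2) unfolding PL_embeddable_def by blast
  have one: "\<Phi> \<one>\<^bsub>A\<^esub> = id" using hom_one[OF hom A(1) PLo_group] by simp
  note g = bump_PLo
  define p :: real where "p = 1/4"
  have p: "p < bump p" "bump p = 1/2" by (auto simp: p_def bump_def)
  define J where "J i = {ipow bump i p<..<ipow bump (i + 1) p}" for i
  have disj: "i = j" if "x \<in> J i" "x \<in> J j" for i j x
    using intervals_disjoint[of "\<lambda>i. ipow bump (i + 1) p" "\<lambda>i. ipow bump i p" x i j]
      ipow_chain[OF g p(1)] that unfolding J_def by blast
  have J_iff: "ipow bump m x \<in> J i \<longleftrightarrow> x \<in> J (i - m)" for m x i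
    unfolding J_def by (rule ipow_mem_iff[OF g])
  have J0: "J 0 = {1/4<..<1/2}"
    unfolding J_def add_0 ipow_0 ipow_1[OF g] p(2) by (simp add: p_def)
  define s where "s = squeeze (1/4) (1/2)"
  \<comment> \<open>The i-th coordinate is first realised in (1/4, 1/2) and then carried to the i-th
    translate by conjugation.\<close>
  define u where "u f i = ipow bump i \<circ> s (\<Phi> (f i)) \<circ> ipow bump (- i)" for f i
  have \<Phi>_PLo: "\<Phi> a \<in> PLo_set" if "a \<in> carrier A" for a using hom_in_carrier[OF hom that] by simp
  have sup: "supported J (u f)" if f: "\<And>i. f i \<in> carrier A" for f
    unfolding supported_def
  proof (intro allI conjI impI)
    fix i
    have "s (\<Phi> (f i)) \<in> PLo_set"
      unfolding s_def using \<Phi>_PLo[OF f] by (intro squeeze_PLo) auto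
    then show "u f i \<in> PLo_set" unfolding u_def using g by (intro comp_PLo ipow_PLo)
    fix x assume "x \<notin> J i"
    then have "ipow bump (- i) x \<notin> J 0" by (simp add: J_iff)
    then have "s (\<Phi> (f i)) (ipow bump (- i) x) = ipow bump (- i) x"
      unfolding s_def J0 using \<Phi>_PLo[OF f] by (intro squeeze_out) auto
    then show "u f i x = x" using g by (simp add: u_def ipow_add_apply)
  qed
  define \<Psi> where "\<Psi> = (\<lambda>(f, m). glue J (u f) \<circ> ipow bump m)"
  \<comment> \<open>Conjugation by the m-th power of \<open>bump\<close> shifts the coordinates by
    m, which is the multiplication rule of the wreath product.\<close>
  have conj: "ipow bump m \<circ> glue J (u f) = glue J (u (\<lambda>i. f (i - m))) \<circ> ipow bump m" for m f
  proof
    fix x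
    show "(ipow bump m \<circ> glue J (u f)) x = (glue J (u (\<lambda>i. f (i - m))) \<circ> ipow bump m) x"
    proof (cases "\<exists>i. x \<in> J i")
      case True
      then obtain i where i: "x \<in> J i" by blast
      then have "ipow bump m x \<in> J (i + m)" by (simp add: J_iff)
      then show ?thesis using i g
        by (simp add: glue_in[of J, OF disj] u_def ipow_add_apply algebra_simps)
    next
      case False
      then have "ipow bump m x \<notin> J i" for i by (simp add: J_iff)
      then show ?thesis using False by (simp add: glue_out[of J, OF disj])
    qed
  qed
  have "\<Psi> \<in> hom (wreath_Z A) PLo_I"
  proof (rule homI)
    fix x assume x: "x \<in> carrier (wreath_Z A)"
    obtain f m where fm: "x = (f, m)" by fastforce
    have f: "\<And>i. f i \<in> carrier A" "finite {i. f i \<noteq> \<one>\<^bsub>A\<^esub>}"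
      using x fm by (auto simp: wreath_simps)
    have "u f i = id" if "f i = \<one>\<^bsub>A\<^esub>" for i
      using that g by (simp add: u_def one s_def squeeze_id fun_eq_iff ipow_add_apply)
    then have "{i. u f i \<noteq> id} \<subseteq> {i. f i \<noteq> \<one>\<^bsub>A\<^esub>}" by auto
    then have "finite {i. u f i \<noteq> id}" using f(2) by (rule finite_subset)
    then have "glue J (u f) \<in> PLo_set" using glue_PLo[of J "u f", OF disj sup[OF f(1)]] by simp
    then show "\<Psi> x \<in> carrier PLo_I" using fm g by (simp add: \<Psi>_def comp_PLo ipow_PLo)
  next
    fix x y assume xy: "x \<in> carrier (wreath_Z A)" "y \<in> carrier (wreath_Z A)"
    obtain f m h n where fm: "x = (f, m)" "y = (h, n)" by fastforce
    have f: "\<And>i. f i \<in> carrier A" "\<And>i. h i \<in> carrier A"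
      using xy fm by (auto simp: wreath_simps)
    have sup': "supported J (u (\<lambda>i. h (i - m)))" using sup f by simp
    have "u (\<lambda>i. f i \<otimes>\<^bsub>A\<^esub> h (i - m)) = (\<lambda>i. u f i \<circ> u (\<lambda>i. h (i - m)) i)"
    proof
      fix i
      have "\<Phi> (f i \<otimes>\<^bsub>A\<^esub> h (i - m)) = \<Phi> (f i) \<circ> \<Phi> (h (i - m))"
        using hom_mult[OF hom f(1)[of i] f(2)[of "i - m"]] by simp
      then have "s (\<Phi> (f i \<otimes>\<^bsub>A\<^esub> h (i - m))) = s (\<Phi> (f i)) \<circ> s (\<Phi> (h (i - m)))"
        by (simp only: s_def squeeze_comp)
      then show "u (\<lambda>i. f i \<otimes>\<^bsub>A\<^esub> h (i - m)) i = u f i \<circ> u (\<lambda>i. h (i - m)) i"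
        using g by (simp add: u_def fun_eq_iff ipow_add_apply)
    qed
    then have "\<Psi> (x \<otimes>\<^bsub>wreath_Z A\<^esub> y) = glue J (u f) \<circ> glue J (u (\<lambda>i. h (i - m))) \<circ> ipow bump m \<circ> ipow bump n"
      using glue_comp[of J "u (\<lambda>i. h (i - m))" "u f", OF disj sup'] g by (simp add: \<Psi>_def fm wreath_simps ipow_add comp_assoc)
    also have "\<dots> = glue J (u f) \<circ> ipow bump m \<circ> glue J (u h) \<circ> ipow bump n"
      using conj[of m h] by (simp add: comp_assoc)
    finally show "\<Psi> (x \<otimes>\<^bsub>wreath_Z A\<^esub> y) = \<Psi> x \<otimes>\<^bsub>PLo_I\<^esub> \<Psi> y"
      by (simp add: \<Psi>_def fm comp_assoc)
  qed
  moreover have "inj_on \<Psi> (carrier (wreath_Z A))"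
  proof (rule inj_onI)
    fix x y assume xy: "x \<in> carrier (wreath_Z A)" "y \<in> carrier (wreath_Z A)" and eq: "\<Psi> x = \<Psi> y"
    obtain f m h n where fm: "x = (f, m)" "y = (h, n)" by fastforce
    have f: "\<And>i. f i \<in> carrier A" "\<And>i. h i \<in> carrier A"
      using xy fm by (auto simp: wreath_simps)
    \<comment> \<open>The orbit of p consists of ends of the intervals, which glued maps fix. Hence
      the image of p under \<open>\<Psi> (f, m)\<close> reveals m.\<close>
    have orb: "ipow bump i p \<notin> J j" for i j
    proof
      assume "ipow bump i p \<in> J j"
      then have "p \<in> J (j - i)" by (simp add: J_iff)
      then have "ipow bump (j - i) p < p" "p < ipow bump (j - i + 1) p" by (auto simp: J_def)
      then show False
        using ipow_chain[OF g p(1), of "j - i" 0] ipow_chain[OF g p(1), of 0 "j - i"]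
          ipow_less[OF g p(1), of 0] by (cases "j - i" "0::int" rule: linorder_cases) auto
    qed
    have "ipow bump m p = \<Psi> x p" "ipow bump n p = \<Psi> y p"
      using orb by (simp_all add: \<Psi>_def fm glue_out[of J, OF disj])
    then have mn: "ipow bump m p = ipow bump n p" using eq by simp
    have "m = n"
      using ipow_chain[OF g p(1), of m n] ipow_chain[OF g p(1), of n m] mn
        ipow_less[OF g p(1), of m] ipow_less[OF g p(1), of n]
      by (cases m n rule: linorder_cases) auto
    have "glue J (u f) = \<Psi> x \<circ> ipow bump (- m)" "glue J (u h) = \<Psi> y \<circ> ipow bump (- m)"
      using g \<open>m = n\<close> by (simp_all add: \<Psi>_def fm fun_eq_iff ipow_add_apply)
    then have uu: "u f = u h"
      using eq glue_inject[of J "u f" "u h", OF disj sup[OF f(1)] sup[OF f(2)]] by simp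
    have "f i = h i" for i
    proof -
      have "s (\<Phi> (f i)) = ipow bump (- i) \<circ> u f i \<circ> ipow bump i"
        "s (\<Phi> (h i)) = ipow bump (- i) \<circ> u h i \<circ> ipow bump i"
        using g by (simp_all add: u_def fun_eq_iff ipow_add_apply)
      then have "s (\<Phi> (f i)) = s (\<Phi> (h i))" using uu by simp
      then have "\<Phi> (f i) = \<Phi> (h i)" unfolding s_def by (rule squeeze_inject[rotated]) simp
      then show ?thesis using inj f by (auto simp: inj_on_def)
    qed
    then show "x = y" using fm \<open>m = n\<close> by auto
  qed
  ultimately show ?thesis unfolding PL_embeddable_def by blast
qed

lemma PL_embeddable_embed:
  assumes "PL_embeddable A" "\<Phi> \<in> hom G A" "inj_on \<Phi> (carrier G)"
  shows "PL_embeddable G"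
proof -
  obtain \<Psi> where \<Psi>: "\<Psi> \<in> hom A PLo_I" "inj_on \<Psi> (carrier A)"
    using assms(1) unfolding PL_embeddable_def by blast
  have "\<Psi> \<circ> \<Phi> \<in> hom G PLo_I" by (rule hom_compose[OF assms(2) \<Psi>(1)])
  moreover have "inj_on (\<Psi> \<circ> \<Phi>) (carrier G)"
    using assms(3) inj_on_subset[OF \<Psi>(2) hom_carrier[OF assms(2)]] by (rule comp_inj_on)
  ultimately show ?thesis unfolding PL_embeddable_def by blast
qed

text \<open>Minimality of R acts as an induction principle: the embeddable groups of finite derived
  length form a non-empty closed class. The uniform bound in the sum clause is what keeps the
  derived length finite there.\<close>

lemma R_class_PL:
  assumes "G \<in> R_class"
  shows "PL_embeddable G \<and> (\<exists>n. derived_length_le G n)"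
proof -
  define C :: "nat monoid set" where
    "C = {G. group G \<and> PL_embeddable G \<and> (\<exists>n. derived_length_le G n)}"
  have iso: "G \<in> C" if "group G" "G \<cong> A" "group A" "PL_embeddable A" "derived_length_le A n"
    for G :: "nat monoid" and A :: "'c monoid" and n
  proof -
    obtain \<Phi> where "\<Phi> \<in> hom G A" "inj_on \<Phi> (carrier G)"
      using \<open>G \<cong> A\<close> unfolding is_iso_def iso_def bij_betw_def by blast
    then show ?thesis unfolding C_def
      using PL_embeddable_embed[OF that(4)] derived_length_le_embed[OF that(1,3) _ _ that(5)] that(1)
      by blast
  qed
  have "R_closed C"
    unfolding R_closed_def
  proof (intro conjI ballI allI impI)
    fix A G assume A: "A \<in> C" and G: "group (G::nat monoid) \<and> G \<cong> wreath_Z A"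
    then obtain n where "derived_length_le A n" "group A" "PL_embeddable A" unfolding C_def by blast
    then show "G \<in> C"
      using iso[of G "wreath_Z A"] G wreath_group PL_embeddable_wreath derived_length_le_wreath by blast
  next
    fix A :: "nat \<Rightarrow> nat monoid" and G
    assume "(\<forall>i. A i \<in> C) \<and> (\<exists>n. \<forall>i. derived_length_le (A i) n)"
    then obtain n where A: "\<And>i. group (A i)" "\<And>i. PL_embeddable (A i)" "\<And>i. derived_length_le (A i) n"
      unfolding C_def by blast
    assume G: "group (G::nat monoid) \<and> G \<cong> dsum A"
    then show "G \<in> C"
      using iso[of G "dsum A" n] dsum_group[of A] PL_embeddable_dsum[of A] derived_length_le_dsum[of A n] A
      by simp
  next
    fix A K assume A: "A \<in> C" and K: "subgroup K A"
    then obtain n where n: "derived_length_le A n" "group A" "PL_embeddable A" unfolding C_def by blast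
    have gK: "group (A\<lparr>carrier := K\<rparr>)" using n K group.subgroup_imp_group by blast
    have "(\<lambda>x. x) \<in> hom (A\<lparr>carrier := K\<rparr>) A"
      using subgroup.subset[OF K] by (auto simp: hom_def)
    then show "A\<lparr>carrier := K\<rparr> \<in> C"
      unfolding C_def using PL_embeddable_embed[OF n(3)] derived_length_le_embed[OF gK n(2) _ _ n(1)] gK
      by (simp add: inj_on_def) blast
  qed (auto simp: C_def)
  moreover have "C \<noteq> {}"
  proof -
    let ?T = "\<lparr>carrier = {0::nat}, mult = (\<lambda>_ _. 0), one = 0\<rparr>"
    have "(\<lambda>_. id) \<in> hom ?T PLo_I" by (auto simp: hom_def id_PLo)
    then have "PL_embeddable ?T" unfolding PL_embeddable_def by (auto simp: inj_on_def)
    moreover have "derived_length_le ?T 0" by (simp add: derived_length_le_def)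
    ultimately have "?T \<in> C" unfolding C_def using trivial_group by blast
    then show ?thesis by blast
  qed
  ultimately have "G \<in> C" using assms R_class_subset by (meson subsetD)
  then show ?thesis by (simp add: C_def)
qed

subsection \<open>Solvable groups of compactly supported maps\<close>

lemma subgroup_PLoD:
  assumes "subgroup H PLo_I" "f \<in> H"
  shows "f \<in> PLo_set" "pl_homeo f" "finv f \<in> H"
proof -
  show f: "f \<in> PLo_set" using subgroup.mem_carrier[OF assms] by simp
  then show "pl_homeo f" by (rule PLo_setD)
  show "finv f \<in> H" using subgroup.m_inv_closed[OF assms] PLo_inv[OF f] by simp
qed

lemma subgroup_PLo_id: "subgroup H PLo_I \<Longrightarrow> id \<in> H"
  using subgroup.one_closed by fastforce

lemma subgroup_PLo_comp: "subgroup H PLo_I \<Longrightarrow> f \<in> H \<Longrightarrow> g \<in> H \<Longrightarrow> f \<circ> g \<in> H"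
  using subgroup.m_closed[of H PLo_I f g] by simp

lemma subgroup_PLo_ipow:
  assumes "subgroup H PLo_I" "g \<in> H"
  shows "ipow g m \<in> H"
  using group.int_pow_consistent[OF PLo_group assms, of m]
    group.int_pow_closed[OF subgroup.subgroup_is_group[OF assms(1) PLo_group], of g m] assms(2)
  by simp

lemma subgroup_PLoI:
  assumes "H \<subseteq> PLo_set" "id \<in> H" "\<And>f. f \<in> H \<Longrightarrow> finv f \<in> H"
    "\<And>f g. f \<in> H \<Longrightarrow> g \<in> H \<Longrightarrow> f \<circ> g \<in> H"
  shows "subgroup H PLo_I"
  by (rule group.subgroupI[OF PLo_group]) (use assms PLo_inv in auto)

text \<open>Since X is invariant under f and its inverse, f carries upper bounds of X to upper
  bounds of X in both directions. Applied to orbits and to sets of fixed points, this takes the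
  place of limit arguments.\<close>

lemma Sup_invariant_fixed:
  assumes f: "pl_homeo f" and X: "X \<noteq> {}" "bdd_above X"
    and inv: "\<And>x. x \<in> X \<Longrightarrow> f x \<in> X \<and> finv f x \<in> X"
  shows "f (Sup X) = Sup X"
proof (rule antisym)
  have "Sup X \<le> finv f (Sup X)"
  proof (rule cSup_least[OF X(1)])
    fix y assume "y \<in> X"
    then have "f y \<le> Sup X" using inv X cSup_upper by blast
    then show "y \<le> finv f (Sup X)" using finv_less_iff(1)[OF f] by (meson not_less)
  qed
  then show "f (Sup X) \<le> Sup X" using finv_less_iff(1)[OF f] by (meson not_less)
  show "Sup X \<le> f (Sup X)"
  proof (rule cSup_least[OF X(1)])
    fix y assume "y \<in> X"
    then have "finv f y \<le> Sup X" using inv X cSup_upper by blast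
    then show "y \<le> f (Sup X)" using finv_less_iff(2)[OF f] by (meson not_less)
  qed
qed

lemma Inf_invariant_fixed:
  assumes f: "pl_homeo f" and X: "X \<noteq> {}" "bdd_below X"
    and inv: "\<And>x. x \<in> X \<Longrightarrow> f x \<in> X \<and> finv f x \<in> X"
  shows "f (Inf X) = Inf X"
proof (rule antisym)
  show "f (Inf X) \<le> Inf X"
  proof (rule cInf_greatest[OF X(1)])
    fix y assume "y \<in> X"
    then have "Inf X \<le> finv f y" using inv X cInf_lower by blast
    then show "f (Inf X) \<le> y" using finv_less_iff(1)[OF f] by (meson not_less)
  qed
  have "finv f (Inf X) \<le> Inf X"
  proof (rule cInf_greatest[OF X(1)])
    fix y assume "y \<in> X"
    then have "Inf X \<le> f y" using inv X cInf_lower by blast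
    then show "finv f (Inf X) \<le> y" using finv_less_iff(2)[OF f] by (meson not_less)
  qed
  then show "Inf X \<le> f (Inf X)" using finv_less_iff(2)[OF f] by (meson not_less)
qed

text \<open>If the orbit of c stayed below d, its supremum would be a common fixed point between a
  and b.\<close>

lemma orbit_unbounded:
  assumes H: "subgroup H PLo_I" and fix_b: "\<And>h. h \<in> H \<Longrightarrow> h b = b"
    and nofix: "\<And>p. a < p \<Longrightarrow> p < b \<Longrightarrow> \<exists>h\<in>H. h p \<noteq> p"
    and c: "a < c" "c < b" and d: "d < b"
  shows "\<exists>h\<in>H. d < h c"
proof (rule ccontr)
  assume "\<not> ?thesis"
  then have le: "\<And>h. h \<in> H \<Longrightarrow> h c \<le> d" by force
  define X where "X = (\<lambda>h. h c) ` H"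
  have cX: "c \<in> X" unfolding X_def using image_eqI[of c "\<lambda>h. h c" id H] subgroup_PLo_id[OF H] by simp
  have bdd: "bdd_above X" using le by (auto simp: X_def intro!: bdd_aboveI[of _ d])
  have "f (Sup X) = Sup X" if f: "f \<in> H" for f
  proof (rule Sup_invariant_fixed)
    fix x assume "x \<in> X"
    then obtain h where h: "h \<in> H" "x = h c" by (auto simp: X_def)
    have "f \<circ> h \<in> H" "finv f \<circ> h \<in> H"
      using subgroup_PLo_comp[OF H] subgroup_PLoD[OF H f] f h by auto
    then show "f x \<in> X \<and> finv f x \<in> X"
      using h image_eqI[of "f x" "\<lambda>h. h c" "f \<circ> h" H]
        image_eqI[of "finv f x" "\<lambda>h. h c" "finv f \<circ> h" H] by (simp add: X_def)
  qed (use subgroup_PLoD[OF H f] cX bdd in auto)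
  moreover have "a < Sup X" using cSup_upper[OF cX bdd] c by linarith
  moreover have "Sup X \<le> d" by (rule cSup_least) (use cX le in \<open>auto simp: X_def\<close>)
  ultimately show False using nofix[of "Sup X"] d by auto
qed

text \<open>A point that f moves goes to a point that f moves again, so both lie in A, where g is
  the identity; likewise with f and g exchanged.\<close>

lemma disjoint_support_commute:
  assumes f: "pl_homeo f" "\<And>x. f x \<noteq> x \<Longrightarrow> x \<in> A" and g: "pl_homeo g" "\<And>x. g x \<noteq> x \<Longrightarrow> x \<in> B"
    and AB: "A \<inter> B = {}"
  shows "f \<circ> g = g \<circ> f"
proof
  fix x
  have fA: "f (f x) \<noteq> f x \<longleftrightarrow> f x \<noteq> x" "g (g x) \<noteq> g x \<longleftrightarrow> g x \<noteq> x"
    using f g by (simp_all add: pl_homeo_eq_iff)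
  show "(f \<circ> g) x = (g \<circ> f) x"
    using f(2)[of x] g(2)[of x] f(2)[of "f x"] g(2)[of "g x"] f(2)[of "g x"] g(2)[of "f x"] AB fA
    by (cases "f x = x"; cases "g x = x") auto
qed

text \<open>With a a' and b b' chosen as commutators, this exhibits the commutator of a and b as an
  element of the second derived subgroup.\<close>

lemma (in group) commutator_mult_commuting:
  assumes "a \<in> carrier G" "b \<in> carrier G" "a' \<in> carrier G" "b' \<in> carrier G"
    and "a' \<otimes> b = b \<otimes> a'" "a' \<otimes> b' = b' \<otimes> a'" "b' \<otimes> a = a \<otimes> b'"
  shows "(a \<otimes> a') \<otimes> (b \<otimes> b') \<otimes> inv (a \<otimes> a') \<otimes> inv (b \<otimes> b') = a \<otimes> b \<otimes> inv a \<otimes> inv b"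
proof -
  let ?c = "a \<otimes> b \<otimes> inv a \<otimes> inv b"
  have aux: "inv x \<otimes> (x \<otimes> y) = y" "x \<otimes> (inv x \<otimes> y) = y"
    if "x \<in> carrier G" "y \<in> carrier G" for x y
    using that by (simp_all flip: m_assoc)
  \<comment> \<open>The claim is cleared of the inverses of the two products: it suffices that ?c
    times (b b')(a a') equals (a a')(b b').\<close>
  have "?c \<otimes> (b \<otimes> b') \<otimes> (a \<otimes> a') = a \<otimes> b \<otimes> inv a \<otimes> (b' \<otimes> a) \<otimes> a'"
    using assms(1-4) by (simp add: m_assoc aux)
  also have "\<dots> = a \<otimes> b \<otimes> inv a \<otimes> (a \<otimes> b') \<otimes> a'"
    by (simp only: assms(7))
  also have "\<dots> = a \<otimes> b \<otimes> (b' \<otimes> a')"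
    using assms(1-4) by (simp add: m_assoc aux)
  also have "\<dots> = a \<otimes> b \<otimes> (a' \<otimes> b')"
    by (simp only: assms(6))
  also have "\<dots> = a \<otimes> (b \<otimes> a') \<otimes> b'"
    using assms(1-4) by (simp add: m_assoc)
  also have "\<dots> = a \<otimes> (a' \<otimes> b) \<otimes> b'"
    by (simp only: assms(5))
  also have "\<dots> = (a \<otimes> a') \<otimes> (b \<otimes> b')"
    using assms(1-4) by (simp add: m_assoc)
  finally have "(a \<otimes> a') \<otimes> (b \<otimes> b') = ?c \<otimes> (b \<otimes> b') \<otimes> (a \<otimes> a')" by (rule sym)
  moreover have "x \<otimes> y \<otimes> z \<otimes> inv z \<otimes> inv y = x"
    if "x \<in> carrier G" "y \<in> carrier G" "z \<in> carrier G" for x y z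
    using that by (simp add: m_assoc)
  ultimately show ?thesis using assms(1-4) by (metis m_closed inv_closed)
qed

lemma commutator_in_derived:
  assumes "subgroup H PLo_I" "f \<in> H" "g \<in> H"
  shows "f \<circ> g \<circ> finv f \<circ> finv g \<in> derived PLo_I H"
  unfolding derived_def
  by (rule generate.incl) (use assms subgroup_PLoD PLo_inv in force)

lemma derived_subgroup_PLo: "subgroup H PLo_I \<Longrightarrow> subgroup (derived PLo_I H) PLo_I"
  using group.derived_is_subgroup[OF PLo_group] subgroup.subset by blast

lemma finv_fixed: "pl_homeo f \<Longrightarrow> f x = x \<Longrightarrow> finv f x = x"
  by (metis pl_homeo_inv_apply(2))

text \<open>If supports can be moved off one another, a commutator of two elements is a commutator of
  commutators, so the derived series cannot descend.\<close>

lemma common_fixed_point: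
  assumes H: "subgroup H PLo_I" and solv: "(derived PLo_I ^^ n) H = {id}" and ab: "a < b"
    and cpt: "\<And>h. h \<in> H \<Longrightarrow> \<exists>c d. a < c \<and> c < d \<and> d < b \<and> (\<forall>x. x \<notin> {c..d} \<longrightarrow> h x = x)"
  shows "\<exists>p. a < p \<and> p < b \<and> (\<forall>h\<in>H. h p = p)"
proof (rule ccontr)
  assume "\<not> ?thesis"
  then have nofix: "\<And>p. a < p \<Longrightarrow> p < b \<Longrightarrow> \<exists>h\<in>H. h p \<noteq> p" by blast
  have fix_b: "h b = b" if "h \<in> H" for h using cpt[OF that] by fastforce
  have unb: "\<exists>h\<in>H. d < h c" if "a < c" "c < b" "d < b" for c d
    using orbit_unbounded[of H b a c d] H fix_b nofix that by blast
  have conj_supp: "x \<in> {h c..h d}"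
    if h: "h \<in> H" and f: "f \<in> H" "\<And>x. f x \<noteq> x \<Longrightarrow> x \<in> {c..d}"
      and x: "(h \<circ> finv f \<circ> finv h) x \<noteq> x" for h f c d x
  proof -
    have "finv f (finv h x) \<noteq> finv h x"
    proof
      assume "finv f (finv h x) = finv h x"
      then show False using x subgroup_PLoD(2)[OF H h] by simp
    qed
    then have "f (finv h x) \<noteq> finv h x" using finv_fixed[OF subgroup_PLoD(2)[OF H f(1)]] by blast
    then have "finv h x \<in> {c..d}" by (rule f(2))
    then show ?thesis using finv_less_iff[OF subgroup_PLoD(2)[OF H h]] by (auto simp: not_less[symmetric])
  qed
  have gen: "generate PLo_I (derived_set PLo_I H) \<subseteq> derived PLo_I (derived PLo_I H)"
  proof (rule group.generate_subgroup_incl[OF PLo_group])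
    show "subgroup (derived PLo_I (derived PLo_I H)) PLo_I"
      using H by (intro derived_subgroup_PLo)
    show "derived_set PLo_I H \<subseteq> derived PLo_I (derived PLo_I H)"
    proof clarify
      fix f g assume f: "f \<in> H" and g: "g \<in> H"
      obtain c1 d1 where 1: "a < c1" "c1 < d1" "d1 < b" "\<And>x. x \<notin> {c1..d1} \<Longrightarrow> f x = x"
        using cpt[OF f] by blast
      obtain c2 d2 where 2: "a < c2" "c2 < d2" "d2 < b" "\<And>x. x \<notin> {c2..d2} \<Longrightarrow> g x = x"
        using cpt[OF g] by blast
      define c d where "c = min c1 c2" and "d = max d1 d2"
      have cd: "a < c" "c < d" "d < b" using 1 2 by (auto simp: c_def d_def)
      have fs: "f x \<noteq> x \<Longrightarrow> x \<in> {c..d}" and gs: "g x \<noteq> x \<Longrightarrow> x \<in> {c..d}" for x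
        using 1(4)[of x] 2(4)[of x] by (auto simp: c_def d_def min_le_iff_disj le_max_iff_disj)
      \<comment> \<open>The interval [c, d] contains both supports. Two elements h and h' are chosen
        so that [c, d], its image under h and its image under h' follow one another without
        overlap.\<close>
      obtain h where h: "h \<in> H" "d < h c" using unb[of c d] cd by auto
      have "h d < b" using cd fix_b[OF h(1)] pl_homeo_less_iff[OF subgroup_PLoD(2)[OF H h(1)], of d b] by simp
      then obtain h' where h': "h' \<in> H" "h d < h' c" using unb[of c "h d"] cd by auto
      have hcd: "h c < h d" using cd pl_homeo_less_iff[OF subgroup_PLoD(2)[OF H h(1)]] by simp
      \<comment> \<open>The inverse inside the conjugate makes f \<circ> f' the commutator of f and
        h, hence an element of the derived subgroup, while f' itself is supported in the image of
        [c, d] under h.\<close>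
      define f' where "f' = h \<circ> finv f \<circ> finv h"
      define g' where "g' = h' \<circ> finv g \<circ> finv h'"
      have f's: "f' x \<noteq> x \<Longrightarrow> x \<in> {h c..h d}" for x unfolding f'_def by (rule conj_supp[OF h(1) f fs])
      have g's: "g' x \<noteq> x \<Longrightarrow> x \<in> {h' c..h' d}" for x unfolding g'_def by (rule conj_supp[OF h'(1) g gs])
      have mem: "f' \<in> H" "g' \<in> H" unfolding f'_def g'_def
        using f g h(1) h'(1) subgroup_PLoD(3)[OF H] by (auto intro!: subgroup_PLo_comp[OF H])
      have c1: "f' \<circ> g = g \<circ> f'"
        by (rule disjoint_support_commute[OF _ f's _ gs]) (use mem g h hcd subgroup_PLoD(2)[OF H] in auto)
      have c2: "f' \<circ> g' = g' \<circ> f'"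
        by (rule disjoint_support_commute[OF _ f's _ g's]) (use mem h' subgroup_PLoD(2)[OF H] in auto)
      have c3: "g' \<circ> f = f \<circ> g'"
        by (rule disjoint_support_commute[OF _ g's _ fs]) (use mem f h h' hcd subgroup_PLoD(2)[OF H] in auto)
      have "f \<circ> f' \<in> derived PLo_I H" "g \<circ> g' \<in> derived PLo_I H"
        using commutator_in_derived[OF H f h(1)] commutator_in_derived[OF H g h'(1)]
        by (simp_all add: f'_def g'_def comp_assoc)
      then have "(f \<circ> f') \<circ> (g \<circ> g') \<circ> finv (f \<circ> f') \<circ> finv (g \<circ> g') \<in> derived PLo_I (derived PLo_I H)"
        using commutator_in_derived derived_subgroup_PLo H by blast
      moreover have "f \<otimes>\<^bsub>PLo_I\<^esub> g \<otimes>\<^bsub>PLo_I\<^esub> inv\<^bsub>PLo_I\<^esub> f \<otimes>\<^bsub>PLo_I\<^esub> inv\<^bsub>PLo_I\<^esub> g =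
         (f \<circ> f') \<circ> (g \<circ> g') \<circ> finv (f \<circ> f') \<circ> finv (g \<circ> g')"
        using group.commutator_mult_commuting[OF PLo_group, of f g f' g'] c1 c2 c3
          subgroup_PLoD(1)[OF H] f g mem by (simp add: PLo_inv comp_PLo)
      ultimately show "f \<otimes>\<^bsub>PLo_I\<^esub> g \<otimes>\<^bsub>PLo_I\<^esub> inv\<^bsub>PLo_I\<^esub> f \<otimes>\<^bsub>PLo_I\<^esub> inv\<^bsub>PLo_I\<^esub> g
          \<in> derived PLo_I (derived PLo_I H)" by metis
    qed
  qed
  have "derived PLo_I H \<subseteq> derived PLo_I (derived PLo_I H)"
    by (rule ord_eq_le_trans[OF derived_def gen])
  \<comment> \<open>The derived subgroup lies in its own derived subgroup, hence in all later terms
    of the series, which end at the identity. So H is abelian.\<close>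
  then have "derived PLo_I H \<subseteq> (derived PLo_I ^^ Suc k) H" for k
  proof (induction k)
    case (Suc k)
    have "derived PLo_I (derived PLo_I H) \<subseteq> (derived PLo_I ^^ Suc (Suc k)) H"
      using group.mono_derived[OF PLo_group Suc.IH] Suc.prems by simp
    then show ?case using Suc.prems by (rule order_trans[rotated])
  qed simp
  from this[of n] have "derived PLo_I H \<subseteq> derived PLo_I {id}" by (simp add: solv)
  also have "\<dots> \<subseteq> {id}"
    using group.derived_incl[OF PLo_group order_refl group.triv_subgroup[OF PLo_group]] by simp
  finally have triv: "derived PLo_I H \<subseteq> {id}" .
  have comm: "f (g x) = g (f x)" if fg: "f \<in> H" "g \<in> H" for f g x
  proof -
    have "f \<circ> g \<circ> finv f \<circ> finv g = id" using commutator_in_derived[OF H fg] triv by blast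
    then have "(f \<circ> g \<circ> finv f \<circ> finv g) (g (f x)) = g (f x)" by simp
    then show ?thesis using subgroup_PLoD(2)[OF H] fg by simp
  qed
  \<comment> \<open>An abelian H is excluded too: if h moves p beyond the support of f, then f fixes
    h p, and commuting with h makes f fix p.\<close>
  obtain p where p: "a < p" "p < b" using ab dense by blast
  obtain f where f: "f \<in> H" "f p \<noteq> p" using nofix p by blast
  obtain c d where cd: "a < c" "c < d" "d < b" "\<And>x. x \<notin> {c..d} \<Longrightarrow> f x = x"
    using cpt[OF f(1)] by blast
  have "c \<le> p" using cd(4)[of p] f(2) by auto
  obtain h where h: "h \<in> H" "d < h c" using unb[of c d] cd by auto
  have "h c \<le> h p" using \<open>c \<le> p\<close> subgroup_PLoD(2)[OF H h(1)] by (simp add: pl_homeo_le_iff)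
  then have "f (h p) = h p" using cd(4) h by auto
  then have "h (f p) = h p" using comm f h by simp
  then show False using f(2) subgroup_PLoD(2)[OF H h(1)] by (simp add: pl_homeo_eq_iff)
qed

subsection \<open>One-sided slopes\<close>

text \<open>A one-sided derivative for maps that are exactly affine near x. The sign chooses the
  side, 1 for the right and -1 for the left, so both ends of an orbital share the same lemmas; t is
  the distance from x.\<close>

definition germ :: "real \<Rightarrow> (real \<Rightarrow> real) \<Rightarrow> real \<Rightarrow> real \<Rightarrow> bool" where
  "germ \<sigma> f x s \<longleftrightarrow> (\<exists>e>0. \<forall>t\<in>{0..e}. f (x + \<sigma> * t) = f x + \<sigma> * (s * t))"

definition slope :: "real \<Rightarrow> (real \<Rightarrow> real) \<Rightarrow> real \<Rightarrow> real" where
  "slope \<sigma> f x = (SOME s. 0 < s \<and> germ \<sigma> f x s)"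

lemma finite_gap:
  fixes x :: real
  assumes "finite S"
  shows "\<exists>e>0. {x<..<x + e} \<inter> S = {} \<and> {x - e<..<x} \<inter> S = {}"
  using assms
proof (induction S)
  case empty
  show ?case by (intro exI[of _ 1]) simp
next
  case (insert y S)
  then obtain e where e: "e > 0" "{x<..<x + e} \<inter> S = {}" "{x - e<..<x} \<inter> S = {}" by blast
  define e' where "e' = (if y = x then e else min e \<bar>y - x\<bar>)"
  have "e' > 0" "e' \<le> e" "y \<notin> {x<..<x + e'}" "y \<notin> {x - e'<..<x}"
    using e(1) by (auto simp: e'_def)
  moreover have "{x<..<x + e'} \<subseteq> {x<..<x + e}" "{x - e'<..<x} \<subseteq> {x - e<..<x}"
    using \<open>e' \<le> e\<close> by auto
  ultimately show ?case using e(2,3) by (intro exI[of _ e']) blast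
qed

lemma germ_exists:
  assumes f: "pl_homeo f" and \<sigma>: "\<sigma> = 1 \<or> \<sigma> = - 1"
  shows "\<exists>s>0. germ \<sigma> f x s"
proof -
  obtain S where S: "finite S" "aff_off S f" using f unfolding pl_homeo_def by blast
  obtain e where e: "e > 0" "{x<..<x + e} \<inter> S = {}" "{x - e<..<x} \<inter> S = {}"
    using finite_gap[OF S(1)] by blast
  note cont = pl_homeo_continuous[OF f]
  have "\<exists>s r. \<forall>t\<in>{0..e}. f (x + \<sigma> * t) = s * (x + \<sigma> * t) + r"
    using \<sigma>
  proof
    assume \<sigma>: "\<sigma> = 1"
    have less: "x < x + e" using e(1) by simp
    obtain s r where sr: "\<And>y. y \<in> {x<..<x + e} \<Longrightarrow> f y = s * y + r"
      using aff_offE[OF S(2) less e(2)] by metis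
    have "f y = s * y + r" if "y \<in> {x..x + e}" for y
      by (rule affine_extend[OF cont less sr that])
    then show ?thesis using \<sigma> by auto
  next
    assume \<sigma>: "\<sigma> = - 1"
    have less: "x - e < x" using e(1) by simp
    obtain s r where sr: "\<And>y. y \<in> {x - e<..<x} \<Longrightarrow> f y = s * y + r"
      using aff_offE[OF S(2) less e(3)] by metis
    have "f y = s * y + r" if "y \<in> {x - e..x}" for y
      by (rule affine_extend[OF cont less sr that])
    then show ?thesis using \<sigma> by auto
  qed
  then obtain s r where sr: "\<And>t. t \<in> {0..e} \<Longrightarrow> f (x + \<sigma> * t) = s * (x + \<sigma> * t) + r" by blast
  have fx: "f x = s * x + r" using sr[of 0] e(1) by simp
  then have "germ \<sigma> f x s"
    unfolding germ_def using sr e(1) by (intro exI[of _ e]) (auto simp: algebra_simps)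
  moreover have "s > 0"
  proof -
    have "f (x + \<sigma> * e) - f x = \<sigma> * e * s" using sr[of e] e(1) fx by (simp add: algebra_simps)
    moreover have "0 < \<sigma> * e \<Longrightarrow> f x < f (x + \<sigma> * e)" "\<sigma> * e < 0 \<Longrightarrow> f (x + \<sigma> * e) < f x"
      using f by (simp_all add: pl_homeo_less_iff)
    ultimately have "0 < e * s" using \<sigma> e(1) by auto
    then show ?thesis using e(1) by (rule zero_less_mult_pos)
  qed
  ultimately show ?thesis by blast
qed

lemma germ_unique:
  assumes "germ \<sigma> f x s" "germ \<sigma> f x r" "\<sigma> = 1 \<or> \<sigma> = - 1"
  shows "s = r"
proof -
  obtain e where e: "e > 0" "\<And>t. t \<in> {0..e} \<Longrightarrow> f (x + \<sigma> * t) = f x + \<sigma> * (s * t)"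
    using assms(1) unfolding germ_def by blast
  obtain e' where e': "e' > 0" "\<And>t. t \<in> {0..e'} \<Longrightarrow> f (x + \<sigma> * t) = f x + \<sigma> * (r * t)"
    using assms(2) unfolding germ_def by blast
  define t where "t = min e e'"
  have "t > 0" using e e' by (simp add: t_def)
  moreover have "\<sigma> * (s * t) = \<sigma> * (r * t)"
    using e(2)[of t] e'(2)[of t] e(1) e'(1) by (simp add: t_def)
  ultimately show ?thesis using assms(3) by auto
qed

lemma
  assumes "pl_homeo f" "\<sigma> = 1 \<or> \<sigma> = - 1"
  shows slope_germ: "germ \<sigma> f x (slope \<sigma> f x)" and slope_pos: "0 < slope \<sigma> f x"
  using someI_ex[OF germ_exists[OF assms, of x]] by (simp_all add: slope_def)

lemma slope_eqI:
  assumes "pl_homeo f" "\<sigma> = 1 \<or> \<sigma> = - 1" "germ \<sigma> f x s"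
  shows "slope \<sigma> f x = s"
  using germ_unique[OF slope_germ[OF assms(1,2)] assms(3,2)] .

lemma slope_id: "\<sigma> = 1 \<or> \<sigma> = - 1 \<Longrightarrow> slope \<sigma> id x = 1"
  by (rule slope_eqI[OF id_pl_homeo]) (auto simp: germ_def intro: exI[of _ 1])

lemma slope_comp:
  assumes f: "pl_homeo f" and g: "pl_homeo g" and \<sigma>: "\<sigma> = 1 \<or> \<sigma> = - 1"
  shows "slope \<sigma> (f \<circ> g) x = slope \<sigma> f (g x) * slope \<sigma> g x"
proof (rule slope_eqI[OF pl_homeo_comp[OF f g] \<sigma>])
  define s r where "s = slope \<sigma> f (g x)" and "r = slope \<sigma> g x"
  have r: "r > 0" unfolding r_def by (rule slope_pos[OF g \<sigma>])
  obtain e where e: "e > 0" "\<And>t. t \<in> {0..e} \<Longrightarrow> f (g x + \<sigma> * t) = f (g x) + \<sigma> * (s * t)"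
    using slope_germ[OF f \<sigma>, of "g x"] unfolding germ_def s_def by blast
  obtain e' where e': "e' > 0" "\<And>t. t \<in> {0..e'} \<Longrightarrow> g (x + \<sigma> * t) = g x + \<sigma> * (r * t)"
    using slope_germ[OF g \<sigma>, of x] unfolding germ_def r_def by blast
  \<comment> \<open>The bound e / r keeps the image distance r * t inside the range where f is
    affine.\<close>
  define e'' where "e'' = min e' (e / r)"
  have "e'' > 0" using e e' r by (simp add: e''_def)
  moreover have "(f \<circ> g) (x + \<sigma> * t) = (f \<circ> g) x + \<sigma> * (s * r * t)" if t: "t \<in> {0..e''}" for t
  proof -
    have "r * t \<in> {0..e}" using t r by (auto simp: e''_def field_simps)
    then show ?thesis using e'(2)[of t] e(2)[of "r * t"] t by (simp add: e''_def mult.assoc)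
  qed
  ultimately show "germ \<sigma> (f \<circ> g) x (s * r)" unfolding germ_def by blast
qed

lemma slope_finv:
  assumes f: "pl_homeo f" "f x = x" and \<sigma>: "\<sigma> = 1 \<or> \<sigma> = - 1"
  shows "slope \<sigma> (finv f) x = 1 / slope \<sigma> f x"
proof -
  have "finv f \<circ> f = id" using f by (simp add: fun_eq_iff)
  then have "slope \<sigma> (finv f) x * slope \<sigma> f x = 1"
    using slope_comp[OF pl_homeo_inv[OF f(1)] f(1) \<sigma>, of x] slope_id[OF \<sigma>, of x] f(2) by simp
  then show ?thesis using slope_pos[OF f(1) \<sigma>, of x] by (simp add: field_simps)
qed

lemma slope_fixedE:
  assumes f: "pl_homeo f" "f x = x" and \<sigma>: "\<sigma> = 1 \<or> \<sigma> = - 1"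
  obtains e where "e > 0" "\<And>t. 0 \<le> t \<Longrightarrow> t \<le> e \<Longrightarrow> f (x + \<sigma> * t) = x + \<sigma> * (slope \<sigma> f x * t)"
  using slope_germ[OF f(1) \<sigma>, of x] f(2) unfolding germ_def by auto

subsection \<open>Solvable groups with a single orbital\<close>

locale one_orbital =
  fixes H :: "(real \<Rightarrow> real) set" and a b :: real and n :: nat
  assumes H: "subgroup H PLo_I" and ab: "a < b"
    and supp: "\<And>h x. h \<in> H \<Longrightarrow> x \<notin> {a<..<b} \<Longrightarrow> h x = x"
    and nofix: "\<And>p. a < p \<Longrightarrow> p < b \<Longrightarrow> \<exists>h\<in>H. h p \<noteq> p"
    and solv: "(derived PLo_I ^^ n) H = {id}"
begin

lemmas HD = subgroup_PLoD[OF H]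
lemmas H_id = subgroup_PLo_id[OF H]
lemmas H_comp = subgroup_PLo_comp[OF H]
lemmas H_ipow = subgroup_PLo_ipow[OF H]

lemma fix_ends [simp]: "h \<in> H \<Longrightarrow> h a = a" "h \<in> H \<Longrightarrow> h b = b"
  using supp by auto

lemma H_mem_iff: "h \<in> H \<Longrightarrow> a < h x \<longleftrightarrow> a < x" "h \<in> H \<Longrightarrow> h x < b \<longleftrightarrow> x < b"
  using pl_homeo_less_iff[OF HD(2)] fix_ends by metis+

text \<open>The slopes at the two ends. As the ends are fixed by H, both are homomorphisms into the
  positive reals, and their common kernel is K.\<close>

definition q :: "(real \<Rightarrow> real) \<Rightarrow> real" where "q h = slope 1 h a"
definition r :: "(real \<Rightarrow> real) \<Rightarrow> real" where "r h = slope (- 1) h b"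

lemma q_comp: "f \<in> H \<Longrightarrow> g \<in> H \<Longrightarrow> q (f \<circ> g) = q f * q g"
  unfolding q_def by (subst slope_comp) (auto simp: HD)

lemma r_comp: "f \<in> H \<Longrightarrow> g \<in> H \<Longrightarrow> r (f \<circ> g) = r f * r g"
  unfolding r_def by (subst slope_comp) (auto simp: HD)

lemma q_finv: "f \<in> H \<Longrightarrow> q (finv f) = 1 / q f"
  unfolding q_def by (subst slope_finv) (auto simp: HD)

lemma r_finv: "f \<in> H \<Longrightarrow> r (finv f) = 1 / r f"
  unfolding r_def by (subst slope_finv) (auto simp: HD)

lemma q_pos: "f \<in> H \<Longrightarrow> 0 < q f" and r_pos: "f \<in> H \<Longrightarrow> 0 < r f"
  unfolding q_def r_def by (auto intro!: slope_pos simp: HD)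

lemma q_id [simp]: "q id = 1" and r_id [simp]: "r id = 1"
  unfolding q_def r_def by (auto intro!: slope_id)

text \<open>The bound b - a on e keeps a + e inside the orbital, where results on fixed points
  apply.\<close>

lemma q_germE:
  assumes "f \<in> H"
  obtains e where "e > 0" "e < b - a" "\<And>t. 0 \<le> t \<Longrightarrow> t \<le> e \<Longrightarrow> f (a + t) = a + q f * t"
proof -
  obtain e where e: "e > 0" "\<And>t. 0 \<le> t \<Longrightarrow> t \<le> e \<Longrightarrow> f (a + 1 * t) = a + 1 * (slope 1 f a * t)"
    using slope_fixedE[of f a 1] assms HD(2) by auto
  show thesis by (rule that[of "min e ((b - a) / 2)"]) (use e ab in \<open>auto simp: q_def min_less_iff_disj\<close>)
qed

lemma r_germE:
  assumes "f \<in> H"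
  obtains e where "e > 0" "e < b - a" "\<And>t. 0 \<le> t \<Longrightarrow> t \<le> e \<Longrightarrow> f (b - t) = b - r f * t"
proof -
  obtain e where e: "e > 0"
    "\<And>t. 0 \<le> t \<Longrightarrow> t \<le> e \<Longrightarrow> f (b + (- 1) * t) = b + (- 1) * (slope (- 1) f b * t)"
    using slope_fixedE[of f b "- 1"] assms HD(2) by auto
  show thesis by (rule that[of "min e ((b - a) / 2)"]) (use e ab in \<open>auto simp: r_def min_less_iff_disj\<close>)
qed

lemma unbounded_up: "a < c \<Longrightarrow> c < b \<Longrightarrow> d < b \<Longrightarrow> \<exists>h\<in>H. d < h c"
  using orbit_unbounded[OF H, of b a c d] nofix by auto

lemma unbounded_down:
  assumes "c < b" "a < d" "d < b"
  shows "\<exists>h\<in>H. h c < d"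
proof -
  obtain h where h: "h \<in> H" "c < h d" using unbounded_up[of d c] assms by auto
  then have "finv h c < d" using finv_less_iff(1)[OF HD(2)] by blast
  then show ?thesis using HD(3) h by blast
qed

section \<open>The kernel K of the end slopes and its fixed points\<close>

definition K :: "(real \<Rightarrow> real) set" where "K = {h \<in> H. q h = 1 \<and> r h = 1}"

lemma K_H: "k \<in> K \<Longrightarrow> k \<in> H"
  by (simp add: K_def)

lemma K: "subgroup K PLo_I"
  by (rule subgroup_PLoI)
     (auto simp: K_def HD H_id H_comp q_comp r_comp q_finv r_finv)

lemma K_conj: "k \<in> K \<Longrightarrow> f \<in> H \<Longrightarrow> f \<circ> k \<circ> finv f \<in> K"
  using q_pos[of f] r_pos[of f]
  by (auto simp: K_def H_comp HD q_comp r_comp q_finv r_finv)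

lemma K_commutator: "f \<in> H \<Longrightarrow> g \<in> H \<Longrightarrow> f \<circ> g \<circ> finv f \<circ> finv g \<in> K"
  using q_pos[of f] r_pos[of f] q_pos[of g] r_pos[of g]
  by (auto simp: K_def H_comp HD q_comp r_comp q_finv r_finv)

lemma K_compact:
  assumes k: "k \<in> K"
  shows "\<exists>c d. a < c \<and> c < d \<and> d < b \<and> (\<forall>x. x \<notin> {c..d} \<longrightarrow> k x = x)"
proof -
  have kH: "k \<in> H" and q1: "q k = 1" and r1: "r k = 1" using k by (auto simp: K_def)
  obtain e where e: "e > 0" "\<And>t. 0 \<le> t \<Longrightarrow> t \<le> e \<Longrightarrow> k (a + t) = a + q k * t"
    using q_germE[OF kH] by metis
  obtain e' where e': "e' > 0" "\<And>t. 0 \<le> t \<Longrightarrow> t \<le> e' \<Longrightarrow> k (b - t) = b - r k * t"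
    using r_germE[OF kH] by metis
  \<comment> \<open>Limiting both margins to a third of the length guarantees c < d.\<close>
  define c d where "c = a + min e ((b - a) / 3)" and "d = b - min e' ((b - a) / 3)"
  have "min e ((b - a) / 3) \<le> (b - a) / 3" "min e' ((b - a) / 3) \<le> (b - a) / 3"
    by (rule min.cobounded2)+
  moreover have "a + v < b - w" if "v \<le> (b - a) / 3" "w \<le> (b - a) / 3" for v w
  proof -
    have "3 * v \<le> b - a" "3 * w \<le> b - a" using that by simp_all
    then show ?thesis using ab by linarith
  qed
  ultimately have "c < d" unfolding c_def d_def by blast
  moreover have "a < c" "d < b" using e e' ab by (auto simp: c_def d_def)
  moreover have "k x = x" if x: "x \<notin> {c..d}" for x
  proof (cases "x \<in> {a<..<b}")
    case True
    then consider "x - a \<le> e" | "b - x \<le> e'" using x by (fastforce simp: c_def d_def)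
    then show ?thesis
      using e(2)[of "x - a"] e'(2)[of "b - x"] True q1 r1 by cases auto
  qed (use supp[OF kH] in blast)
  ultimately show ?thesis by blast
qed

lemma derived_K: "(derived PLo_I ^^ n) K = {id}"
proof -
  have "(derived PLo_I ^^ n) K \<subseteq> {id}"
    using group.mono_exp_of_derived[OF PLo_group, of K H n] solv by (auto simp: K_def)
  moreover have "id \<in> (derived PLo_I ^^ n) K"
    using subgroup_PLo_id[OF group.exp_of_derived_is_subgroup[OF PLo_group K]] .
  ultimately show ?thesis by blast
qed

definition F :: "real set" where "F = {p. a < p \<and> p < b \<and> (\<forall>k\<in>K. k p = p)}"

lemma F_nonempty: "\<exists>p. p \<in> F"
  using common_fixed_point[OF K derived_K ab K_compact] by (auto simp: F_def)

lemma F_ab: "p \<in> F \<Longrightarrow> a < p" "p \<in> F \<Longrightarrow> p < b"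
  by (auto simp: F_def)

lemma F_invariant:
  assumes f: "f \<in> H" and p: "p \<in> F"
  shows "f p \<in> F"
proof -
  have "k (f p) = f p" if k: "k \<in> K" for k
  proof -
    have "finv f \<circ> k \<circ> f \<in> K"
      using f q_pos[OF f] r_pos[OF f] k
      by (auto simp: K_def H_comp HD q_comp r_comp q_finv r_finv)
    then have "(finv f \<circ> k \<circ> f) p = p" using p by (auto simp: F_def)
    then have "f ((finv f \<circ> k \<circ> f) p) = f p" by simp
    then show ?thesis using HD(2)[OF f] by simp
  qed
  then show ?thesis using p f by (auto simp: F_def H_mem_iff)
qed

text \<open>The two products differ by an element of K, which fixes p. So H acts on F as an abelian
  group.\<close>

lemma F_commute:
  assumes f: "f \<in> H" and g: "g \<in> H" and p: "p \<in> F"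
  shows "f (g p) = g (f p)"
proof -
  have "finv (g \<circ> f) \<circ> (f \<circ> g) \<in> K"
    using f g q_pos[OF f] r_pos[OF f] q_pos[OF g] r_pos[OF g]
    by (auto simp: K_def H_comp HD q_comp r_comp q_finv r_finv)
  then have "(finv (g \<circ> f) \<circ> (f \<circ> g)) p = p" using p by (auto simp: F_def)
  then have "finv (g \<circ> f) (f (g p)) = p" by simp
  moreover have "(g \<circ> f) (finv (g \<circ> f) (f (g p))) = f (g p)"
    using pl_homeo_inv_apply(1)[OF HD(2)[OF H_comp[OF g f]]] .
  ultimately show ?thesis by simp
qed

text \<open>F is invariant under H, and H moves each of its points arbitrarily close to a.\<close>

lemma F_low:
  assumes "a < d" "d < b"
  shows "\<exists>p\<in>F. p < d"
proof -
  obtain p where p: "p \<in> F" using F_nonempty by blast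
  obtain h where "h \<in> H" "h p < d" using unbounded_down[of p d] F_ab[OF p] assms by auto
  then show ?thesis using F_invariant p by blast
qed

text \<open>By commutation on F, fixing p means fixing the whole orbit of p under H. That orbit
  comes arbitrarily close to both ends, where a slope other than 1 leaves no fixed points.\<close>

lemma no_fixed_point_F:
  assumes f: "f \<in> H" "q f \<noteq> 1 \<or> r f \<noteq> 1" and p: "p \<in> F"
  shows "f p \<noteq> p"
proof
  assume fp: "f p = p"
  have orb: "f (h p) = h p" if "h \<in> H" for h using F_commute[OF f(1) that p] fp by simp
  show False
    using f(2)
  proof
    assume q1: "q f \<noteq> 1"
    obtain e where e: "e > 0" "e < b - a" "\<And>t. 0 \<le> t \<Longrightarrow> t \<le> e \<Longrightarrow> f (a + t) = a + q f * t"
      using q_germE[OF f(1)] by metis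
    obtain h where h: "h \<in> H" "h p < a + e"
      using unbounded_down[of p "a + e"] F_ab[OF p] e by auto
    have "a < h p" using H_mem_iff(1)[OF h(1)] F_ab[OF p] by simp
    moreover define t where "t = h p - a"
    ultimately have t: "0 < t" "t < e" "h p = a + t" using h by auto
    then have "t = q f * t" using e(3)[of t] orb[OF h(1)] by simp
    then show False using t(1) q1 by simp
  next
    assume r1: "r f \<noteq> 1"
    obtain e where e: "e > 0" "e < b - a" "\<And>t. 0 \<le> t \<Longrightarrow> t \<le> e \<Longrightarrow> f (b - t) = b - r f * t"
      using r_germE[OF f(1)] by metis
    obtain h where h: "h \<in> H" "b - e < h p"
      using unbounded_up[of p "b - e"] F_ab[OF p] e by auto
    have "h p < b" using H_mem_iff(2)[OF h(1)] F_ab[OF p] by simp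
    moreover define t where "t = b - h p"
    ultimately have t: "0 < t" "t < e" "h p = b - t" using h by auto
    then have "t = r f * t" using e(3)[of t] orb[OF h(1)] by simp
    then show False using t(1) r1 by simp
  qed
qed

text \<open>A fixed point c outside F is replaced by the supremum of the part of F below it. This
  supremum is fixed by K, hence lies in F, and it is fixed by f because f preserves F and fixes
  c.\<close>

lemma no_fixed_point:
  assumes f: "f \<in> H" "q f \<noteq> 1 \<or> r f \<noteq> 1" and c: "a < c" "c < b"
  shows "f c \<noteq> c"
proof
  assume fc: "f c = c"
  define X where "X = {x \<in> F. x \<le> c}"
  obtain p where p: "p \<in> F" "p < c" using F_low[OF c] by blast
  then have pX: "p \<in> X" by (simp add: X_def)
  have bdd: "bdd_above X" by (auto simp: X_def intro!: bdd_aboveI[of _ c])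
  have "p \<le> Sup X" using cSup_upper[OF pX bdd] .
  moreover have "Sup X \<le> c" by (rule cSup_least) (use pX in \<open>auto simp: X_def\<close>)
  moreover have "k (Sup X) = Sup X" if k: "k \<in> K" for k
  proof (rule Sup_invariant_fixed[OF HD(2)[OF K_H[OF k]] _ bdd])
    fix x assume x: "x \<in> X"
    then have "k x = x" using k by (auto simp: X_def F_def)
    then show "k x \<in> X \<and> finv k x \<in> X"
      using x finv_fixed[OF HD(2)[OF K_H[OF k]], of x] by simp
  qed (use pX in blast)
  ultimately have "Sup X \<in> F" using F_ab[OF p(1)] c by (auto simp: F_def)
  moreover have "f (Sup X) = Sup X"
  proof (rule Sup_invariant_fixed[OF HD(2)[OF f(1)] _ bdd])
    fix x assume "x \<in> X"
    then have x: "x \<in> F" "x \<le> c" by (auto simp: X_def)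
    have "f x \<le> c" using x(2) fc pl_homeo_le_iff[OF HD(2)[OF f(1)], of x c] by simp
    moreover have "finv f x \<le> c"
      using x(2) fc finv_less_iff(2)[OF HD(2)[OF f(1)], of c x] by (auto simp: not_less[symmetric])
    ultimately show "f x \<in> X \<and> finv f x \<in> X"
      using F_invariant f(1) HD(3) x by (auto simp: X_def)
  qed (use pX in blast)
  ultimately show False using no_fixed_point_F f by blast
qed

text \<open>Slope 1 at a gives fixed points near a, and elements outside K have none. So q by itself
  has kernel K.\<close>

lemma q_eq_1_imp_K:
  assumes f: "f \<in> H" "q f = 1"
  shows "f \<in> K"
proof (rule ccontr)
  assume "f \<notin> K"
  then have r: "r f \<noteq> 1" using f by (simp add: K_def)
  obtain e where e: "e > 0" "e < b - a" "\<And>t. 0 \<le> t \<Longrightarrow> t \<le> e \<Longrightarrow> f (a + t) = a + q f * t"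
    using q_germE[OF f(1)] by metis
  have "f (a + e) = a + e" using e f by simp
  then show False using no_fixed_point[OF f(1), of "a + e"] r e by auto
qed

text \<open>Close to a the slope forces upward motion; a point moved the other way would give a
  fixed point in between by the intermediate value theorem.\<close>

lemma moves_up:
  assumes f: "f \<in> H" "1 < q f" and x: "a < x" "x < b"
  shows "x < f x"
proof (rule ccontr)
  assume "\<not> x < f x"
  obtain e where e: "e > 0" "e < b - a" "\<And>t. 0 \<le> t \<Longrightarrow> t \<le> e \<Longrightarrow> f (a + t) = a + q f * t"
    using q_germE[OF f(1)] by metis
  define t where "t = min e ((x - a) / 2)"
  have t: "0 < t" "t \<le> e" "a + t < x" using e x by (auto simp: t_def min_def field_simps)
  have "a + t < f (a + t)" using e(3)[of t] t f(2) by simp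
  moreover have "continuous_on {a + t..x} (\<lambda>y. f y - y)"
    using pl_homeo_continuous[OF HD(2)[OF f(1)]]
    by (intro continuous_intros) (blast intro: continuous_on_subset)
  ultimately have "\<exists>y\<ge>a + t. y \<le> x \<and> f y - y = 0"
    using \<open>\<not> x < f x\<close> t by (intro IVT2') auto
  then obtain y where y: "a + t \<le> y" "y \<le> x" "f y = y" by auto
  then have "a < y" "y < b" using x t by auto
  then show False using y(3) no_fixed_point[OF f(1), of y] f(2) by auto
qed

lemma r_less_1:
  assumes f: "f \<in> H" "1 < q f"
  shows "r f < 1"
proof -
  obtain e where e: "e > 0" "e < b - a" "\<And>t. 0 \<le> t \<Longrightarrow> t \<le> e \<Longrightarrow> f (b - t) = b - r f * t"
    using r_germE[OF f(1)] by metis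
  have "b - e < f (b - e)" using moves_up[OF f, of "b - e"] e by simp
  then show ?thesis using e(3)[of e] e(1) by simp
qed

lemma exists_q_gt_1: "\<exists>g\<in>H. 1 < q g"
proof -
  obtain p where p: "p \<in> F" using F_nonempty by blast
  obtain h where h: "h \<in> H" "h p \<noteq> p" using nofix F_ab[OF p] by blast
  then have "q h \<noteq> 1" using q_eq_1_imp_K[OF h(1)] p by (auto simp: F_def)
  then have "1 < q h \<or> 1 < q (finv h)" using q_pos[OF h(1)] by (auto simp: q_finv[OF h(1)])
  then show ?thesis using h HD(3) by blast
qed

section \<open>Powers of an expanding element and discreteness of the slopes\<close>

context
  fixes g assumes g: "g \<in> H" and qg: "1 < q g"
begin

lemma g_less: "a < x \<Longrightarrow> x < b \<Longrightarrow> x < g x"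
  using moves_up[OF g qg] .

lemma g_PLo: "g \<in> PLo_set"
  using HD(1)[OF g] .

lemma ipow_up:
  assumes x: "a < x" "x < b" and d: "d < b"
  shows "\<exists>m. d < ipow g m x"
proof (rule ccontr)
  assume "\<not> ?thesis"
  then have le: "ipow g m x \<le> d" for m by (simp add: not_less)
  define X where "X = range (\<lambda>m. ipow g m x)"
  have xX: "x \<in> X" unfolding X_def using rangeI[of "\<lambda>m. ipow g m x" 0] by simp
  have bdd: "bdd_above X" using le by (auto simp: X_def intro!: bdd_aboveI[of _ d])
  have fin: "finv g = ipow g (- 1)" using ipow_neg[OF g_PLo, of 1] by (simp add: ipow_1[OF g_PLo])
  have "g (Sup X) = Sup X"
  proof (rule Sup_invariant_fixed[OF HD(2)[OF g] _ bdd])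
    fix y assume "y \<in> X"
    then obtain m where m: "y = ipow g m x" by (auto simp: X_def)
    have "g y = ipow g (1 + m) x" using m by (simp add: ipow_add[OF g_PLo] ipow_1[OF g_PLo])
    moreover have "finv g y = ipow g (- 1 + m) x" using m fin by (simp add: ipow_add_apply[OF g_PLo])
    ultimately show "g y \<in> X \<and> finv g y \<in> X" by (auto simp: X_def)
  qed (use xX in blast)
  moreover have "x \<le> Sup X" by (rule cSup_upper[OF xX bdd])
  moreover have "Sup X \<le> d" by (rule cSup_least) (use xX le in \<open>auto simp: X_def\<close>)
  ultimately show False using no_fixed_point[OF g, of "Sup X"] qg x d by auto
qed

lemma ipow_down:
  assumes x: "a < x" "x < b" and d: "a < d" "d < b"
  shows "\<exists>m. ipow g m x < d"
proof -
  obtain m where "x < ipow g m d" using ipow_up[OF d x(2)] by blast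
  then have "finv (ipow g m) x < d" using finv_less_iff(1)[OF PLo_setD(1)[OF ipow_PLo[OF g_PLo]]] by blast
  then show ?thesis using ipow_neg[OF g_PLo] by metis
qed

lemma ipow_mono:
  assumes p: "a < p" "p < b" and ij: "i \<le> j"
  shows "ipow g i p \<le> ipow g j p"
proof (cases "i = j")
  case False
  then have "i < j" using ij by simp
  then show ?thesis
    using ipow_chain[OF g_PLo g_less[OF p], of i j] ipow_less[OF g_PLo g_less[OF p], of i] by simp
qed simp

text \<open>The inverse of g contracts towards a, so its iterates never leave the range where g is
  linear.\<close>

lemma finv_iterate:
  assumes e: "\<And>t. 0 \<le> t \<Longrightarrow> t \<le> e \<Longrightarrow> g (a + t) = a + q g * t" and t: "0 \<le> t" "t \<le> e"
  shows "(finv g ^^ m) (a + t) = a + t / q g ^ m"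
proof (induction m)
  case (Suc m)
  have "1 * 1 \<le> q g ^ Suc m" using qg one_le_power[of "q g" "Suc m"] by simp
  then have "t / q g ^ Suc m \<le> t / 1" using t by (intro divide_left_mono) auto
  then have "g (a + t / q g ^ Suc m) = a + q g * (t / q g ^ Suc m)"
    using t qg by (intro e) auto
  also have "\<dots> = a + t / q g ^ m" using qg by simp
  finally have "finv g (a + t / q g ^ m) = a + t / q g ^ Suc m"
    using pl_homeo_inv_apply(2)[OF HD(2)[OF g]] by metis
  then show ?case using Suc by simp
qed simp

lemma finv_funpow_H: "finv g ^^ m \<in> H" and funpow_H: "g ^^ m \<in> H"
  by (induction m) (use H_id H_comp HD(3) g in auto)

text \<open>Elements act affinely on the part of F near an endpoint, with a bound independent of the element:
  conjugation by powers of g, which commute with everything on F, magnifies germs at that endpoint.\<close>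

lemma affine_near_a:
  "\<exists>e>0. e < b - a \<and> (\<forall>p\<in>F. \<forall>h\<in>H. p \<le> a + e \<and> q h * (p - a) \<le> e \<longrightarrow> h p = a + q h * (p - a))"
proof -
  obtain e where e: "e > 0" "e < b - a" "\<And>t. 0 \<le> t \<Longrightarrow> t \<le> e \<Longrightarrow> g (a + t) = a + q g * t"
    using q_germE[OF g] by metis
  have main: "h p = a + q h * (p - a)"
    if p: "p \<in> F" "p \<le> a + e" and h: "h \<in> H" "q h * (p - a) \<le> e" for p h
  proof -
    obtain e' where e': "e' > 0" "\<And>t. 0 \<le> t \<Longrightarrow> t \<le> e' \<Longrightarrow> h (a + t) = a + q h * t"
      using q_germE[OF h(1)] by metis
    define u where "u = p - a"
    have u: "0 < u" "u \<le> e" "p = a + u" using p F_ab[OF p(1)] by (auto simp: u_def)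
    have qu: "q h * u \<le> e" using h(2) by (simp add: u_def)
    \<comment> \<open>Here e' depends on h, whereas e comes from g alone. Enough inverse iterates of
      g bring p into the range e' of h.\<close>
    obtain m where "u / e' < q g ^ m" using real_arch_pow[OF qg] by blast
    then have m: "u / q g ^ m \<le> e'" using e'(1) qg by (simp add: field_simps)
    have "(finv g ^^ m) (h p) = h ((finv g ^^ m) p)"
      by (rule F_commute[OF finv_funpow_H h(1) p(1)])
    also have "(finv g ^^ m) p = a + u / q g ^ m"
      unfolding u(3) by (rule finv_iterate[OF e(3)]) (use u in auto)
    also have "h (a + u / q g ^ m) = a + q h * u / q g ^ m" using e'(2)[of "u / q g ^ m"] m u qg by simp
    \<comment> \<open>Undoing the contraction at the image point requires it to lie in the linear
      range of g; this is the reason for the condition on \<open>q h * (p - a)\<close>.\<close>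
    also have "\<dots> = (finv g ^^ m) (a + q h * u)"
      by (rule finv_iterate[OF e(3), symmetric]) (use u(1) q_pos[OF h(1)] qu in auto)
    finally have "h p = a + q h * u"
      by (rule pl_homeo_eq_iff[OF HD(2)[OF finv_funpow_H], THEN iffD1])
    then show ?thesis by (simp add: u_def)
  qed
  show ?thesis
  proof (intro exI[of _ e] conjI ballI impI, rule e(1), rule e(2))
    fix p h assume "p \<in> F" "h \<in> H" and "p \<le> a + e \<and> q h * (p - a) \<le> e"
    then show "h p = a + q h * (p - a)" using main[of p h] by blast
  qed
qed

lemma g_iterate:
  assumes e: "\<And>t. 0 \<le> t \<Longrightarrow> t \<le> e \<Longrightarrow> g (b - t) = b - r g * t" and t: "0 \<le> t" "t \<le> e"
  shows "(g ^^ m) (b - t) = b - r g ^ m * t"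
proof (induction m)
  case (Suc m)
  have "r g ^ m \<le> 1" using r_less_1[OF g qg] r_pos[OF g] by (simp add: power_le_one)
  then have "r g ^ m * t \<le> 1 * t" using t by (intro mult_right_mono)
  then have "g (b - r g ^ m * t) = b - r g * (r g ^ m * t)"
    using t r_pos[OF g] by (intro e) auto
  then show ?case using Suc by (simp add: mult.assoc)
qed simp

text \<open>At b the positive powers of g contract, since \<open>r g\<close> is below 1. The range
  condition is put on \<open>h p\<close> itself: when \<open>q h\<close> exceeds 1 it passes from p
  to \<open>h p\<close>, because h moves points up.\<close>

lemma affine_near_b:
  "\<exists>e>0. e < b - a \<and> (\<forall>p\<in>F. \<forall>h\<in>H. b - e \<le> p \<and> b - e \<le> h p \<longrightarrow> b - h p = r h * (b - p))"
proof -
  obtain e where e: "e > 0" "e < b - a" "\<And>t. 0 \<le> t \<Longrightarrow> t \<le> e \<Longrightarrow> g (b - t) = b - r g * t"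
    using r_germE[OF g] by metis
  have main: "b - h p = r h * (b - p)"
    if p: "p \<in> F" "b - e \<le> p" and h: "h \<in> H" "b - e \<le> h p" for p h
  proof -
    obtain e' where e': "e' > 0" "\<And>t. 0 \<le> t \<Longrightarrow> t \<le> e' \<Longrightarrow> h (b - t) = b - r h * t"
      using r_germE[OF h(1)] by metis
    define u w where "u = b - p" and "w = b - h p"
    have u: "0 < u" "u \<le> e" "p = b - u" using p F_ab[OF p(1)] by (auto simp: u_def)
    have w: "0 \<le> w" "w \<le> e" "h p = b - w"
      using h F_ab[OF F_invariant[OF h(1) p(1)]] by (auto simp: w_def)
    obtain m where "r g ^ m < e' / u" using real_arch_pow_inv[OF _ r_less_1[OF g qg], of "e' / u"] e' u by auto
    then have m: "r g ^ m * u \<le> e'" using u by (simp add: field_simps)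
    have "b - r g ^ m * w = (g ^^ m) (h p)" using g_iterate[OF e(3)] w by simp
    also have "\<dots> = h ((g ^^ m) p)"
      by (rule F_commute[OF funpow_H h(1) p(1)])
    also have "\<dots> = h (b - r g ^ m * u)" using g_iterate[OF e(3)] u by simp
    also have "\<dots> = b - r h * (r g ^ m * u)" using e'(2)[of "r g ^ m * u"] m u r_pos[OF g] by simp
    finally have "r g ^ m * w = r h * (r g ^ m * u)" by simp
    also have "\<dots> = r g ^ m * (r h * u)" by (rule mult.left_commute)
    finally have eq: "r g ^ m * w = r g ^ m * (r h * u)" .
    have "r g ^ m \<noteq> 0" using r_pos[OF g] by simp
    then have "w = r h * u" using eq mult_left_cancel[of "r g ^ m" w "r h * u"] by blast
    then show ?thesis by (simp add: u_def w_def)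
  qed
  show ?thesis
  proof (intro exI[of _ e] conjI ballI impI, rule e(1), rule e(2))
    fix p h assume "p \<in> F" "h \<in> H" and "b - e \<le> p \<and> b - e \<le> h p"
    then show "b - h p = r h * (b - p)" using main[of p h] by blast
  qed
qed

text \<open>Three points p, h p, h (h p) near a, lying in one affine piece of a power G of g that maps them
  near b, give geometric progressions of distances to a and to b. An affine map matches these only if
  the ratios agree, which the inequalities 1 < q h and r h < 1 forbid.\<close>

lemma q_discrete: "\<exists>\<delta>>1. \<forall>h\<in>H. 1 < q h \<longrightarrow> \<delta> \<le> q h"
proof -
  obtain ea where ea: "ea > 0" "ea < b - a"
    "\<And>p h. p \<in> F \<Longrightarrow> h \<in> H \<Longrightarrow> p \<le> a + ea \<Longrightarrow> q h * (p - a) \<le> ea \<Longrightarrow> h p = a + q h * (p - a)"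
    using affine_near_a by blast
  obtain eb where eb: "eb > 0" "eb < b - a"
    "\<And>p h. p \<in> F \<Longrightarrow> h \<in> H \<Longrightarrow> b - eb \<le> p \<Longrightarrow> b - eb \<le> h p \<Longrightarrow> b - h p = r h * (b - p)"
    using affine_near_b by blast
  obtain p where p: "p \<in> F" "p < a + ea" using F_low[of "a + ea"] ea by auto
  obtain m where m: "b - eb < ipow g m p"
    using ipow_up[of p "b - eb"] F_ab[OF p(1)] eb by auto
  define G where "G = ipow g m"
  have G: "G \<in> H" unfolding G_def by (rule H_ipow[OF g])
  define \<beta> where "\<beta> = slope 1 G p"
  have \<beta>: "\<beta> > 0" unfolding \<beta>_def by (rule slope_pos) (use HD(2)[OF G] in auto)
  have "germ 1 G p \<beta>" unfolding \<beta>_def by (rule slope_germ) (use HD(2)[OF G] in auto)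
  then obtain e1 where e1: "e1 > 0" "\<And>t. 0 \<le> t \<Longrightarrow> t \<le> e1 \<Longrightarrow> G (p + t) = G p + \<beta> * t"
    unfolding germ_def by auto
  define u where "u = p - a"
  have u: "0 < u" "u < ea" "p = a + u" using p F_ab[OF p(1)] by (auto simp: u_def)
  \<comment> \<open>M bounds the growth factor of the distance u to a. Its first term keeps the
    points in the affine range at a, its second in the affine piece of G to the right of p.\<close>
  define M where "M = 1 + min ((ea - u) / u) (e1 / u)"
  have M: "1 < M" "M * u \<le> ea" "M * u - u \<le> e1"
  proof -
    show "1 < M" using u e1 by (auto simp: M_def)
    have "M \<le> 1 + (ea - u) / u" "M \<le> 1 + e1 / u" by (auto simp: M_def)
    then have "M * u \<le> (1 + (ea - u) / u) * u" "M * u \<le> (1 + e1 / u) * u"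
      using u by (auto intro!: mult_right_mono)
    moreover have "(1 + (ea - u) / u) * u = ea" "(1 + e1 / u) * u = u + e1"
      using u by (simp_all add: distrib_right)
    ultimately show "M * u \<le> ea" "M * u - u \<le> e1" by linarith+
  qed
  have "sqrt M \<le> q h" if h: "h \<in> H" "1 < q h" for h
  proof (rule ccontr)
    define s where "s = q h"
    assume "\<not> sqrt M \<le> q h"
    then have "s < sqrt M" by (simp add: s_def)
    \<comment> \<open>Two applications of h multiply the distance by s * s, so the threshold for s
      is the square root of M.\<close>
    then have "s * s < sqrt M * sqrt M" using h M(1) by (intro mult_strict_mono) (auto simp: s_def)
    then have s: "1 < s" "s * s < M" using h M by (auto simp: s_def)
    have "s * 1 < s * s" using s by (intro mult_strict_left_mono) auto
    then have "s * u < s * s * u" "s * s * u < M * u"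
      using u s by (auto intro!: mult_strict_right_mono)
    then have su: "s * u \<le> ea" "s * s * u \<le> ea" "s * u - u \<le> e1" "s * s * u - u \<le> e1"
      using M by auto
    have "u < s * u" using u s by simp
    have p1: "h p = a + s * u"
      using ea(3)[OF p(1) h(1)] u su by (simp add: s_def)
    have p1F: "h p \<in> F" by (rule F_invariant[OF h(1) p(1)])
    have p2: "h (h p) = a + s * s * u"
      using ea(3)[OF p1F h(1)] p1 su by (simp add: s_def mult.assoc)
    define y where "y = b - G p"
    have GF: "G p \<in> F" "h (G p) \<in> F" using F_invariant G h p by auto
    have y: "0 < y" "b - eb < G p" using F_ab[OF GF(1)] m by (auto simp: y_def G_def)
    have up: "G p < h (G p)" "h (G p) < h (h (G p))"
      using moves_up[OF h] F_ab[OF GF(1)] F_ab[OF GF(2)] by auto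
    have "G (h p) = h (G p)" by (rule F_commute[OF G h(1) p(1)])
    moreover have "G (h (h p)) = h (h (G p))"
      using F_commute[OF G h(1) p1F] calculation by simp
    moreover have "b - h (G p) = r h * y"
      using eb(3)[OF GF(1) h(1)] y up by (simp add: y_def)
    moreover have "b - h (h (G p)) = r h * (r h * y)"
      using eb(3)[OF GF(2) h(1)] y up calculation(3) by simp
    moreover have "G (h p) = G p + \<beta> * (s * u - u)"
      using e1(2)[of "s * u - u"] su(3) \<open>u < s * u\<close> p1 u(3) by (simp add: algebra_simps)
    moreover have "G (h (h p)) = G p + \<beta> * (s * s * u - u)"
      using e1(2)[of "s * s * u - u"] su(4) \<open>u < s * u\<close> \<open>s * u < s * s * u\<close> p2 u(3)
      by (simp add: algebra_simps)
    ultimately have 1: "(1 - r h) * y = \<beta> * u * (s - 1)"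
      and 2: "(1 - r h * r h) * y = \<beta> * u * (s * s - 1)"
      by (simp_all add: y_def algebra_simps)
    \<comment> \<open>The quotient of equations 2 and 1, kept in multiplied form, reads 1 + r h = 1
      + s.\<close>
    have "(1 + r h) * (\<beta> * u * (s - 1)) = (1 + r h) * ((1 - r h) * y)" using 1 by simp
    also have "\<dots> = (1 + s) * (\<beta> * u * (s - 1))" using 2 by (simp add: algebra_simps)
    finally have "r h = s" using \<beta> u s by simp
    then show False using r_less_1[OF h] s by simp
  qed
  then show ?thesis using M(1) by (intro exI[of _ "sqrt M"]) auto
qed

lemma q_ipow: "q (ipow g k) = q g powr (of_int k)"
proof -
  have q0: "0 < q g" using qg by simp
  have add: "q (ipow g (i + j)) = q (ipow g i) * q (ipow g j)" for i j
    using q_comp[OF H_ipow[OF g] H_ipow[OF g]] by (simp add: ipow_add[OF g_PLo])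
  show ?thesis
  proof (induction k rule: int_induct[where k=0])
    case base
    show ?case using q0 q_id by (simp only: ipow_0) simp
  next
    case (step1 i)
    then show ?case using add[of i 1] q0 by (simp add: ipow_1[OF g_PLo] powr_add)
  next
    case (step2 i)
    then show ?case using add[of "i - 1" 1] q0 by (simp add: ipow_1[OF g_PLo] powr_diff field_simps)
  qed
qed

end

text \<open>A multiplicative group of positive reals with a gap above 1 is cyclic. The least value
  above 1 is attained: two values of Q within a factor \<open>\<delta>\<close> of the infimum have a
  quotient below \<open>\<delta>\<close>, so they agree.\<close>

lemma generator_exists: "\<exists>g\<in>H. 1 < q g \<and> (\<forall>h\<in>H. \<exists>k::int. q h = q g powr k)"
proof -
  obtain g0 where g0: "g0 \<in> H" "1 < q g0" using exists_q_gt_1 by blast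
  obtain \<delta> where \<delta>: "\<delta> > 1" "\<And>h. h \<in> H \<Longrightarrow> 1 < q h \<Longrightarrow> \<delta> \<le> q h" using q_discrete[OF g0] by blast
  define Q where "Q = {q h | h. h \<in> H \<and> 1 < q h}"
  have ne: "Q \<noteq> {}" using g0 by (auto simp: Q_def)
  have bdd: "bdd_below Q" using \<delta>(2) by (auto simp: Q_def intro!: bdd_belowI[of _ \<delta>])
  have "\<delta> \<le> Inf Q" using ne \<delta>(2) by (intro cInf_greatest) (auto simp: Q_def)
  then have "Inf Q < Inf Q * \<delta>" using \<delta>(1) by simp
  then obtain z where "z \<in> Q" "z < Inf Q * \<delta>" using cInf_lessD[OF ne] by blast
  then obtain g where g: "g \<in> H" "1 < q g" "q g < Inf Q * \<delta>" by (auto simp: Q_def)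
  have min: "q g \<le> q h" if h: "h \<in> H" "1 < q h" for h
  proof (rule ccontr)
    assume "\<not> q g \<le> q h"
    then have lt: "q h < q g" by simp
    have "Inf Q \<le> q h" using h bdd by (intro cInf_lower) (auto simp: Q_def)
    then have "Inf Q * \<delta> \<le> q h * \<delta>" using \<delta>(1) by simp
    then have "q g / q h < \<delta>" using g(3) h(2) by (simp add: field_simps)
    moreover have "q (g \<circ> finv h) = q g / q h"
      using q_comp[OF g(1) HD(3)[OF h(1)]] q_finv[OF h(1)] by simp
    moreover have "1 < q g / q h" using lt h by simp
    ultimately show False using \<delta>(2)[OF H_comp[OF g(1) HD(3)[OF h(1)]]] by simp
  qed
  have "\<exists>k::int. q h = q g powr k" if h: "h \<in> H" for h
  proof -
    \<comment> \<open>Division with remainder: the power of g leaves a slope in [1, q g), and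
      minimality makes it 1.\<close>
    define k where "k = \<lfloor>log (q g) (q h)\<rfloor>"
    have "of_int k \<le> log (q g) (q h)" "log (q g) (q h) < of_int k + 1" by (auto simp: k_def)
    then have k: "q g powr k \<le> q h" "q h < q g powr (k + 1)"
      using g(2) q_pos[OF h] by (auto simp: le_log_iff log_less_iff)
    let ?f = "h \<circ> ipow g (- k)"
    have f: "?f \<in> H" by (rule H_comp[OF h H_ipow[OF g(1)]])
    have qf: "q ?f = q h / q g powr k"
      using q_comp[OF h H_ipow[OF g(1)]] q_ipow[OF g(1,2)] g(2) by (simp add: powr_minus divide_inverse)
    have "1 \<le> q ?f" "q ?f < q g" using k g(2) unfolding qf by (auto simp: field_simps powr_add)
    then have "q ?f = 1" using min[OF f] by fastforce
    then have "q h = q g powr k" unfolding qf using g(2) by simp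
    then show ?thesis by blast
  qed
  then show ?thesis using g by blast
qed

end

subsection \<open>Decomposition into orbitals\<close>

lemma restr_comp:
  assumes g: "pl_homeo g" "g c = c" "g d = d"
  shows "restr c d (f \<circ> g) = restr c d f \<circ> restr c d g"
proof
  fix x
  have "c < g x \<longleftrightarrow> c < x" "g x < d \<longleftrightarrow> x < d"
    using pl_homeo_less_iff[OF g(1), of c x] pl_homeo_less_iff[OF g(1), of x d] g by auto
  then show "restr c d (f \<circ> g) x = (restr c d f \<circ> restr c d g) x"
    by (auto simp: restr_def)
qed

lemma restr_id [simp]: "restr c d id = id"
  by (auto simp: restr_def fun_eq_iff)

lemma restr_group_hom:
  assumes H: "subgroup H PLo_I" and fixed: "\<And>h. h \<in> H \<Longrightarrow> h c = c \<and> h d = d"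
  shows "group_hom (PLo_I\<lparr>carrier := H\<rparr>) PLo_I (restr c d)"
proof -
  have "restr c d \<in> hom (PLo_I\<lparr>carrier := H\<rparr>) PLo_I"
    by (rule homI) (use fixed subgroup_PLoD[OF H] in \<open>auto simp: restr_PLo restr_comp\<close>)
  then show ?thesis
    using group.subgroup_imp_group[OF PLo_group H] PLo_group
    by (simp add: group_hom_def group_hom_axioms_def)
qed

lemma subgroup_restr:
  assumes "subgroup H PLo_I" and "\<And>h. h \<in> H \<Longrightarrow> h c = c \<and> h d = d"
  shows "subgroup (restr c d ` H) PLo_I"
  using group_hom.img_is_subgroup[OF restr_group_hom[OF assms]] by simp

lemma derived_restr:
  assumes H: "subgroup H PLo_I" and fixed: "\<And>h. h \<in> H \<Longrightarrow> h c = c \<and> h d = d" and X: "X \<subseteq> H"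
  shows "(derived PLo_I ^^ n) (restr c d ` X) = restr c d ` ((derived PLo_I ^^ n) X)"
  using group_hom.exp_of_derived_img[OF restr_group_hom[OF H fixed], of X n]
    derived_exp_consistent[OF PLo_group H X, of n] X by simp

text \<open>Every h is uniquely a product of an element \<open>\<kappa> h\<close> of K and the power
  \<open>\<phi> h\<close> of g. The hypothesis \<open>IH\<close> covers all subgroups, since the
  restriction of K to (p, g p) may have many orbitals.\<close>

lemma (in one_orbital) in_R_step:
  assumes n: "n = Suc m"
    and IH: "\<And>L. subgroup L PLo_I \<Longrightarrow> (derived PLo_I ^^ m) L = {id} \<Longrightarrow> in_R (PLo_I\<lparr>carrier := L\<rparr>)"
  shows "in_R (PLo_I\<lparr>carrier := H\<rparr>)"
proof -
  obtain g where g: "g \<in> H" "1 < q g" and gen: "\<And>h. h \<in> H \<Longrightarrow> \<exists>k::int. q h = q g powr k"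
    using generator_exists by blast
  note gP = HD(1)[OF g(1)]
  define \<phi> :: "(real \<Rightarrow> real) \<Rightarrow> int" where "\<phi> h = (THE k. q h = q g powr k)" for h
  have \<phi>_eq: "\<phi> h = k" if "q h = q g powr of_int k" for h k
    unfolding \<phi>_def by (rule the_equality) (use that g(2) powr_inj in auto)
  have \<phi>: "q h = q g powr \<phi> h" if "h \<in> H" for h using gen[OF that] \<phi>_eq by metis
  have \<phi>_comp: "\<phi> (f \<circ> h) = \<phi> f + \<phi> h" if "f \<in> H" "h \<in> H" for f h
    by (rule \<phi>_eq) (simp add: q_comp[OF that] \<phi>[OF that(1)] \<phi>[OF that(2)] powr_add)
  define \<kappa> where "\<kappa> h = h \<circ> ipow g (- \<phi> h)" for h
  have \<kappa>: "\<kappa> h \<in> K" if h: "h \<in> H" for h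
  proof (rule q_eq_1_imp_K)
    show "\<kappa> h \<in> H" unfolding \<kappa>_def using h g by (intro H_comp H_ipow)
    show "q (\<kappa> h) = 1"
      using g by (simp add: \<kappa>_def q_comp[OF h H_ipow] q_ipow \<phi>[OF h] flip: powr_add)
  qed
  obtain p where p: "p \<in> F" using F_nonempty by blast
  have pg: "p < g p" using g_less[OF g] F_ab[OF p] by simp
  define \<rho> where "\<rho> = restr p (g p)"
  have orbF: "ipow g i p \<in> F" for i by (rule F_invariant[OF H_ipow[OF g(1)] p])
  have K_fix: "k p = p \<and> k (g p) = g p" if "k \<in> K" for k
    using p F_invariant[OF g(1) p] that by (auto simp: F_def)
  have gp_step: "ipow g (i + 1) p = ipow g i (g p)" for i
    by (simp add: ipow_add[OF gP] ipow_1[OF gP])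
  have ipow_less_iff: "ipow g i x < ipow g i y \<longleftrightarrow> x < y" for i x y
    by (rule pl_homeo_less_iff[OF PLo_setD(1)[OF ipow_PLo[OF gP]]])
  define A where "A = PLo_I\<lparr>carrier := \<rho> ` K\<rparr>"
  have sub: "subgroup (\<rho> ` K) PLo_I" unfolding \<rho>_def by (rule subgroup_restr[OF K K_fix])
  have gA: "group A" unfolding A_def by (rule group.subgroup_imp_group[OF PLo_group sub])
  have A_simps: "\<And>x y. x \<otimes>\<^bsub>A\<^esub> y = x \<circ> y" "\<one>\<^bsub>A\<^esub> = id" "carrier A = \<rho> ` K" by (simp_all add: A_def)
  have \<rho>_comp: "\<rho> (k \<circ> k') = \<rho> k \<circ> \<rho> k'" if "k' \<in> K" for k k'
    unfolding \<rho>_def using K_fix[OF that] HD(2)[OF K_H[OF that]] by (simp add: restr_comp)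
  have "in_R A"
    unfolding A_def
  proof (rule IH[OF sub])
    have dK: "derived PLo_I H \<subseteq> K"
    proof (rule ord_eq_le_trans[OF derived_def], rule group.generate_subgroup_incl[OF PLo_group _ K])
      show "derived_set PLo_I H \<subseteq> K"
        using K_commutator HD(1) by (auto simp: PLo_inv)
    qed
    have "\<rho> ` K \<subseteq> \<rho> ` derived PLo_I H"
    proof clarify
      fix k assume k: "k \<in> K"
      obtain c d where cd: "a < c" "c < d" "d < b" "\<And>x. x \<notin> {c..d} \<Longrightarrow> k x = x"
        using K_compact[OF k] by blast
      \<comment> \<open>The power j of g moves (p, g p) below the support of k. There the inverse of
        k does nothing, so on (p, g p) the conjugated factor of the commutator is the identity and
        only k remains.\<close>
      obtain j where j: "ipow g j (g p) < c"
        using ipow_down[OF g, of "g p" c] F_ab[OF F_invariant[OF g(1) p]] cd by auto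
      define w where "w = ipow g (- j)"
      have w: "w \<in> H" unfolding w_def by (rule H_ipow[OF g(1)])
      have finvw: "finv w = ipow g j" using ipow_neg[OF gP, of "- j"] by (simp add: w_def)
      have "\<rho> k = \<rho> (k \<circ> w \<circ> finv k \<circ> finv w)"
      proof
        fix x show "\<rho> k x = \<rho> (k \<circ> w \<circ> finv k \<circ> finv w) x"
        proof (cases "p < x \<and> x < g p")
          case True
          then have "finv w x < c"
            using j ipow_less_iff[of j x "g p"] finvw by simp
          then have "k (finv w x) = finv w x" using cd(4) by simp
          then have "finv k (finv w x) = finv w x" using finv_fixed HD(2)[OF K_H[OF k]] by blast
          then show ?thesis using True HD(2)[OF w] by (simp add: \<rho>_def restr_def)
        qed (auto simp: \<rho>_def restr_def)
      qed
      then show "\<rho> k \<in> \<rho> ` derived PLo_I H"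
        using commutator_in_derived[OF H K_H[OF k] w] by blast
    qed
    then have "(derived PLo_I ^^ m) (\<rho> ` K) \<subseteq> (derived PLo_I ^^ m) (\<rho> ` derived PLo_I H)"
      by (rule group.mono_exp_of_derived[OF PLo_group])
    also have "\<dots> = \<rho> ` ((derived PLo_I ^^ m) (derived PLo_I H))"
      unfolding \<rho>_def by (rule derived_restr[OF K K_fix dK])
    also have "(derived PLo_I ^^ m) (derived PLo_I H) = {id}"
      using solv n by (simp add: funpow_swap1)
    also have "\<rho> ` {id} = {id}" by (simp only: \<rho>_def image_insert image_empty restr_id)
    finally have "(derived PLo_I ^^ m) (\<rho> ` K) \<subseteq> {id}" .
    moreover have "id \<in> (derived PLo_I ^^ m) (\<rho> ` K)"
      using subgroup_PLo_id[OF group.exp_of_derived_is_subgroup[OF PLo_group sub]] .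
    ultimately show "(derived PLo_I ^^ m) (\<rho> ` K) = {id}" by blast
  qed
  then have RW: "in_R (wreath_Z A)" by (rule in_R_wreath[OF gA])
  have conjK: "ipow g (- i) \<circ> k \<circ> ipow g i \<in> K" if "k \<in> K" for i k
    using K_conj[OF that H_ipow[OF g(1), of "- i"]] ipow_neg[OF gP, of "- i"] by simp
  \<comment> \<open>Coordinate i is \<open>\<kappa> h\<close> on the interval from g^i p to g^(i+1)
    p, carried back to (p, g p).\<close>
  define \<Phi> where "\<Phi> h = (\<lambda>i. \<rho> (ipow g (- i) \<circ> \<kappa> h \<circ> ipow g i), \<phi> h)" for h
  have mem: "\<Phi> h \<in> carrier (wreath_Z A)" if h: "h \<in> H" for h
  proof -
    obtain c d where cd: "a < c" "c < d" "d < b" "\<And>x. x \<notin> {c..d} \<Longrightarrow> \<kappa> h x = x"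
      using K_compact[OF \<kappa>[OF h]] by blast
    obtain m1 where m1: "ipow g m1 p < c" using ipow_down[OF g, of p c] F_ab[OF p] cd by auto
    obtain m2 where m2: "d < ipow g m2 p" using ipow_up[OF g, of p d] F_ab[OF p] cd by auto
    have "\<rho> (ipow g (- i) \<circ> \<kappa> h \<circ> ipow g i) = id" if i: "i \<notin> {m1..m2}" for i
    proof
      fix x show "\<rho> (ipow g (- i) \<circ> \<kappa> h \<circ> ipow g i) x = id x"
      proof (cases "p < x \<and> x < g p")
        case True
        then have x: "ipow g i p < ipow g i x" "ipow g i x < ipow g (i + 1) p"
          by (simp_all add: ipow_less_iff gp_step)
        \<comment> \<open>The right end of the i-th interval carries the exponent i + 1, so for i <
          m1 the interval lies below g^m1 p and misses the support.\<close>
        have "i + 1 \<le> m1 \<or> m2 \<le> i" using i by auto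
        then have "ipow g (i + 1) p \<le> ipow g m1 p \<or> ipow g m2 p \<le> ipow g i p"
          using ipow_mono[OF g, of p] F_ab[OF p] by blast
        then have "\<kappa> h (ipow g i x) = ipow g i x" using x m1 m2 by (intro cd(4)) auto
        then show ?thesis by (simp add: \<rho>_def restr_def ipow_add_apply[OF gP])
      qed (auto simp: \<rho>_def restr_def)
    qed
    then have "{i. \<rho> (ipow g (- i) \<circ> \<kappa> h \<circ> ipow g i) \<noteq> id} \<subseteq> {m1..m2}" by blast
    then have "finite {i. \<rho> (ipow g (- i) \<circ> \<kappa> h \<circ> ipow g i) \<noteq> id}" by (rule finite_subset) simp
    then show ?thesis
      using conjK[OF \<kappa>[OF h]] unfolding \<Phi>_def wreath_simps(1) A_simps by blast
  qed
  have "\<Phi> \<in> hom (PLo_I\<lparr>carrier := H\<rparr>) (wreath_Z A)"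
  proof (rule homI)
    fix f h assume "f \<in> carrier (PLo_I\<lparr>carrier := H\<rparr>)" "h \<in> carrier (PLo_I\<lparr>carrier := H\<rparr>)"
    then have f: "f \<in> H" and h: "h \<in> H" by auto
    have "\<rho> (ipow g (- i) \<circ> \<kappa> (f \<circ> h) \<circ> ipow g i) =
      \<rho> (ipow g (- i) \<circ> \<kappa> f \<circ> ipow g i) \<circ> \<rho> (ipow g (- (i - \<phi> f)) \<circ> \<kappa> h \<circ> ipow g (i - \<phi> f))" for i
    proof -
      \<comment> \<open>The K-part of f \<circ> h is \<open>\<kappa> f\<close> times the conjugate
        of \<open>\<kappa> h\<close> by the power \<open>\<phi> f\<close> of g. This conjugation is
        the index shift of the wreath product.\<close>
      have "ipow g (- i) \<circ> \<kappa> (f \<circ> h) \<circ> ipow g i =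
        (ipow g (- i) \<circ> \<kappa> f \<circ> ipow g i) \<circ> (ipow g (- (i - \<phi> f)) \<circ> \<kappa> h \<circ> ipow g (i - \<phi> f))"
        by (simp add: \<kappa>_def \<phi>_comp[OF f h] fun_eq_iff ipow_add_apply[OF gP] algebra_simps)
      then show ?thesis using \<rho>_comp[OF conjK[OF \<kappa>[OF h]]] by metis
    qed
    then show "\<Phi> (f \<otimes>\<^bsub>PLo_I\<lparr>carrier := H\<rparr>\<^esub> h) = \<Phi> f \<otimes>\<^bsub>wreath_Z A\<^esub> \<Phi> h"
      by (simp add: \<Phi>_def wreath_simps A_simps \<phi>_comp[OF f h])
  qed (use mem in simp)
  moreover have "inj_on \<Phi> (carrier (PLo_I\<lparr>carrier := H\<rparr>))"
  proof (rule inj_onI)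
    fix f h assume "f \<in> carrier (PLo_I\<lparr>carrier := H\<rparr>)" "h \<in> carrier (PLo_I\<lparr>carrier := H\<rparr>)"
      and eq: "\<Phi> f = \<Phi> h"
    then have f: "f \<in> H" and h: "h \<in> H" by auto
    have \<phi>fh: "\<phi> f = \<phi> h" using eq by (simp add: \<Phi>_def)
    have \<rho>fh: "\<rho> (ipow g (- i) \<circ> \<kappa> f \<circ> ipow g i) = \<rho> (ipow g (- i) \<circ> \<kappa> h \<circ> ipow g i)" for i
      using fun_cong[OF arg_cong[OF eq, of fst], of i] by (simp add: \<Phi>_def)
    have "\<kappa> f x = \<kappa> h x" for x
    proof (cases "a < x \<and> x < b")
      case True
      obtain m1 where m1: "ipow g m1 p < x" using ipow_down[OF g, of p x] F_ab[OF p] True by auto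
      obtain m2 where m2: "x < ipow g m2 p" using ipow_up[OF g, of p x] F_ab[OF p] True by auto
      \<comment> \<open>The largest i with g^i p at most x selects the interval that contains
        x.\<close>
      define I where "I = {i \<in> {m1..m2}. ipow g i p \<le> x}"
      have fin: "finite I" by (rule finite_subset[of _ "{m1..m2}"]) (auto simp: I_def)
      have "m1 \<le> m2"
      proof (rule ccontr)
        assume "\<not> m1 \<le> m2"
        then show False using ipow_mono[OF g, of p m2 m1] F_ab[OF p] m1 m2 by auto
      qed
      then have "m1 \<in> I" using m1 by (simp add: I_def)
      then have iI: "Max I \<in> I" using Max_in[OF fin] by blast
      define i where "i = Max I"
      have i: "m1 \<le> i" "i \<le> m2" "ipow g i p \<le> x" using iI by (auto simp: I_def i_def)
      have "i \<noteq> m2" using i m2 by auto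
      have "i + 1 \<notin> I" using Max_ge[OF fin, of "i + 1"] by (auto simp: i_def)
      then have i1: "x < ipow g (i + 1) p" using i \<open>i \<noteq> m2\<close> by (auto simp: I_def)
      show ?thesis
      \<comment> \<open>\<open>\<rho>\<close> records nothing at the ends of the intervals; these
        lie in F, where every element of K is the identity.\<close>
      proof (cases "ipow g i p = x")
        case True
        then have "x \<in> F" using orbF by blast
        then have "\<kappa> f x = x" "\<kappa> h x = x"
          using \<kappa>[OF f] \<kappa>[OF h] unfolding F_def by blast+
        then show ?thesis by simp
      next
        case False
        define y where "y = ipow g (- i) x"
        have xy: "x = ipow g i y" by (simp add: y_def ipow_add_apply[OF gP])
        have "p < y" "y < g p"
          using False i(3) i1 ipow_less_iff[of i p y] ipow_less_iff[of i y "g p"]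
          by (simp_all add: xy gp_step)
        then have "ipow g (- i) (\<kappa> f x) = ipow g (- i) (\<kappa> h x)"
          using fun_cong[OF \<rho>fh[of i], of y] by (simp add: \<rho>_def restr_def xy)
        then show ?thesis
          using pl_homeo_eq_iff[OF PLo_setD(1)[OF ipow_PLo[OF gP]]] by blast
      qed
    next
      case False
      then have "x \<notin> {a<..<b}" by simp
      then show ?thesis using supp[OF K_H[OF \<kappa>[OF f]]] supp[OF K_H[OF \<kappa>[OF h]]] by simp
    qed
    then have "\<kappa> f = \<kappa> h" by blast
    moreover have "f = \<kappa> f \<circ> ipow g (\<phi> f)" "h = \<kappa> h \<circ> ipow g (\<phi> h)"
      by (simp_all add: \<kappa>_def fun_eq_iff ipow_add_apply[OF gP])
    ultimately show "f = h" using \<phi>fh by metis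
  qed
  ultimately show ?thesis
    using in_R_embed[OF group.subgroup_imp_group[OF PLo_group H]] RW by blast
qed

text \<open>An affine map with two fixed points is the identity; continuity brings the ends into the
  affine piece.\<close>

lemma aff_off_fixed_id:
  assumes f: "pl_homeo f" "aff_off S f" and cd: "c < d" "f c = c" "f d = d" "{c<..<d} \<inter> S = {}"
    and x: "c < x" "x < d"
  shows "f x = x"
proof -
  obtain s t where "\<And>y. y \<in> {c<..<d} \<Longrightarrow> f y = s * y + t"
    using aff_offE[OF f(2) cd(1,4)] by metis
  then have st: "f y = s * y + t" if "y \<in> {c..d}" for y
    using affine_extend[OF pl_homeo_continuous[OF f(1)] cd(1) _ that] by blast
  have "c = s * c + t" "d = s * d + t" using st[of c] st[of d] cd by auto
  then have "(s - 1) * (d - c) = 0" by (simp add: algebra_simps)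
  then have "s = 1" using cd(1) by simp
  then show ?thesis using st[of x] st[of c] cd x by simp
qed

section \<open>Orbitals of a subgroup\<close>

locale PL_subgroup =
  fixes H :: "(real \<Rightarrow> real) set"
  assumes H: "subgroup H PLo_I"
begin

lemmas HD = subgroup_PLoD[OF H]

definition fixset :: "real set" where "fixset = {x. \<forall>h\<in>H. h x = x}"
text \<open>For x not fixed by H, \<open>lo x\<close> and \<open>hi x\<close> are the ends of the
  component of the complement of \<open>fixset\<close> that contains x.\<close>

definition lo :: "real \<Rightarrow> real" where "lo x = Sup {y \<in> fixset. y \<le> x}"
definition hi :: "real \<Rightarrow> real" where "hi x = Inf {y \<in> fixset. x \<le> y}"

lemma fixset_outside: "x \<notin> {0<..<1} \<Longrightarrow> x \<in> fixset"
  using PLo_setD(2)[OF HD(1)] by (simp add: fixset_def)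

lemma fixset_invariant:
  "h \<in> H \<Longrightarrow> x \<in> {y \<in> fixset. P y} \<Longrightarrow> h x \<in> {y \<in> fixset. P y} \<and> finv h x \<in> {y \<in> fixset. P y}"
proof -
  assume h: "h \<in> H" and x: "x \<in> {y \<in> fixset. P y}"
  then have "h x = x" by (simp add: fixset_def)
  moreover have "finv h x = x" by (rule finv_fixed[OF HD(2)[OF h] calculation])
  ultimately show ?thesis using x by simp
qed

text \<open>H fixes the two sets pointwise, hence also their supremum and infimum. Both sets are
  non-empty because everything outside (0, 1) is fixed.\<close>

lemma lo_hi:
  assumes x: "x \<notin> fixset"
  shows "lo x < x" "x < hi x" "lo x \<in> fixset" "hi x \<in> fixset"
    and "\<And>y. lo x < y \<Longrightarrow> y < hi x \<Longrightarrow> y \<notin> fixset"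
proof -
  let ?L = "{y \<in> fixset. y \<le> x}" and ?U = "{y \<in> fixset. x \<le> y}"
  have "x \<in> {0<..<1}" using fixset_outside x by blast
  then have L: "?L \<noteq> {}" and U: "?U \<noteq> {}"
    using fixset_outside[of 0] fixset_outside[of 1] by fastforce+
  have bL: "bdd_above ?L" and bU: "bdd_below ?U" by (auto intro: bdd_aboveI[of _ x] bdd_belowI[of _ x])
  have "h (lo x) = lo x" if "h \<in> H" for h
    unfolding lo_def
    by (rule Sup_invariant_fixed[OF HD(2)[OF that] L bL]) (rule fixset_invariant[OF that])
  then show loF: "lo x \<in> fixset" by (simp add: fixset_def)
  have "h (hi x) = hi x" if "h \<in> H" for h
    unfolding hi_def
    by (rule Inf_invariant_fixed[OF HD(2)[OF that] U bU]) (rule fixset_invariant[OF that])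
  then show hiF: "hi x \<in> fixset" by (simp add: fixset_def)
  have "lo x \<le> x" unfolding lo_def using L by (intro cSup_least) auto
  then show "lo x < x" using loF x by (cases "lo x = x") auto
  have "x \<le> hi x" unfolding hi_def using U by (intro cInf_greatest) auto
  then show "x < hi x" using hiF x by (cases "hi x = x") auto
  fix y assume y: "lo x < y" "y < hi x"
  show "y \<notin> fixset"
  proof
    assume "y \<in> fixset"
    then have "y \<le> x \<Longrightarrow> y \<le> lo x" "x \<le> y \<Longrightarrow> hi x \<le> y"
      unfolding lo_def hi_def using bL bU by (auto intro!: cSup_upper cInf_lower)
    then show False using y by linarith
  qed
qed

lemma orbital_eq:
  assumes x: "x \<notin> fixset" and y: "lo x < y" "y < hi x"
  shows "lo y = lo x" "hi y = hi x"
proof -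
  note X = lo_hi[OF x] and Y = lo_hi[OF X(5)[OF y]]
  show "lo y = lo x"
    using X(3) X(5)[of "lo y"] Y(3) Y(5)[of "lo x"] Y(1,2) y by (meson linorder_neqE less_trans)
  show "hi y = hi x"
    using X(4) X(5)[of "hi y"] Y(4) Y(5)[of "hi x"] Y(1,2) y by (meson linorder_neqE less_trans)
qed

text \<open>The orbitals are indexed by the first rational number they contain.\<close>

definition rat_seq :: "nat \<Rightarrow> real" where "rat_seq i = of_rat (from_nat i)"

definition active :: "nat \<Rightarrow> bool" where
  "active i \<longleftrightarrow> rat_seq i \<notin> fixset \<and>
     (\<forall>j<i. rat_seq j \<notin> {lo (rat_seq i)<..<hi (rat_seq i)})"

definition orbital :: "nat \<Rightarrow> real set" where
  "orbital i = {lo (rat_seq i)<..<hi (rat_seq i)}"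

lemma active_cover:
  assumes x: "x \<notin> fixset"
  shows "\<exists>i. active i \<and> x \<in> orbital i"
proof -
  note X = lo_hi[OF x]
  obtain u where u: "lo x < of_rat u" "of_rat u < hi x"
    using of_rat_dense[of "lo x" "hi x"] X by auto
  then have ex: "rat_seq (to_nat u) \<in> {lo x<..<hi x}" by (simp add: rat_seq_def)
  define i where "i = (LEAST i. rat_seq i \<in> {lo x<..<hi x})"
  have i: "rat_seq i \<in> {lo x<..<hi x}" unfolding i_def by (rule LeastI, rule ex)
  have eq: "lo (rat_seq i) = lo x" "hi (rat_seq i) = hi x" using orbital_eq[OF x] i by auto
  have "rat_seq j \<notin> {lo x<..<hi x}" if "j < i" for j using not_less_Least that unfolding i_def by blast
  then have "active i" unfolding active_def eq using i X(5) by auto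
  then show ?thesis using X unfolding orbital_def eq[symmetric] by auto
qed

lemma active_unique:
  assumes "active i" "active j" "x \<in> orbital i" "x \<in> orbital j"
  shows "i = j"
proof -
  have ni: "rat_seq i \<notin> fixset" and nj: "rat_seq j \<notin> fixset" using assms by (auto simp: active_def)
  have x: "lo (rat_seq i) < x" "x < hi (rat_seq i)" "lo (rat_seq j) < x" "x < hi (rat_seq j)"
    using assms(3,4) by (simp_all add: orbital_def)
  have eq: "lo (rat_seq i) = lo (rat_seq j)" "hi (rat_seq i) = hi (rat_seq j)"
    using orbital_eq[OF ni x(1,2)] orbital_eq[OF nj x(3,4)] by simp_all
  have "rat_seq i \<in> orbital j" "rat_seq j \<in> orbital i"
    using lo_hi(1,2)[OF ni] lo_hi(1,2)[OF nj] eq by (auto simp: orbital_def)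
  then have "\<not> j < i" "\<not> i < j" using assms(1,2) by (auto simp: active_def orbital_def)
  then show ?thesis by simp
qed

text \<open>Inactive indices contribute a trivial factor, so that the sum runs over all natural
  numbers as in \<open>dsum\<close>.\<close>

definition proj :: "nat \<Rightarrow> (real \<Rightarrow> real) \<Rightarrow> real \<Rightarrow> real" where
  "proj i h = (if active i then restr (lo (rat_seq i)) (hi (rat_seq i)) h else id)"

lemma active_fixed:
  assumes "active i" "h \<in> H"
  shows "h (lo (rat_seq i)) = lo (rat_seq i) \<and> h (hi (rat_seq i)) = hi (rat_seq i)"
proof -
  have "rat_seq i \<notin> fixset" using assms by (simp add: active_def)
  then show ?thesis using lo_hi(3,4) assms(2) by (simp add: fixset_def)
qed

text \<open>An orbital without a break of h carries a single affine piece fixed at both ends, so h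
  is trivial there. Each of the finitely many breaks lies in at most one orbital.\<close>

lemma finite_proj:
  assumes h: "h \<in> H"
  shows "finite {i. proj i h \<noteq> id}"
proof -
  obtain S where S: "finite S" "aff_off S h" using HD(2)[OF h] unfolding pl_homeo_def by blast
  have "{i. proj i h \<noteq> id} \<subseteq> (\<Union>s\<in>S. {i. active i \<and> s \<in> orbital i})"
  proof
    fix i assume "i \<in> {i. proj i h \<noteq> id}"
    then have act: "active i" and ne: "proj i h \<noteq> id" by (auto simp: proj_def split: if_splits)
    have "orbital i \<inter> S \<noteq> {}"
    proof
      assume dis: "orbital i \<inter> S = {}"
      have "rat_seq i \<notin> fixset" using act by (simp add: active_def)
      then have lt: "lo (rat_seq i) < hi (rat_seq i)" using lo_hi(1,2) less_trans by blast
      have "proj i h x = x" for x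
        using aff_off_fixed_id[OF HD(2)[OF h] S(2) lt _ _ dis[unfolded orbital_def], of x]
          active_fixed[OF act h] by (auto simp: proj_def restr_def)
      then show False using ne by (auto simp: fun_eq_iff)
    qed
    then show "i \<in> (\<Union>s\<in>S. {i. active i \<and> s \<in> orbital i})" using act by blast
  qed
  moreover have "finite {i. active i \<and> s \<in> orbital i}" for s
  proof (cases "\<exists>i. active i \<and> s \<in> orbital i")
    case True
    then obtain i where "active i" "s \<in> orbital i" by blast
    then have "{i. active i \<and> s \<in> orbital i} \<subseteq> {i}" using active_unique by blast
    then show ?thesis by (rule finite_subset) simp
  next
    case False
    then have "{i. active i \<and> s \<in> orbital i} = {}" by blast
    then show ?thesis by (simp only: finite.emptyI)
  qed
  then have "finite (\<Union>s\<in>S. {i. active i \<and> s \<in> orbital i})" using S(1) by blast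
  ultimately show ?thesis by (rule finite_subset)
qed

lemma proj_separates:
  assumes f: "f \<in> H" and h: "h \<in> H" and eq: "\<And>i. proj i f = proj i h"
  shows "f = h"
proof
  fix x show "f x = h x"
  proof (cases "x \<in> fixset")
    case True
    then have "f x = x" "h x = x" using f h unfolding fixset_def by blast+
    then show ?thesis by simp
  next
    case False
    then obtain i where "active i" "x \<in> orbital i" using active_cover by blast
    then show ?thesis using fun_cong[OF eq[of i], of x] by (simp add: proj_def restr_def orbital_def)
  qed
qed

end

text \<open>The restrictions to the orbitals are homomorphic images of H, so they share the bound
  \<open>Suc m\<close>, as \<open>in_R_dsum\<close> requires. The descent to m takes place inside
  \<open>in_R_step\<close>.\<close>

lemma in_R_of_derived_length:
  assumes "subgroup H PLo_I" "(derived PLo_I ^^ n) H = {id}"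
  shows "in_R (PLo_I\<lparr>carrier := H\<rparr>)"
  using assms
proof (induction n arbitrary: H)
  case 0
  then show ?case using group.subgroup_imp_group[OF PLo_group] by (intro in_R_trivial) auto
next
  case (Suc m H)
  interpret PL_subgroup H by (rule PL_subgroup.intro[OF Suc.prems(1)])
  have solv: "(derived PLo_I ^^ Suc m) H = {id}" by (rule Suc.prems(2))
  define L where "L i = proj i ` H" for i
  have sub: "subgroup (L i) PLo_I" for i
  proof (cases "active i")
    case True
    then have "L i = restr (lo (rat_seq i)) (hi (rat_seq i)) ` H" by (simp add: L_def proj_def)
    then show ?thesis using subgroup_restr[OF H active_fixed[OF True]] by simp
  next
    case False
    then have "L i = {id}" using subgroup_PLo_id[OF H] by (auto simp: L_def proj_def)
    then show ?thesis using group.triv_subgroup[OF PLo_group] by simp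
  qed
  have dl: "(derived PLo_I ^^ Suc m) (L i) = {id}" for i
  proof (cases "active i")
    case True
    then have "L i = restr (lo (rat_seq i)) (hi (rat_seq i)) ` H" by (simp add: L_def proj_def)
    then show ?thesis
      using derived_restr[OF H active_fixed[OF True] order_refl, of "Suc m"] solv by simp
  next
    case False
    then have Li: "L i = {id}" using subgroup_PLo_id[OF H] by (auto simp: L_def proj_def)
    have "(derived PLo_I ^^ Suc m) (L i) \<subseteq> L i"
      using derived_exp_consistent[OF PLo_group sub order_refl] by blast
    then show ?thesis
      using Li subgroup_PLo_id[OF group.exp_of_derived_is_subgroup[OF PLo_group sub]] by blast
  qed
  have inR: "in_R (PLo_I\<lparr>carrier := L i\<rparr>)" for i
  proof (cases "active i")
    case True
    let ?a = "lo (rat_seq i)" and ?b = "hi (rat_seq i)"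
    have Li: "L i = restr ?a ?b ` H" using True by (simp add: L_def proj_def)
    have nf: "rat_seq i \<notin> fixset" using True by (simp add: active_def)
    interpret one_orbital "L i" ?a ?b "Suc m"
    proof (rule one_orbital.intro[OF sub _ _ _ dl])
      show "?a < ?b" using lo_hi(1,2)[OF nf] by linarith
      show "h x = x" if "h \<in> L i" "x \<notin> {?a<..<?b}" for h x
        using that by (auto simp: Li restr_def)
      show "\<exists>h\<in>L i. h p \<noteq> p" if p: "?a < p" "p < ?b" for p
      proof -
        obtain h where "h \<in> H" "h p \<noteq> p" using lo_hi(5)[OF nf p] by (auto simp: fixset_def)
        then show ?thesis using p by (auto simp: Li restr_def)
      qed
    qed
    show ?thesis using in_R_step[OF refl] Suc.IH by blast
  next
    case False
    then have "L i = {id}" using subgroup_PLo_id[OF H] by (auto simp: L_def proj_def)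
    then show ?thesis
      by (intro in_R_trivial group.subgroup_imp_group[OF PLo_group sub]) simp
  qed
  define A where "A i = PLo_I\<lparr>carrier := L i\<rparr>" for i
  have gA: "group (A i)" for i unfolding A_def by (rule group.subgroup_imp_group[OF PLo_group sub])
  have "in_R (dsum A)"
  proof (rule in_R_dsum[OF gA])
    show "in_R (A i)" for i using inR by (simp add: A_def)
    show "derived_length_le (A i) (Suc m)" for i
      unfolding A_def derived_length_le_subgroup[OF PLo_group sub] using dl by simp
  qed
  moreover have "(\<lambda>h i. proj i h) \<in> hom (PLo_I\<lparr>carrier := H\<rparr>) (dsum A)"
  proof (rule homI)
    fix h assume "h \<in> carrier (PLo_I\<lparr>carrier := H\<rparr>)"
    then show "(\<lambda>i. proj i h) \<in> carrier (dsum A)"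
      using finite_proj by (simp add: dsum_simps A_def L_def)
  next
    fix f h assume "f \<in> carrier (PLo_I\<lparr>carrier := H\<rparr>)" "h \<in> carrier (PLo_I\<lparr>carrier := H\<rparr>)"
    then have h: "h \<in> H" by simp
    have "proj i (f \<circ> h) = proj i f \<circ> proj i h" for i
      using active_fixed[OF _ h] HD(2)[OF h] by (simp add: proj_def restr_comp)
    then show "(\<lambda>i. proj i (f \<otimes>\<^bsub>PLo_I\<lparr>carrier := H\<rparr>\<^esub> h)) = (\<lambda>i. proj i f) \<otimes>\<^bsub>dsum A\<^esub> (\<lambda>i. proj i h)"
      by (simp add: dsum_simps A_def)
  qed
  moreover have "inj_on (\<lambda>h i. proj i h) (carrier (PLo_I\<lparr>carrier := H\<rparr>))"
    using proj_separates by (auto intro!: inj_onI simp: fun_eq_iff[of "\<lambda>i. proj i _"])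
  ultimately show ?case
    using in_R_embed[OF group.subgroup_imp_group[OF PLo_group H]] by blast
qed

theorem theorem1:
  fixes H :: "('h, 'm) monoid_scheme"
  assumes "group H"
  shows "(\<exists>K. subgroup K PLo_I \<and> solvable (PLo_I\<lparr>carrier := K\<rparr>) \<and> H \<cong> PLo_I\<lparr>carrier := K\<rparr>)
         \<longleftrightarrow> (\<exists>G \<in> R_class. H \<cong> G)"
proof
  assume "\<exists>K. subgroup K PLo_I \<and> solvable (PLo_I\<lparr>carrier := K\<rparr>) \<and> H \<cong> PLo_I\<lparr>carrier := K\<rparr>"
  then obtain K where K: "subgroup K PLo_I" "solvable (PLo_I\<lparr>carrier := K\<rparr>)"
    "H \<cong> PLo_I\<lparr>carrier := K\<rparr>" by blast
  obtain n where "derived_length_le (PLo_I\<lparr>carrier := K\<rparr>) n"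
    using K(2) solvable_iff_derived_length_le[OF group.subgroup_imp_group[OF PLo_group K(1)]] by blast
  then have "(derived PLo_I ^^ n) K = {id}"
    using derived_length_le_subgroup[OF PLo_group K(1)] by simp
  then have "in_R (PLo_I\<lparr>carrier := K\<rparr>)" by (rule in_R_of_derived_length[OF K(1)])
  then show "\<exists>G\<in>R_class. H \<cong> G" unfolding in_R_def using K(3) iso_trans by blast
next
  assume "\<exists>G\<in>R_class. H \<cong> G"
  then obtain G \<psi> where G: "G \<in> R_class" and \<psi>: "\<psi> \<in> iso H G" by (auto simp: is_iso_def)
  have \<psi>h: "\<psi> \<in> hom H G" "inj_on \<psi> (carrier H)" using \<psi> by (auto simp: iso_def bij_betw_def)
  obtain n where n: "derived_length_le G n" and "PL_embeddable G" using R_class_PL[OF G] by blast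
  then obtain \<Phi> where \<Phi>: "\<Phi> \<in> hom H PLo_I" "inj_on \<Phi> (carrier H)"
    using PL_embeddable_embed[OF _ \<psi>h] unfolding PL_embeddable_def by blast
  interpret \<Phi>: group_hom H PLo_I \<Phi>
    using assms PLo_group \<Phi> by (simp add: group_hom_def group_hom_axioms_def)
  let ?K = "\<Phi> ` carrier H"
  have K: "subgroup ?K PLo_I" by (rule \<Phi>.img_is_subgroup)
  have dl: "derived_length_le H n"
    by (rule derived_length_le_embed[OF assms R_class_group[OF G] \<psi>h n])
  \<comment> \<open>The homomorphism carries the derived series of H onto that of its image, so the
    image is solvable.\<close>
  have "(derived PLo_I ^^ n) ?K = \<Phi> ` {\<one>\<^bsub>H\<^esub>}"
    using \<Phi>.exp_of_derived_img[OF order_refl, of n] dl by (simp add: derived_length_le_def)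
  then have "derived_length_le (PLo_I\<lparr>carrier := ?K\<rparr>) n"
    using derived_length_le_subgroup[OF PLo_group K] \<Phi>.hom_one by simp
  then have "solvable (PLo_I\<lparr>carrier := ?K\<rparr>)"
    using solvable_iff_derived_length_le[OF group.subgroup_imp_group[OF PLo_group K]] by blast
  moreover have "\<Phi> \<in> iso H (PLo_I\<lparr>carrier := ?K\<rparr>)"
    using \<Phi> by (auto simp: iso_def hom_def bij_betw_def)
  ultimately show "\<exists>K. subgroup K PLo_I \<and> solvable (PLo_I\<lparr>carrier := K\<rparr>) \<and> H \<cong> PLo_I\<lparr>carrier := K\<rparr>"
    using K is_isoI by blast
qed

end
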